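(* Let $G$ be a finite group and $m$ a positive integer. If $G$ has a normal subgroup $N$ such that $G/N\cong C_m\ltimes_{\varphi} C_m$ (for some homomorphism $\varphi$), then $$|G|+\mathsf d(G)\le \mathsf E(G)\le |G|+\frac{|G|}{m}+m-2.$$ In particular, if $G\cong C_m\ltimes_{\varphi} C_{mn}$, where $m,n$ are positive integers, then $$\mathsf E(G)=|G|+\mathsf d(G)=m^2n+mn+m-2,$$ and consequently $\mathsf d(G)=mn+m-2$.
   Context: Groups are written multiplicatively with identity $1$. A sequence over $G$ is a finite unordered list of elements of $G$ with repetition allowed (an element of the free abelian monoid on $G$); its length $|S|$ is the number of terms. A sequence $S=a_1\cdot\ldots\cdot a_k$ is product-one if $1=a_{\tau(1)}\cdots a_{\tau(k)}$ for some permutation $\tau$ of $\{1,\dots,k\}$; it is product-one free if it has no nonempty product-one subsequence. The small Davenport constant $\mathsf d(G)$ is the maximal length of a product-one free sequence over $G$. $\mathsf E(G)$ is the smallest integer $l$ such that every sequence over $G$ of length at least $l$ has a product-one subsequence of length exactly $|G|$. For positive integers $a,b$, $C_a\ltimes_{\varphi} C_b$ denotes a semidirect product of a normal cyclic subgroup of order $b$ by a cyclic subgroup of order $a$ with respect to any homomorphism $\varphi:C_a\to\mathrm{Aut}(C_b)$; i.e. a group generated by $x,y$ with $\mathrm{ord}(x)=b$, $\mathrm{ord}(y)=a$, $\langle x\rangle\cap\langle y\rangle=\{1\}$ and $yxy^{-1}=x^s$ for some integer $s$ with $1\le s\le b-1$ (necessarily $s^a\equiv 1\pmod b$). *)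

theory Defs
  imports "HOL-Algebra.Algebra" "HOL-Library.Multiset"
begin

text \<open>
  A sequence over \<open>G\<close> is a multiset of elements of \<open>G\<close>: its length is \<^const>\<open>size\<close> and its
  subsequences are its submultisets.
\<close>

definition sequence_over :: "('a, 'b) monoid_scheme \<Rightarrow> 'a multiset \<Rightarrow> bool" where
  "sequence_over G S \<longleftrightarrow> set_mset S \<subseteq> carrier G"

text \<open>
  The lists \<open>as\<close> with \<open>mset as = S\<close> are the orderings of the terms of \<open>S\<close>.
  The empty sequence is product-one.
\<close>

definition product_one :: "('a, 'b) monoid_scheme \<Rightarrow> 'a multiset \<Rightarrow> bool" where
  "product_one G S \<longleftrightarrow> (\<exists>as. mset as = S \<and> foldr (\<otimes>\<^bsub>G\<^esub>) as \<one>\<^bsub>G\<^esub> = \<one>\<^bsub>G\<^esub>)"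

definition product_one_free :: "('a, 'b) monoid_scheme \<Rightarrow> 'a multiset \<Rightarrow> bool" where
  "product_one_free G S \<longleftrightarrow> \<not> (\<exists>T. T \<subseteq># S \<and> T \<noteq> {#} \<and> product_one G T)"

text \<open>
  For a finite group \<open>G\<close> the maximum and the minimum in the next two definitions exist;
  nothing is claimed for other \<open>G\<close>.
\<close>

definition small_davenport :: "('a, 'b) monoid_scheme \<Rightarrow> nat" where
  "small_davenport G = Max {size S |S. sequence_over G S \<and> product_one_free G S}"

definition E_constant :: "('a, 'b) monoid_scheme \<Rightarrow> nat" where
  "E_constant G =
    (LEAST l. \<forall>S. sequence_over G S \<and> l \<le> size S \<longrightarrow>
       (\<exists>T. T \<subseteq># S \<and> size T = order G \<and> product_one G T))"

text \<open>
  The semidirect product of \<open>N\<close> by \<open>H\<close>. The pair \<open>(h, n)\<close> stands for the product \<open>n h\<close>, and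
  \<open>h n h\<^sup>-\<^sup>1 = \<phi> h n\<close>, so that the second factor is the normal one.
\<close>

definition semidirect_product ::
  "('h, 'c) monoid_scheme \<Rightarrow> ('h \<Rightarrow> 'n \<Rightarrow> 'n) \<Rightarrow> ('n, 'd) monoid_scheme \<Rightarrow> ('h \<times> 'n) monoid" where
  "semidirect_product H \<phi> N =
    \<lparr>carrier = carrier H \<times> carrier N,
     monoid.mult = (\<lambda>(h, n) (h', n'). (h \<otimes>\<^bsub>H\<^esub> h', n \<otimes>\<^bsub>N\<^esub> \<phi> h n')),
     one = (\<one>\<^bsub>H\<^esub>, \<one>\<^bsub>N\<^esub>)\<rparr>"

lemma group_semidirect_product:
  assumes "group H" "group N" and \<phi>: "\<phi> \<in> hom H (AutoGroup N)"
  shows "group (semidirect_product H \<phi> N)"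
proof -
  interpret H: group H by fact
  interpret N: group N by fact
  interpret A: group "AutoGroup N" by (rule N.AutoGroup)
  interpret \<phi>: group_hom H "AutoGroup N" \<phi>
    by unfold_locales (rule \<phi>)
  have auto: "\<phi> h \<in> auto N" if "h \<in> carrier H" for h
    using \<phi>.hom_closed[OF that] by (simp add: AutoGroup_def)
  have cl: "\<phi> h n \<in> carrier N" if "h \<in> carrier H" "n \<in> carrier N" for h n
    using auto[OF that(1)] that(2) by (auto simp: auto_def hom_def)
  have mult: "\<phi> h (n \<otimes>\<^bsub>N\<^esub> n') = \<phi> h n \<otimes>\<^bsub>N\<^esub> \<phi> h n'"
    if "h \<in> carrier H" "n \<in> carrier N" "n' \<in> carrier N" for h n n'
    using auto[OF that(1)] that(2,3) by (auto simp: auto_def hom_def)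
  have comp: "\<phi> (h \<otimes>\<^bsub>H\<^esub> h') n = \<phi> h (\<phi> h' n)"
    if "h \<in> carrier H" "h' \<in> carrier H" "n \<in> carrier N" for h h' n
    using \<phi>.hom_mult[OF that(1,2)] auto[OF that(1)] auto[OF that(2)] that(3)
    by (simp add: AutoGroup_def BijGroup_def auto_def compose_eq)
  have one: "\<phi> \<one>\<^bsub>H\<^esub> n = n" if "n \<in> carrier N" for n
    using \<phi>.hom_one that by (simp add: AutoGroup_def BijGroup_def)
  show ?thesis
  proof (rule groupI)
    fix x assume "x \<in> carrier (semidirect_product H \<phi> N)"
    then obtain h n where x: "x = (h, n)" "h \<in> carrier H" "n \<in> carrier N"
      by (auto simp: semidirect_product_def)
    have "(inv\<^bsub>H\<^esub> h, \<phi> (inv\<^bsub>H\<^esub> h) (inv\<^bsub>N\<^esub> n)) \<otimes>\<^bsub>semidirect_product H \<phi> N\<^esub> x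
        = \<one>\<^bsub>semidirect_product H \<phi> N\<^esub>"
      using x mult[of "inv\<^bsub>H\<^esub> h" "inv\<^bsub>N\<^esub> n" n] mult[of "inv\<^bsub>H\<^esub> h" "\<one>\<^bsub>N\<^esub>" "\<one>\<^bsub>N\<^esub>"]
        cl[of "inv\<^bsub>H\<^esub> h" "\<one>\<^bsub>N\<^esub>"]
      by (simp add: semidirect_product_def)
    then show "\<exists>y\<in>carrier (semidirect_product H \<phi> N).
        y \<otimes>\<^bsub>semidirect_product H \<phi> N\<^esub> x = \<one>\<^bsub>semidirect_product H \<phi> N\<^esub>"
      using x cl[of "inv\<^bsub>H\<^esub> h" "inv\<^bsub>N\<^esub> n"]
      by (intro bexI[of _ "(inv\<^bsub>H\<^esub> h, \<phi> (inv\<^bsub>H\<^esub> h) (inv\<^bsub>N\<^esub> n))"])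
        (simp_all add: semidirect_product_def del: \<phi>.hom_inv)
  qed (auto simp: semidirect_product_def cl mult comp one H.m_assoc N.m_assoc
        simp del: \<phi>.hom_mult \<phi>.hom_one)
qed

text \<open>
  \<open>cyclic_semidirect_product a \<phi> b\<close> is \<open>C\<^sub>a \<ltimes>\<^sub>\<phi> C\<^sub>b\<close> for \<open>a, b > 0\<close>; note that
  \<^term>\<open>integer_mod_group 0\<close> is the infinite cyclic group.
\<close>

definition cyclic_semidirect_product :: "nat \<Rightarrow> (int \<Rightarrow> int \<Rightarrow> int) \<Rightarrow> nat \<Rightarrow> (int \<times> int) monoid" where
  "cyclic_semidirect_product a \<phi> b =
    semidirect_product (integer_mod_group a) \<phi> (integer_mod_group b)"

definition cyclic_actions :: "nat \<Rightarrow> nat \<Rightarrow> (int \<Rightarrow> int \<Rightarrow> int) set" where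
  "cyclic_actions a b = hom (integer_mod_group a) (AutoGroup (integer_mod_group b))"

end

(*
  Groups are written additively, without commutativity. Olson's theorem (every sequence of length
  2|A| - 1 over A has a zero-sum subsequence of length |A|) is proved by letting a set B of sums
  of s terms grow: with two distinct further terms a and b, the set (B + a) \<union> (B + b) has as many
  elements more than B as B + a - b has outside B. By an isoperimetric argument in Cayley graphs
  this growth is zero, or at least the order of each group of periods of B. If the growth stops
  too early, then the remaining terms lie in a coset of a proper subgroup, and induction applies.

  For the upper bound, let p be the least prime divisor of m. The quotient C_m \<ltimes> C_m maps onto
  C_p \<times> C_p, because the action is trivial modulo p. By Reiher's theorem (among 4p - 3 elements of
  C_p \<times> C_p, some p have sum zero) the terms of the sequence can be packed into blocks of p terms
  with sum in the kernel, which is of the same kind with m / p in place of m. The last 3p - 2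
  terms only give a block of p or 2p terms; in the second case its sum counts twice.

  The lower bound |G| + d(G) comes from adding |G| - 1 copies of the identity to a product-one
  free sequence; over C_m \<ltimes> C_mn, the sequence x^(mn - 1) y^(m - 1) is product-one free.
*)

theory Submission
  imports Defs "HOL-Number_Theory.Residues"
begin

section \<open>Growth under translations\<close>

text \<open>The constant is best read through \<open>c + 2\<close>, where \<open>|A| + c\<close> is
  the bound for a group \<open>A\<close>. Olson gives \<open>c + 2 = k + 1\<close> for a group of
  order \<open>k\<close>; each passage from a kernel to the larger group multiplies
  \<open>c + 2\<close> by \<open>p\<close>; so \<open>c + 2 = m k + m\<close> at the end, where
  \<open>|G| = m^2 k\<close>. To have exactly the factor \<open>p\<close> is the obstacle: a last
  block of \<open>p\<close> terms is certain only among \<open>4 p - 3\<close> terms, and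
  \<open>3 p - 2\<close> are left. A block of \<open>2 p\<close> terms yields one sum in place of
  two, so the bound for the kernel has to be used one term too early, where a strengthened form of
  it still holds. Olson's theorem is needed without hypotheses, since nothing is known about
  \<open>N\<close>. Its induction keeps the length \<open>n\<close> while the subgroup shrinks, and
  it speaks of cosets, because terms get trapped in a subgroup only up to translation by an element
  that normalizes it. For \<open>C_m\<close> acting on \<open>C_mn\<close>, reducing the second
  coordinate modulo \<open>m\<close> gives the required quotient with \<open>|N| = n\<close>; the
  upper bound then meets the lower bound from the explicit free sequence.\<close>

definition add_subgroup :: "'g::group_add set \<Rightarrow> bool" where
  "add_subgroup H \<longleftrightarrow> 0 \<in> H \<and> (\<forall>x\<in>H. \<forall>y\<in>H. x + y \<in> H) \<and> (\<forall>x\<in>H. - x \<in> H)"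

lemma add_subgroupD:
  assumes "add_subgroup H"
  shows "0 \<in> H" "\<And>x y. x \<in> H \<Longrightarrow> y \<in> H \<Longrightarrow> x + y \<in> H" "\<And>x. x \<in> H \<Longrightarrow> - x \<in> H"
    "\<And>x y. x \<in> H \<Longrightarrow> y \<in> H \<Longrightarrow> x - y \<in> H"
  using assms unfolding add_subgroup_def by (auto simp: diff_conv_add_uminus simp del:
      add_uminus_conv_diff)

lemma finite_add_subgroupI:
  assumes "finite H" "0 \<in> H" "\<And>x y. x \<in> H \<Longrightarrow> y \<in> H \<Longrightarrow> x + y \<in> H"
  shows "add_subgroup H"
proof -
  have "- x \<in> H" if x: "x \<in> H" for x
  proof -
    have "(+) x ` H \<subseteq> H" using assms x by auto
    then have "(+) x ` H = H"
      using assms(1) by (intro endo_inj_surj) (auto simp: inj_on_def)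
    then obtain y where y: "y \<in> H" "0 = x + y" using assms(2) by blast
    then have "y = - x" by (metis minus_unique)
    then show ?thesis using y by simp
  qed
  then show ?thesis unfolding add_subgroup_def using assms by blast
qed

definition rtrans :: "'g::group_add set \<Rightarrow> 'g \<Rightarrow> 'g set" where
  "rtrans B a = (\<lambda>x. x + a) ` B"

definition ltrans :: "'g::group_add \<Rightarrow> 'g set \<Rightarrow> 'g set" where
  "ltrans a B = (+) a ` B"

definition rstab :: "'g::group_add set \<Rightarrow> 'g set" where
  "rstab B = {a. rtrans B a = B}"

text \<open>The number of edges leaving \<open>B\<close> in the Cayley graph of right translation by
  \<open>k\<close>; also what a pair of terms with difference \<open>k\<close> gains.\<close>

definition growth :: "'g::group_add set \<Rightarrow> 'g \<Rightarrow> nat" where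
  "growth B k = card (rtrans B k - B)"

definition gen :: "'g::group_add set \<Rightarrow> 'g set" where
  "gen S = \<Inter>{H. add_subgroup H \<and> S \<subseteq> H}"

section \<open>Calculus of translates, periods and growth\<close>

lemma mem_rtrans_iff: "y \<in> rtrans B a \<longleftrightarrow> y - a \<in> B"
  unfolding rtrans_def by (metis (no_types, lifting) diff_add_cancel add_diff_cancel image_iff)

lemma mem_ltrans_iff: "y \<in> ltrans a B \<longleftrightarrow> - a + y \<in> B"
  unfolding ltrans_def by (metis (no_types, lifting) add.assoc image_iff left_minus right_minus
      add_0_left)

lemma rtransI: "x \<in> B \<Longrightarrow> x + a \<in> rtrans B a"
  by (simp add: mem_rtrans_iff)

lemma finite_rtrans [simp]: "finite B \<Longrightarrow> finite (rtrans B a)"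
  by (simp add: rtrans_def)

lemma finite_ltrans [simp]: "finite B \<Longrightarrow> finite (ltrans a B)"
  by (simp add: ltrans_def)

lemma rtrans_empty_iff [simp]: "rtrans B a = {} \<longleftrightarrow> B = {}"
  by (simp add: rtrans_def)

lemma ltrans_empty_iff [simp]: "ltrans a B = {} \<longleftrightarrow> B = {}"
  by (simp add: ltrans_def)

lemma rtrans_rtrans: "rtrans (rtrans B a) b = rtrans B (a + b)"
  by (auto simp: rtrans_def image_image add.assoc)

lemma rtrans_zero [simp]: "rtrans B 0 = B" by (simp add: rtrans_def)

lemma rtrans_insert: "rtrans (insert p B) a = insert (p + a) (rtrans B a)"
  by (simp add: rtrans_def)

lemma card_rtrans [simp]: "card (rtrans B a) = card B"
  unfolding rtrans_def by (rule card_image) (auto simp: inj_on_def)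

lemma card_ltrans [simp]: "card (ltrans a B) = card B"
  unfolding ltrans_def by (rule card_image) (auto simp: inj_on_def)

lemma rtrans_ltrans: "rtrans (ltrans g B) a = ltrans g (rtrans B a)"
  by (auto simp: rtrans_def ltrans_def image_image add.assoc)

lemma rtrans_mono: "B \<subseteq> Y \<Longrightarrow> rtrans B a \<subseteq> rtrans Y a"
  by (auto simp: rtrans_def)

lemma rtrans_Un: "rtrans (B \<union> Y) a = rtrans B a \<union> rtrans Y a"
  by (auto simp: mem_rtrans_iff)

lemma rtrans_Int: "rtrans (B \<inter> Y) a = rtrans B a \<inter> rtrans Y a"
  by (auto simp: mem_rtrans_iff)

lemma rtrans_Diff: "rtrans (B - Y) a = rtrans B a - rtrans Y a"
  by (auto simp: mem_rtrans_iff)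

lemma rtrans_eq_iff: "rtrans B a = rtrans B b \<longleftrightarrow> a - b \<in> rstab B"
proof -
  have "rtrans B a = rtrans B b \<longleftrightarrow> rtrans (rtrans B a) (- b) = rtrans (rtrans B b) (- b)"
    by (metis (no_types, lifting) rtrans_rtrans add.right_inverse rtrans_zero add.assoc left_minus
        add_0_right)
  also have "\<dots> \<longleftrightarrow> rtrans B (a - b) = B"
    by (simp add: rtrans_rtrans)
  finally show ?thesis by (simp add: rstab_def)
qed

lemma rstab_add_subgroup: "add_subgroup (rstab B)"
proof -
  have "rtrans B (- a) = B" if "rtrans B a = B" for a
    by (metis that rtrans_rtrans right_minus rtrans_zero)
  then show ?thesis
    unfolding add_subgroup_def rstab_def
    by (auto simp flip: rtrans_rtrans)
qed

lemma finite_rtrans_eqI: "finite B \<Longrightarrow> rtrans B a \<subseteq> B \<Longrightarrow> rtrans B a = B"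
  by (rule card_seteq) auto

lemma growth_eq_0_iff: "finite B \<Longrightarrow> growth B k = 0 \<longleftrightarrow> k \<in> rstab B"
  unfolding growth_def rstab_def using finite_rtrans_eqI[of B k] by auto

text \<open>Translation by \<open>- b\<close> turns the part of \<open>B + a\<close> outside
  \<open>B + b\<close> into the part of \<open>B + (a - b)\<close> outside \<open>B\<close>. So the
  gain depends only on the difference of the two terms.\<close>

lemma card_Un_rtrans:
  assumes "finite B"
  shows "card (rtrans B a \<union> rtrans B b) = card B + growth B (a - b)"
proof -
  have "rtrans B a - rtrans B b = rtrans (rtrans B (a - b) - B) b"
    by (simp add: rtrans_Diff rtrans_rtrans)
  then have "card (rtrans B a - rtrans B b) = growth B (a - b)"
    unfolding growth_def by simp
  moreover have "rtrans B a \<union> rtrans B b = rtrans B b \<union> (rtrans B a - rtrans B b)" by auto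
  moreover have "card (rtrans B b \<union> (rtrans B a - rtrans B b))
      = card (rtrans B b) + card (rtrans B a - rtrans B b)"
    using assms by (intro card_Un_disjoint) auto
  ultimately show ?thesis by simp
qed

text \<open>Left translations commute with right translations, so they are automorphisms of the
  Cayley graph.\<close>

lemma growth_ltrans: "growth (ltrans g B) k = growth B k"
proof -
  have "rtrans (ltrans g B) k - ltrans g B = ltrans g (rtrans B k - B)"
    unfolding rtrans_ltrans by (auto simp: mem_ltrans_iff)
  then show ?thesis unfolding growth_def by simp
qed

text \<open>Submodularity of cuts: a point counted on the left is counted at least as often on the
  right.\<close>

lemma growth_Int_Un:
  assumes "finite B" "finite Y"
  shows "growth (B \<inter> Y) k + growth (B \<union> Y) k \<le> growth B k + growth Y k"
proof -
  let ?a = "rtrans (B \<inter> Y) k - B \<inter> Y" and ?b = "rtrans (B \<union> Y) k - (B \<union> Y)"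
  let ?c = "rtrans B k - B" and ?d = "rtrans Y k - Y"
  have fin: "finite ?a" "finite ?b" "finite ?c" "finite ?d" using assms by auto
  have "?a \<union> ?b \<subseteq> ?c \<union> ?d" "?a \<inter> ?b \<subseteq> ?c \<inter> ?d" by (auto simp: mem_rtrans_iff)
  then have "card (?a \<union> ?b) \<le> card (?c \<union> ?d)" "card (?a \<inter> ?b) \<le> card (?c \<inter> ?d)"
    using fin by (auto intro!: card_mono)
  then show ?thesis unfolding growth_def
    using card_Un_Int[OF fin(1,2)] card_Un_Int[OF fin(3,4)] by linarith
qed

text \<open>As many edges enter a finite set as leave it, because the set and its translate have
  equal size.\<close>

lemma growth_compl:
  assumes "finite L" "B \<subseteq> L" "rtrans L k = L"
  shows "growth (L - B) k = growth B k"
proof -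
  have fX: "finite B" using assms finite_subset by blast
  have "rtrans (L - B) k - (L - B) = B - rtrans B k"
    unfolding rtrans_Diff assms(3) using assms(2) assms(3) by blast
  moreover have "card (B - rtrans B k) = card (rtrans B k - B)"
    using card_le_sym_Diff[of B "rtrans B k"] card_le_sym_Diff[of "rtrans B k" B] fX by simp
  ultimately show ?thesis unfolding growth_def by simp
qed

lemma gen_add_subgroup: "add_subgroup (gen S)"
  unfolding gen_def add_subgroup_def by auto

lemma gen_superset: "S \<subseteq> gen S" unfolding gen_def by auto

lemma gen_least: "add_subgroup H \<Longrightarrow> S \<subseteq> H \<Longrightarrow> gen S \<subseteq> H" unfolding gen_def by auto

lemma rtrans_add_subgroup:
  assumes "add_subgroup L" "k \<in> L"
  shows "rtrans L k = L"
proof (rule Set.set_eqI)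
  show "x \<in> rtrans L k \<longleftrightarrow> x \<in> L" for x
    using add_subgroupD(2)[OF assms(1), of "x - k" k] add_subgroupD(4)[OF assms(1), of x k] assms(2)
    unfolding mem_rtrans_iff diff_add_cancel by blast
qed

lemma ltrans_add_subgroup:
  assumes "add_subgroup L" "k \<in> L"
  shows "ltrans k L = L"
proof (rule Set.set_eqI)
  have "k + (- k + x) = x" for x by (simp flip: add.assoc)
  then show "x \<in> ltrans k L \<longleftrightarrow> x \<in> L" for x
    using add_subgroupD(2)[OF assms, of "- k + x"] add_subgroupD(2)[OF assms(1), of "- k" x]
      add_subgroupD(3)[OF assms] unfolding mem_ltrans_iff by fastforce
qed

lemma rstab_iff: "finite B \<Longrightarrow> a \<in> rstab B \<longleftrightarrow> (\<forall>x\<in>B. x + a \<in> B)"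
  using finite_rtrans_eqI[of B a] unfolding rstab_def by (auto simp: rtrans_def)

lemma rstab_ltrans [simp]: "rstab (ltrans g B) = rstab B"
proof -
  have "ltrans g C = ltrans g D \<longleftrightarrow> C = D" for C D :: "'a set"
    unfolding ltrans_def by (rule inj_image_eq_iff) (auto simp: inj_on_def)
  then show ?thesis unfolding rstab_def rtrans_ltrans by simp
qed

lemma rstab_Int_Un:
  assumes "J \<subseteq> rstab B" "J \<subseteq> rstab C"
  shows "J \<subseteq> rstab (B \<inter> C)" "J \<subseteq> rstab (B \<union> C)" "J \<subseteq> rstab (B - C)"
  using assms unfolding rstab_def by (auto simp: rtrans_Int rtrans_Un rtrans_Diff subset_iff)

text \<open>
  Minimum edge cuts in Cayley graphs: a set of minimal size among those with the least growth
  meets a left translate of itself only if they coincide, by submodularity, and is therefore a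
  coset of a subgroup.
\<close>

lemma card_le_growth_generated:
  assumes L: "finite L" "add_subgroup L" "gen (insert k J) = L" and J: "add_subgroup J"
    and Z: "Z \<subseteq> L" "Z \<noteq> {}" "Z \<noteq> L" "J \<subseteq> rstab Z"
  shows "card J \<le> growth Z k"
proof -
  define F where "F = {Z. Z \<subseteq> L \<and> Z \<noteq> {} \<and> Z \<noteq> L \<and> J \<subseteq> rstab Z}"
  have kL: "k \<in> L" and JL: "J \<subseteq> L" using gen_superset[of "insert k J"] L(3) by auto
  have ZF: "Z \<in> F" using Z by (simp add: F_def)
  obtain Y0 where Y0: "Y0 \<in> F" "\<And>Y. Y \<in> F \<Longrightarrow> growth Y0 k \<le> growth Y k"
    using ex_has_least_nat[of "\<lambda>Y. Y \<in> F" Z "\<lambda>Y. growth Y k"] ZF by auto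
  define F' where "F' = {Y \<in> F. growth Y k = growth Y0 k}"
  obtain Y1 where Y1: "Y1 \<in> F'" "\<And>Y. Y \<in> F' \<Longrightarrow> card Y1 \<le> card Y"
    using ex_has_least_nat[of "\<lambda>Y. Y \<in> F'" Y0 card] Y0(1) by (auto simp: F'_def)
  have trans: "ltrans g Y \<in> F'" if "Y \<in> F'" "g \<in> L" for g Y
  proof -
    have "ltrans g Y \<subseteq> L"
      using that add_subgroupD(2)[OF L(2)] unfolding F'_def F_def ltrans_def by blast
    moreover have "ltrans g Y \<noteq> L"
    proof -
      have "Y \<subset> L" using that by (auto simp: F'_def F_def)
      then have "card Y < card L" by (rule psubset_card_mono[OF L(1)])
      then show ?thesis using card_ltrans[of g Y] by auto
    qed
    ultimately show ?thesis
      using that by (simp add: F'_def F_def growth_ltrans)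
  qed
  obtain y1 where y1: "y1 \<in> Y1" "y1 \<in> L" using Y1(1) by (auto simp: F'_def F_def)
  define Y where "Y = ltrans (- y1) Y1"
  have YF': "Y \<in> F'" unfolding Y_def by (rule trans[OF Y1(1) add_subgroupD(3)[OF L(2) y1(2)]])
  have Ymin: "card Y \<le> card C" if "C \<in> F'" for C using Y1(2)[OF that] by (simp add: Y_def)
  have Y: "Y \<subseteq> L" "Y \<noteq> L" "J \<subseteq> rstab Y" "growth Y k = growth Y0 k" and "0 \<in> Y"
    using YF' y1 by (auto simp: F'_def F_def Y_def mem_ltrans_iff)
  have finY: "finite Y" using Y(1) L(1) finite_subset by blast
  have JstabL: "J \<subseteq> rstab L" using JL L(2) rtrans_add_subgroup by (auto simp: rstab_def)
  \<comment> \<open>The complement has the same growth, so minimality keeps \<open>Y\<close> below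
    half of \<open>L\<close>. Hence the union of two translates that meet cannot be all of
    \<open>L\<close>.\<close>
  have "L - Y \<in> F'"
    using Y growth_compl[OF L(1) Y(1) rtrans_add_subgroup[OF L(2) kL]] rstab_Int_Un(3)[OF JstabL
        Y(3)] \<open>0 \<in> Y\<close>
    by (auto simp: F'_def F_def)
  then have "card Y \<le> card L - card Y"
    using Ymin[of "L - Y"] by (simp add: card_Diff_subset finY Y(1))
  then have half: "2 * card Y \<le> card L" using card_mono[OF L(1) Y(1)] by linarith
  have transY: "ltrans g Y = Y" if g: "g \<in> Y" for g
  proof (rule ccontr)
    assume ne: "ltrans g Y \<noteq> Y"
    define C where "C = ltrans g Y"
    have CF': "C \<in> F'" unfolding C_def using trans[OF YF'] g Y(1) by auto
    have C: "C \<subseteq> L" "J \<subseteq> rstab C" "growth C k = growth Y0 k" "card C = card Y" "finite C"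
      using CF' finY by (auto simp: F'_def F_def C_def)
    have gI: "g \<in> Y \<inter> C" using g \<open>0 \<in> Y\<close> by (simp add: C_def mem_ltrans_iff)
    have lt: "card (Y \<inter> C) < card Y"
    proof (rule psubset_card_mono[OF finY])
      have "\<not> Y \<subseteq> C" using ne card_subset_eq[OF C(5), of Y] C(4) by (auto simp: C_def)
      then show "Y \<inter> C \<subset> Y" by blast
    qed
    have "card (Y \<inter> C) \<ge> 1" using gI finY by (metis One_nat_def Suc_leI card_gt_0_iff empty_iff
        finite_Int)
    then have ltU: "card (Y \<union> C) < card L"
      using card_Un_Int[OF finY C(5)] C(4) half by linarith
    have IF: "Y \<inter> C \<in> F"
      using gI Y C rstab_Int_Un(1)[OF Y(3) C(2)] lt half card_mono[OF L(1) Y(1)] by (auto simp: F_def)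
    have UF: "Y \<union> C \<in> F"
      using gI Y C rstab_Int_Un(2)[OF Y(3) C(2)] ltU by (auto simp: F_def)
    \<comment> \<open>The union has at least the minimal growth, so submodularity leaves no more
      than the minimum for the intersection.\<close>
    have "growth (Y \<inter> C) k \<le> growth Y0 k"
      using growth_Int_Un[OF finY C(5), of k] Y(4) C(3) Y0(2)[OF UF] by linarith
    then have "Y \<inter> C \<in> F'" using Y0(2)[OF IF] IF by (simp add: F'_def)
    then show False using Ymin lt by fastforce
  qed
  have sub: "add_subgroup Y"
  proof (rule finite_add_subgroupI[OF finY \<open>0 \<in> Y\<close>])
    fix x y assume "x \<in> Y" "y \<in> Y"
    then show "x + y \<in> Y" using transY[of x] by (auto simp: ltrans_def)
  qed
  have JY: "J \<subseteq> Y" using Y(3) \<open>0 \<in> Y\<close> rstab_iff[OF finY] by force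
  \<comment> \<open>A subgroup containing \<open>J\<close> and \<open>k\<close> would be
    \<open>L\<close>. So \<open>Y + k\<close> is disjoint from \<open>Y\<close>, and the minimal
    growth equals \<open>|Y|\<close>.\<close>
  have "k \<notin> Y"
    using gen_least[OF sub, of "insert k J"] JY Y(1,2) L(3) by auto
  have "rtrans Y k \<inter> Y = {}"
  proof -
    have False if "x - k \<in> Y" "x \<in> Y" for x
      using add_subgroupD(2)[OF sub add_subgroupD(3)[OF sub that(1)] that(2)] \<open>k \<notin> Y\<close>
      by (simp add: minus_diff_eq)
    then show ?thesis by (auto simp: mem_rtrans_iff)
  qed
  then have "growth Y k = card Y" unfolding growth_def by (metis Diff_triv card_rtrans)
  then have "card J \<le> growth Y k" using card_mono[OF finY JY] by simp
  then show ?thesis using Y0(2)[OF ZF] Y(4) by simp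
qed

text \<open>A point \<open>y\<close> of \<open>Y\<close> with \<open>y + k\<close> outside
  \<open>Y\<close> singles out the left coset \<open>y + L\<close>, where \<open>L\<close> is
  generated by \<open>J\<close> and \<open>k\<close>. Inside it \<open>Y\<close> is a proper
  nonempty set, and its growth there is part of the whole growth.\<close>

lemma card_le_growth:
  assumes A: "finite A" "add_subgroup A" and J: "add_subgroup J" "J \<subseteq> A" and k: "k \<in> A"
    and Y: "finite Y" "J \<subseteq> rstab Y" "k \<notin> rstab Y"
  shows "card J \<le> growth Y k"
proof -
  define L where "L = gen (insert k J)"
  have LA: "L \<subseteq> A" unfolding L_def using A J k by (intro gen_least) auto
  have L: "finite L" "add_subgroup L" using LA A finite_subset gen_add_subgroup by (auto simp: L_def)
  have kL: "k \<in> L" and JL: "J \<subseteq> L" using gen_superset[of "insert k J"] by (auto simp: L_def)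
  obtain y where y: "y \<in> Y" "y + k \<notin> Y" using Y rstab_iff by blast
  define Z where "Z = ltrans (- y) Y \<inter> L"
  have "0 \<in> Z" "k \<notin> Z"
    using y add_subgroupD(1)[OF L(2)] by (simp_all add: Z_def mem_ltrans_iff)
  moreover have "J \<subseteq> rstab Z" unfolding Z_def
    using Y(2) JL rtrans_add_subgroup[OF L(2)] by (intro rstab_Int_Un) (auto simp: rstab_def[of L])
  ultimately have "card J \<le> growth Z k"
    using card_le_growth_generated[of L k J Z] L J kL unfolding L_def Z_def by auto
  also have "growth Z k \<le> growth (ltrans (- y) Y) k"
  proof -
    have "rtrans Z k - Z \<subseteq> rtrans (ltrans (- y) Y) k - ltrans (- y) Y"
      unfolding Z_def rtrans_Int rtrans_add_subgroup[OF L(2) kL] by auto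
    then show ?thesis unfolding growth_def using Y(1) by (intro card_mono) auto
  qed
  finally show ?thesis by (simp add: growth_ltrans)
qed

section \<open>Sets of growth one\<close>

lemma ltrans_ltrans: "ltrans g (ltrans h B) = ltrans (g + h) B"
  by (auto simp: ltrans_def image_image add.assoc)

lemma ltrans_zero [simp]: "ltrans 0 B = B" by (simp add: ltrans_def)

lemma two_le_growth:
  assumes A: "finite A" "add_subgroup A" "c \<in> A" "k \<in> A"
    and Z: "finite Z" "c \<in> rstab Z" "c \<noteq> 0" "k \<notin> rstab Z"
  shows "2 \<le> growth Z k"
proof -
  have J: "add_subgroup (rstab Z \<inter> A)"
    using rstab_add_subgroup[of Z] A(2) by (auto simp: add_subgroup_def)
  have "card {0, c} \<le> card (rstab Z \<inter> A)"
    using A Z(2) add_subgroupD(1)[OF J] by (intro card_mono) auto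
  also have "\<dots> \<le> growth Z k"
    using card_le_growth[OF A(1,2) J _ A(4) Z(1) _ Z(4)] by auto
  finally show ?thesis using Z(3) by simp
qed

context
  fixes a b :: "'g::group_add" and L :: "'g set"
  assumes L_def: "L = gen {a, b}" and finL: "finite L" and nz: "a \<noteq> 0" "b \<noteq> 0" "a \<noteq> b"
begin

lemma generated_by_two: "add_subgroup L" "a \<in> L" "b \<in> L" "a - b \<in> L"
  using gen_add_subgroup[of "{a, b}"] gen_superset[of "{a, b}"] add_subgroupD(4)[of L] L_def by auto

lemma stable_whole:
  assumes "Z \<subseteq> L" "Z \<noteq> {}" "a \<in> rstab Z" "b \<in> rstab Z"
  shows "Z = L"
proof -
  have "L \<subseteq> rstab Z" unfolding L_def using assms by (intro gen_least rstab_add_subgroup) auto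
  moreover obtain z where z: "z \<in> Z" using assms by auto
  ultimately have "ltrans z L \<subseteq> Z"
    using rstab_iff[of Z] finite_subset[OF assms(1) finL] by (auto simp: ltrans_def)
  then show ?thesis using ltrans_add_subgroup[OF generated_by_two(1), of z] z assms(1) by auto
qed

text \<open>A direction of growth zero is a nonzero period of \<open>Z\<close>. Then neither of the
  other two directions is a period, since \<open>Z\<close> would be all of \<open>L\<close>, and
  each of them has growth at least 2. In the application \<open>a\<close>, \<open>b\<close> and
  \<open>a - b\<close> are the differences of three distinct terms.\<close>

lemma growth_triples:
  assumes Z: "Z \<subseteq> L" "Z \<noteq> {}" "Z \<noteq> L"
  shows "growth Z a = 1 \<and> growth Z b = 1 \<and> growth Z (a - b) = 1
    \<or> 4 \<le> growth Z a + growth Z b + growth Z (a - b)"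
proof -
  have fin: "finite Z" using Z(1) finL finite_subset by blast
  note S = add_subgroupD[OF rstab_add_subgroup[of Z]]
  have ns: "\<not> (a \<in> rstab Z \<and> b \<in> rstab Z)" using stable_whole Z by blast
  note two = two_le_growth[OF finL generated_by_two(1) _ _ fin]
  consider "growth Z a = 0" | "growth Z b = 0" | "growth Z (a - b) = 0"
    | "growth Z a \<ge> 1" "growth Z b \<ge> 1" "growth Z (a - b) \<ge> 1" by linarith
  then show ?thesis
  proof cases
    case 1
    then have a: "a \<in> rstab Z" using growth_eq_0_iff[OF fin] by simp
    then have b: "b \<notin> rstab Z" using ns by simp
    have "a - b \<notin> rstab Z" using S(2)[OF S(3) a, of "a - b"] b by auto
    then show ?thesis using two[of a b] two[of a "a - b"] a b generated_by_two nz by auto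
  next
    case 2
    then have b: "b \<in> rstab Z" using growth_eq_0_iff[OF fin] by simp
    then have a: "a \<notin> rstab Z" using ns by simp
    have "a - b \<notin> rstab Z" using S(2)[OF _ b, of "a - b"] a by auto
    then show ?thesis using two[of b a] two[of b "a - b"] a b generated_by_two nz by auto
  next
    case 3
    then have c: "a - b \<in> rstab Z" using growth_eq_0_iff[OF fin] by simp
    have "a \<notin> rstab Z" "b \<notin> rstab Z" using S(2)[OF S(3) _, of "a - b" a] S(2)[of "a - b" b] c ns by auto
    then show ?thesis using two[of "a - b" a] two[of "a - b" b] c generated_by_two nz by auto
  qed linarith
qed

text \<open>
  By submodularity, a smallest counterexample meets any other of its left translates in at most
  one point. Hence it has only two elements, and \<open>b = - a\<close> has order 3.
\<close>

lemma thin_sets: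
  assumes Z: "Z \<subseteq> L" "Z \<noteq> {}" "Z \<noteq> L" "growth Z a = 1" "growth Z b = 1" "growth Z (a - b) = 1"
  shows "card Z = 1 \<or> card Z + 1 = card L"
proof (rule ccontr)
  assume "\<not> ?thesis"
  moreover have "card Z < card L" using Z(1,3) finL by (intro psubset_card_mono) auto
  moreover have "card Z > 0" using Z(1,2) finL finite_subset card_gt_0_iff by blast
  ultimately have cZ: "2 \<le> card Z" "card Z + 2 \<le> card L" by auto
  define F where "F = {Y. Y \<subseteq> L \<and> 2 \<le> card Y \<and> card Y + 2 \<le> card L
    \<and> growth Y a = 1 \<and> growth Y b = 1 \<and> growth Y (a - b) = 1}"
  obtain Y where YF: "Y \<in> F" and Ymin: "\<And>C. C \<in> F \<Longrightarrow> card Y \<le> card C"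
    using ex_has_least_nat[of "\<lambda>Y. Y \<in> F" Z card] Z cZ by (auto simp: F_def)
  have Y: "Y \<subseteq> L" "2 \<le> card Y" "card Y + 2 \<le> card L" "growth Y a = 1" "growth Y b = 1"
      "growth Y (a - b) = 1"
    using YF by (auto simp: F_def)
  have finY: "finite Y" using Y(1) finL finite_subset by blast
  have cd: "card (L - Y) = card L - card Y" by (simp add: card_Diff_subset finY Y(1))
  have "L - Y \<in> F"
    using Y cd growth_compl[OF finL Y(1) rtrans_add_subgroup[OF generated_by_two(1)]]
        generated_by_two by (auto simp: F_def)
  then have half: "2 * card Y \<le> card L" using Ymin[of "L - Y"] cd Y(3) by linarith
  \<comment> \<open>For distinct translates with two common points, intersection and union are
    proper subsets of \<open>L\<close>. Their growths in the three directions total at most 6, while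
    each contributes 3 or at least 4. So the intersection has growth 1 throughout, against
    minimality.\<close>
  have trans: "ltrans g Y = Y" if g: "g \<in> L" "2 \<le> card (Y \<inter> ltrans g Y)" for g
  proof (rule ccontr)
    assume ne: "ltrans g Y \<noteq> Y"
    define C where "C = ltrans g Y"
    have C: "C \<subseteq> L" "card C = card Y" "finite C" "growth C k = growth Y k" for k
    proof -
      show "C \<subseteq> L"
        using g(1) Y(1) add_subgroupD(2)[OF generated_by_two(1)] unfolding C_def ltrans_def by blast
    qed (use finY in \<open>simp_all add: C_def growth_ltrans\<close>)
    define I where "I = Y \<inter> C"
    define U where "U = Y \<union> C"
    have cI: "card I < card Y" unfolding I_def
    proof (rule psubset_card_mono[OF finY])
      have "\<not> Y \<subseteq> C" using ne card_subset_eq[OF C(3), of Y] C(2) by (auto simp: C_def)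
      then show "Y \<inter> C \<subset> Y" by blast
    qed
    have c2: "2 \<le> card I" using g(2) by (simp add: I_def C_def)
    have cU: "card U + 2 \<le> card L"
      using card_Un_Int[OF finY C(3)] C(2) half c2 by (simp add: U_def I_def)
    have I: "I \<subseteq> L" "I \<noteq> {}" "I \<noteq> L"
    proof -
      show "I \<subseteq> L" unfolding I_def using Y(1) by blast
      show "I \<noteq> {}" using c2 by auto
      show "I \<noteq> L" using cI Y(3) by auto
    qed
    have U: "U \<subseteq> L" "U \<noteq> {}" "U \<noteq> L"
    proof -
      show "U \<subseteq> L" unfolding U_def using Y(1) C(1) by blast
      show "U \<noteq> {}" using I(2) unfolding I_def U_def by blast
      show "U \<noteq> L" using cU by auto
    qed
    have "growth I k + growth U k \<le> 2 * growth Y k" for k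
      using growth_Int_Un[OF finY C(3), of k] C(4)[of k] by (simp add: I_def U_def)
    from this[of a] this[of b] this[of "a - b"]
    have "growth I a = 1 \<and> growth I b = 1 \<and> growth I (a - b) = 1"
      using growth_triples[OF I] growth_triples[OF U] Y(4-6) by linarith
    then have "I \<in> F" using I c2 cI Y(3) by (auto simp: F_def)
    then show False using Ymin cI by fastforce
  qed
  have step: "\<exists>y. y \<in> Y \<and> y + k \<in> Y" and two: "card Y = 2"
    if k: "k \<noteq> 0" "k \<in> L" "growth Y k = 1" for k
  proof -
    \<comment> \<open>Exactly one point of \<open>Y\<close> leaves along \<open>k\<close>. For two
      points \<open>y\<close> and \<open>y0\<close> that stay, translation by \<open>y - y0\<close>
      carries \<open>y0\<close> and \<open>y0 + k\<close> to \<open>y\<close> and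
      \<open>y + k\<close>; with two points in common, it must fix \<open>Y\<close>.\<close>
    define W where "W = {y \<in> Y. y + k \<in> Y}"
    have "rtrans W k = rtrans Y k \<inter> Y" by (auto simp: W_def mem_rtrans_iff)
    then have "card W = card (rtrans Y k) - card (rtrans Y k - Y)"
      using card_rtrans[of W k] finY card_Diff_subset_Int[of "rtrans Y k" Y]
        card_Int_Diff[of "rtrans Y k" Y] by simp
    then have cW: "card W + 1 = card Y" using k(3) Y(2) by (simp add: growth_def)
    then obtain y0 where y0: "y0 \<in> W" using Y(2) by fastforce
    then show "\<exists>y. y \<in> Y \<and> y + k \<in> Y" by (auto simp: W_def)
    define T where "T = {g. ltrans g Y = Y}"
    have WT: "y - y0 \<in> T" if y: "y \<in> W" for y
    proof -
      have *: "y \<in> Y \<inter> ltrans (y - y0) Y" "y + k \<in> Y \<inter> ltrans (y - y0) Y"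
        using y y0 by (auto simp: W_def mem_ltrans_iff minus_diff_eq simp flip: add.assoc)
      have "card {y, y + k} \<le> card (Y \<inter> ltrans (y - y0) Y)"
        using * finY by (intro card_mono) auto
      moreover have "y \<noteq> y + k" using k(1) by (metis add_0_right add_left_cancel)
      ultimately have "2 \<le> card (Y \<inter> ltrans (y - y0) Y)" by simp
      moreover have "y - y0 \<in> L" using y y0 Y(1) add_subgroupD(4)[OF generated_by_two(1)]
          unfolding W_def by blast
      ultimately show ?thesis using trans by (simp add: T_def)
    qed
    have Tcl: "g + y \<in> Y" if "g \<in> T" "y \<in> Y" for g y using that by (auto simp: T_def ltrans_def)
    show "card Y = 2"
    proof (rule ccontr)
      assume "card Y \<noteq> 2"
      then have c3: "3 \<le> card Y" using Y(2) by simp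
      obtain z where z: "Y - W = {z}"
      proof -
        have "card (Y - W) = 1" using cW finY by (subst card_Diff_subset) (auto simp: W_def)
        then show ?thesis using that card_1_singletonE by blast
      qed
      \<comment> \<open>If the last point \<open>z\<close> is in the same orbit of the left
        stabilizer, then \<open>Y\<close> has a nonzero right period, which is incompatible with
        growth 1. If not, \<open>W\<close> is mapped injectively into the part of \<open>Y\<close>
        outside \<open>W\<close>, which is only \<open>z\<close>.\<close>
      show False
      proof (cases "z - y0 \<in> T")
        case True
        have YT: "y - y0 \<in> T" if "y \<in> Y" for y
        proof (cases "y \<in> W")
          case False
          then have "y \<in> {z}" unfolding z[symmetric] using that by blast
          then show ?thesis using True by simp
        qed (rule WT)
        obtain y where y: "y \<in> W" "y \<noteq> y0"
        proof -
          have "\<not> W \<subseteq> {y0}" using cW c3 card_mono[of "{y0}" W] by auto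
          then show ?thesis using that by auto
        qed
        define c where "c = - y0 + y"
        have "c \<noteq> 0" using y by (metis c_def add_minus_cancel add_0_right)
        have "x + c \<in> Y" if x: "x \<in> Y" for x
        proof -
          have "x + c = (x - y0) + y" by (simp add: c_def diff_conv_add_uminus add.assoc del:
              add_uminus_conv_diff)
          then show ?thesis using Tcl[OF YT[OF x], of y] y by (auto simp: W_def)
        qed
        then have cs: "c \<in> rstab Y" using rstab_iff[OF finY] by blast
        have "c \<in> L"
          using y y0 Y(1) add_subgroupD(2,3)[OF generated_by_two(1)] unfolding c_def W_def by blast
        then have "2 \<le> growth Y k"
          using two_le_growth[OF finL generated_by_two(1) _ k(2) finY cs \<open>c \<noteq> 0\<close>] k(3)
              growth_eq_0_iff[OF finY, of k] by auto
        then show False using k(3) by simp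
      next
        case False
        have inj: "inj_on (\<lambda>y. (y - y0) + z) W"
          by (intro inj_onI) (metis diff_add_cancel add_right_cancel)
        have "(\<lambda>y. (y - y0) + z) ` W \<subseteq> {z}"
        proof
          fix x assume "x \<in> (\<lambda>y. (y - y0) + z) ` W"
          then obtain y where y: "y \<in> W" "x = (y - y0) + z" by auto
          have "z \<in> Y" using z by blast
          then have "x \<in> Y" unfolding y(2) by (rule Tcl[OF WT[OF y(1)]])
          moreover have "x \<notin> W"
          proof
            assume "x \<in> W"
            then have "x - y0 \<in> T" by (rule WT)
            have "z - y0 = - (y - y0) + (x - y0)"
              unfolding y(2) by (metis add_diff_eq minus_add_cancel)
            moreover have "- (y - y0) + (x - y0) \<in> T"
            proof -
              have gT: "ltrans (- g) Y = Y" if "ltrans g Y = Y" for g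
                using ltrans_ltrans[of "- g" g Y] that by simp
              have "ltrans (g + h) Y = Y" if "ltrans g Y = Y" "ltrans h Y = Y" for g h
                using ltrans_ltrans[of g h Y] that by simp
              then show ?thesis using WT[OF y(1)] \<open>x - y0 \<in> T\<close> gT unfolding T_def by blast
            qed
            ultimately show False using False by simp
          qed
          ultimately show "x \<in> {z}" using z by blast
        qed
        then have "card W \<le> 1"
          using card_inj_on_le[OF inj, of "{z}"] by simp
        then show False using cW c3 by simp
      qed
    qed
  qed
  obtain y z where yz: "Y = {y, z}" "y \<noteq> z" using two[OF nz(1) generated_by_two(2) Y(4)] card_2_iff
      by metis
  \<comment> \<open>In a set of two points an edge that stays inside joins one point to the other,
    so each direction is \<open>w\<close> or \<open>- w\<close>.\<close>
  define w where "w = - y + z"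
  have pm: "k = w \<or> k = - w" if k: "k \<noteq> 0" "k \<in> L" "growth Y k = 1" for k
  proof -
    obtain x where x: "x \<in> Y" "x + k \<in> Y" using step[OF k] by blast
    have "x + k \<noteq> x" using k(1) by (metis add_0_right add_left_cancel)
    then have "y + k = z \<or> z + k = y" using x unfolding yz(1) insert_iff empty_iff by metis
    then show ?thesis
    proof
      assume "y + k = z"
      then have "k = w" unfolding w_def by (metis minus_add_cancel)
      then show ?thesis ..
    next
      assume "z + k = y"
      then have "- z + y = k" by (metis minus_add_cancel)
      then have "k = - w" by (simp add: w_def minus_add)
      then show ?thesis ..
    qed
  qed
  have ab: "a = w \<or> a = - w" "b = w \<or> b = - w" "a - b = w \<or> a - b = - w"
    using pm[of a] pm[of b] pm[of "a - b"] nz generated_by_two Y by auto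
  have b: "b = - a" using ab(1,2) nz(3) by auto
  have "a + a = a \<or> a + a = - a" using ab(1,3) b by auto
  moreover have "a + a \<noteq> a" using nz(1) by (metis add_0_right add_left_cancel)
  ultimately have a3: "a + a = - a" by blast
  then have a3': "- a + - a = a" using minus_add[of a a] by simp
  \<comment> \<open>Thus \<open>L\<close> has at most three elements, although it has at least twice
    as many as \<open>Y\<close>.\<close>
  have "add_subgroup {0, a, - a}"
    using a3 a3' by (intro finite_add_subgroupI) auto
  then have "L \<subseteq> {0, a, - a}" unfolding L_def using b by (intro gen_least) auto
  then have "card L \<le> card {0, a, - a}" by (intro card_mono) auto
  also have "\<dots> \<le> 3" by (simp add: card_insert_if)
  finally show False using half Y(2) by simp
qed

end

text \<open>In the left coset of \<open>L\<close> where an edge in direction \<open>a\<close> leaves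
  \<open>B\<close>, the three growths total at least 3, which is all there is. So \<open>B\<close>
  is periodic outside this coset, and inside it \<open>B\<close> has one point or lacks one.\<close>

lemma thin_set_structure:
  assumes A: "finite A" "add_subgroup A" "a \<in> A" "b \<in> A"
    and nz: "a \<noteq> 0" "b \<noteq> 0" "a \<noteq> b"
    and B: "finite B" "growth B a = 1" "growth B b = 1" "growth B (a - b) = 1"
  obtains Y p where "a \<in> rstab Y" "b \<in> rstab Y" "finite Y"
    "p \<notin> Y \<and> B = insert p Y \<or> p \<in> Y \<and> B = Y - {p}"
proof -
  define L where "L = gen {a, b}"
  have "L \<subseteq> A" unfolding L_def using A by (intro gen_least) auto
  then have finL: "finite L" using A finite_subset by blast
  note LF = generated_by_two[OF L_def finL nz]
  obtain q where q: "q \<in> rtrans B a - B"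
    using B(2) unfolding growth_def by (metis One_nat_def card_eq_0_iff ex_in_conv zero_neq_one)
  define x where "x = q - a"
  have x: "x \<in> B" "x + a \<notin> B" using q by (auto simp: x_def mem_rtrans_iff)
  define M where "M = ltrans x L"
  have M: "rtrans M k = M" if "k \<in> L" for k
    using rtrans_add_subgroup[OF LF(1) that] by (simp add: M_def rtrans_ltrans)
  have finM: "finite M" using finL by (simp add: M_def)
  define Z where "Z = B \<inter> M"
  have xZ: "x \<in> Z" using x LF(1) add_subgroupD(1) by (auto simp: Z_def M_def mem_ltrans_iff)
  have xa: "x + a \<in> M" using LF(2) by (auto simp: M_def ltrans_def)
  have le: "growth Z k + growth (B - M) k = growth B k" if k: "k \<in> L" for k
  proof -
    have "rtrans Z k - Z = (rtrans B k - B) \<inter> M" "rtrans (B - M) k - (B - M) = (rtrans B k - B) - M"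
      unfolding Z_def rtrans_Int rtrans_Diff M[OF k] by auto
    then show ?thesis unfolding growth_def using card_Int_Diff[of "rtrans B k - B" M] B(1) by simp
  qed
  define Z' where "Z' = ltrans (- x) Z"
  have gZ': "growth Z' k = growth Z k" for k by (simp add: Z'_def growth_ltrans)
  have Z': "Z' \<subseteq> L" "0 \<in> Z'" "a \<notin> Z'"
    using x xZ by (auto simp: Z'_def Z_def M_def mem_ltrans_iff)
  then have Z'2: "Z' \<noteq> {}" "Z' \<noteq> L" using LF(2) by auto
  have g1: "growth Z a = 1" "growth Z b = 1" "growth Z (a - b) = 1"
    using growth_triples[OF L_def finL nz Z'(1) Z'2] le[OF LF(2)] le[OF LF(3)] le[OF LF(4)] B
        unfolding gZ' by linarith+
  then have "growth (B - M) a = 0" "growth (B - M) b = 0"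
    using le[OF LF(2)] le[OF LF(3)] B by auto
  then have st: "a \<in> rstab (B - M)" "b \<in> rstab (B - M)" using B(1) growth_eq_0_iff[of "B - M"] by auto
  have "card Z' = 1 \<or> card Z' + 1 = card L"
    using thin_sets[OF L_def finL nz Z'(1) Z'2] g1 unfolding gZ' by blast
  then consider "card Z = 1" | "card Z + 1 = card M" by (auto simp: Z'_def M_def)
  then show ?thesis
  proof cases
    case 1
    then obtain p where "Z = {p}" using card_1_singletonE by blast
    then have "B = insert p (B - M)" "p \<notin> B - M" by (auto simp: Z_def)
    then show ?thesis using that[of "B - M" p] st B(1) by auto
  next
    case 2
    have "card (M - Z) = 1" using 2 finM card_Diff_subset[of Z M] finite_subset[of Z M]
        by (auto simp: Z_def)
    then obtain p where p: "M - Z = {p}" using card_1_singletonE by blast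
    have "k \<in> rstab ((B - M) \<union> M)" if "k \<in> rstab (B - M)" "k \<in> L" for k
      using rstab_Int_Un(2)[of "{k}" "B - M" M] that M by (auto simp: rstab_def)
    moreover have "B = ((B - M) \<union> M) - {p}" "p \<in> (B - M) \<union> M" using p by (auto simp: Z_def)
    ultimately show ?thesis using that[of "(B - M) \<union> M" p] st LF B(1) finM by auto
  qed
qed

section \<open>Sets stuck under translations\<close>

lemma card_proper_subgroup:
  assumes "finite H" "add_subgroup H" "add_subgroup K" "K \<subset> H"
  shows "2 * card K \<le> card H"
proof -
  obtain h where h: "h \<in> H" "h \<notin> K" using assms(4) by blast
  have "ltrans h K \<inter> K = {}"
  proof -
    have False if "x \<in> ltrans h K" "x \<in> K" for x
    proof -
      have "- h + x \<in> K" using that by (simp add: mem_ltrans_iff)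
      then have "x - (- h + x) \<in> K" using that add_subgroupD(4)[OF assms(3)] by blast
      moreover have "x - (- h + x) = h" by (metis add_diff_cancel add_minus_cancel)
      ultimately show False using h by simp
    qed
    then show ?thesis by blast
  qed
  moreover have "finite K" using assms finite_subset by blast
  ultimately have "card (ltrans h K \<union> K) = 2 * card K" by (subst card_Un_disjoint) auto
  moreover have "ltrans h K \<union> K \<subseteq> H"
    using assms(4) h(1) add_subgroupD(2)[OF assms(2)] unfolding ltrans_def by blast
  ultimately show ?thesis using card_mono[OF assms(1)] by metis
qed

section \<open>Multiples of an element and conjugation by them\<close>

definition mul :: "'g::group_add \<Rightarrow> nat \<Rightarrow> 'g" where
  "mul g n = sum_list (replicate n g)"

lemma mul_0 [simp]: "mul g 0 = 0" and mul_Suc: "mul g (Suc n) = g + mul g n"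
  by (simp_all add: mul_def)

lemma mul_Suc2: "mul g (Suc n) = mul g n + g"
proof (induction n)
  case (Suc n)
  then show ?case by (metis mul_Suc add.assoc)
qed (simp add: mul_Suc)

lemma mul_add: "mul g (m + n) = mul g m + mul g n"
  by (induction m) (simp_all add: mul_Suc add.assoc)

lemma sum_list_mem:
  assumes "add_subgroup A" "set xs \<subseteq> A"
  shows "sum_list xs \<in> A"
  using assms(2) by (induction xs) (simp_all add: add_subgroupD[OF assms(1)])

lemma mul_mem: "add_subgroup A \<Longrightarrow> g \<in> A \<Longrightarrow> mul g n \<in> A"
  unfolding mul_def by (rule sum_list_mem) auto

text \<open>The periods of a right translate are conjugates of the periods of the set, so adding
  equal terms can turn a period into a non-period.\<close>

lemma rstab_rtrans: "a \<in> rstab (rtrans B m) \<longleftrightarrow> m + a - m \<in> rstab B"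
proof -
  have "a \<in> rstab (rtrans B m) \<longleftrightarrow> rtrans B (m + a) = rtrans B m"
    by (simp add: rstab_def rtrans_rtrans)
  also have "\<dots> \<longleftrightarrow> m + a - m \<in> rstab B" by (rule rtrans_eq_iff)
  finally show ?thesis .
qed

lemma rstab_subset:
  assumes "add_subgroup A" "Y \<subseteq> A" "Y \<noteq> {}" "finite Y"
  shows "rstab Y \<subseteq> A"
proof
  fix a assume a: "a \<in> rstab Y"
  obtain y where y: "y \<in> Y" using assms by blast
  then have "y + a \<in> A" using a assms(2) rstab_iff[OF assms(4)] by blast
  then have "- y + (y + a) \<in> A" using y assms(2) add_subgroupD(2,3)[OF assms(1)] by blast
  then show "a \<in> A" by simp
qed

definition conjn :: "'g::group_add \<Rightarrow> nat \<Rightarrow> 'g \<Rightarrow> 'g" where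
  "conjn g j x = mul g j + x - mul g j"

lemma conjn_simps: "conjn g 0 x = x" "conjn g (Suc j) x = conjn g j (g + x - g)"
  by (simp_all add: conjn_def mul_Suc2 diff_conv_add_uminus add.assoc minus_add del:
      add_uminus_conv_diff)

lemma conjn_plus: "conjn g j (x + y) = conjn g j x + conjn g j y"
  by (simp add: conjn_def diff_conv_add_uminus add.assoc del: add_uminus_conv_diff)

lemma conjn_uminus: "conjn g j (- x) = - conjn g j x"
  by (simp add: conjn_def diff_conv_add_uminus add.assoc minus_add del: add_uminus_conv_diff)

lemma conjn_zero [simp]: "conjn g j 0 = 0" by (simp add: conjn_def)

lemma add_subgroup_conjn:
  assumes "add_subgroup J" "add_subgroup A"
  shows "add_subgroup {x \<in> A. \<forall>j\<in>N. conjn g j x \<in> J}"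
  unfolding add_subgroup_def
  by (auto simp: conjn_plus conjn_uminus add_subgroupD[OF assms(1)] add_subgroupD[OF assms(2)])

text \<open>
  If the translates of \<open>Y\<close> by the elements of \<open>D\<close> coincide, single terms are added until they
  separate. Each further term at least halves the subgroup \<open>{x. \<forall>j\<le>i. conjn g j x \<in> rstab Y}\<close>.
\<close>

lemma stuck_alternative:
  assumes A: "finite A" "add_subgroup A" and Y: "Y \<subseteq> A" "Y \<noteq> {}" and D: "D \<subseteq> A" "g \<in> D"
    and stuck: "\<forall>a\<in>D. \<forall>b\<in>D. a - b \<in> rstab Y"
  shows "(\<exists>K. add_subgroup K \<and> K \<subseteq> A \<and> K \<subseteq> rstab Y \<and> (\<forall>x\<in>K. g + x - g \<in> K) \<and> (\<forall>a\<in>D. a - g \<in> K))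
    \<or> (\<exists>t J1 J2. t \<ge> 1 \<and> add_subgroup J1 \<and> J1 \<subseteq> A \<and> (\<forall>a\<in>D. \<forall>b\<in>D. a - b \<in> J1)
        \<and> add_subgroup J2 \<and> J2 \<subseteq> A \<and> 2 ^ (t - 1) * card J1 \<le> card J2
        \<and> J2 \<subseteq> rstab (rtrans Y (mul g t))
        \<and> (\<exists>a\<in>D. \<exists>b\<in>D. a - b \<notin> rstab (rtrans Y (mul g t)))
        \<and> (\<forall>cs. set cs \<subseteq> D \<longrightarrow> length cs = t \<longrightarrow> rtrans Y (sum_list cs) = rtrans Y (mul g t)))"
    (is "?P \<or> ?Q")
proof -
  have finY: "finite Y" using Y(1) A(1) finite_subset by blast
  define J where "J = rstab Y"
  have J: "add_subgroup J" "J \<subseteq> A"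
    using rstab_add_subgroup rstab_subset[OF A(2) Y finY] by (auto simp: J_def)
  have gA: "g \<in> A" using D by blast
  have conjA: "conjn g j x \<in> A \<longleftrightarrow> x \<in> A" for j x
  proof -
    note m = mul_mem[OF A(2) gA, of j]
    have "- mul g j + conjn g j x + mul g j = x"
      by (simp add: conjn_def diff_conv_add_uminus add.assoc del: add_uminus_conv_diff)
    moreover have "- mul g j + z + mul g j \<in> A" if "z \<in> A" for z
      using m that add_subgroupD(2,3)[OF A(2)] by blast
    moreover have "conjn g j z \<in> A" if "z \<in> A" for z
      using m that add_subgroupD(2,4)[OF A(2)] unfolding conjn_def by blast
    ultimately show ?thesis by metis
  qed
  show ?thesis
  proof (cases "\<forall>a\<in>D. \<forall>b\<in>D. \<forall>j. conjn g j (a - b) \<in> J")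
    case True
    \<comment> \<open>The largest subset of \<open>J\<close> that conjugation by \<open>g\<close>
      maps into itself.\<close>
    define K where "K = {x \<in> A. \<forall>j\<in>UNIV. conjn g j x \<in> J}"
    have "add_subgroup K" unfolding K_def by (rule add_subgroup_conjn[OF J(1) A(2)])
    moreover have "K \<subseteq> A" unfolding K_def by blast
    moreover have "K \<subseteq> rstab Y"
    proof
      fix x assume "x \<in> K"
      then have "conjn g 0 x \<in> J" unfolding K_def by blast
      then show "x \<in> rstab Y" by (simp add: conjn_simps J_def)
    qed
    moreover have "g + x - g \<in> K" if "x \<in> K" for x
    proof -
      have "conjn g j (g + x - g) \<in> J" for j using that unfolding K_def by (simp flip: conjn_simps(2))
      moreover have "g + x - g \<in> A" using conjA[of 1 x] that by (simp add: conjn_simps K_def)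
      ultimately show ?thesis by (simp add: K_def)
    qed
    moreover have "a - g \<in> K" if "a \<in> D" for a
      using True that D add_subgroupD(4)[OF A(2)] unfolding K_def by blast
    ultimately have ?P by blast
    then show ?thesis ..
  next
    case False
    define P where "P j \<longleftrightarrow> (\<exists>a\<in>D. \<exists>b\<in>D. conjn g j (a - b) \<notin> J)" for j
    \<comment> \<open>The least number of copies of \<open>g\<close> after which two elements of
      \<open>D\<close> translate \<open>Y\<close> differently.\<close>
    define t where "t = (LEAST j. P j)"
    obtain j0 where "P j0" using False unfolding P_def by blast
    then have Pt: "P t" unfolding t_def by (rule LeastI)
    have least: "\<not> P j" if "j < t" for j using that not_less_Least unfolding t_def by blast
    have "\<not> P 0" using stuck by (simp add: P_def J_def conjn_simps)
    then have t1: "t \<ge> 1" using Pt by (cases t) auto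
    obtain a b where ab: "a \<in> D" "b \<in> D" "conjn g t (a - b) \<notin> J" using Pt unfolding P_def by blast
    define Jn where "Jn i = {x \<in> A. \<forall>j\<in>{..i}. conjn g j x \<in> J}" for i
    have Jn: "add_subgroup (Jn i)" "Jn i \<subseteq> A" "finite (Jn i)" for i
    proof -
      show "add_subgroup (Jn i)" unfolding Jn_def by (rule add_subgroup_conjn[OF J(1) A(2)])
      show *: "Jn i \<subseteq> A" unfolding Jn_def by blast
      show "finite (Jn i)" by (rule finite_subset[OF * A(1)])
    qed
    have dec: "Jn (Suc i) \<subseteq> Jn i" for i unfolding Jn_def by auto
    have diffs: "c - d \<in> Jn i" if "c \<in> D" "d \<in> D" "i < t" for c d i
    proof -
      have "c - d \<in> A" using that(1,2) D(1) add_subgroupD(4)[OF A(2)] by blast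
      moreover have "conjn g j (c - d) \<in> J" if "j \<le> i" for j
        using least[of j] \<open>i < t\<close> \<open>c \<in> D\<close> \<open>d \<in> D\<close> that unfolding P_def by force
      ultimately show ?thesis by (simp add: Jn_def)
    qed
    \<comment> \<open>The conjugate of an element of \<open>Jn (Suc l)\<close> lies in
      \<open>Jn l\<close>. If these two subgroups agree, the conjugate passes one more test, and
      with it the element itself; so a chain that stalls once is constant.\<close>
    have const: "Jn (i + k) = Jn i" if "Jn (Suc i) = Jn i" for i k
    proof -
      have step: "Jn (Suc (Suc l)) = Jn (Suc l)" if l: "Jn (Suc l) = Jn l" for l
      proof
        show "Jn (Suc l) \<subseteq> Jn (Suc (Suc l))"
        proof
          fix x assume x: "x \<in> Jn (Suc l)"
          have "g + x - g \<in> A" using conjA[of 1 x] x by (simp add: conjn_simps Jn_def)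
          moreover have "conjn g j (g + x - g) \<in> J" if "j \<le> l" for j
            using x that unfolding Jn_def conjn_simps(2)[symmetric] by auto
          ultimately have "g + x - g \<in> Jn (Suc l)" unfolding l by (simp add: Jn_def)
          then have "conjn g (Suc (Suc l)) x \<in> J" unfolding Jn_def conjn_simps(2)[of g "Suc l"] by auto
          then show "x \<in> Jn (Suc (Suc l))" using x by (auto simp: Jn_def le_Suc_eq)
        qed
      qed (rule dec)
      have "Jn (Suc (i + k)) = Jn (i + k)"
        by (induction k) (use that step in auto)
      moreover have "Jn (Suc (i + l)) = Jn (i + l)" for l
        by (induction l) (use that step in auto)
      ultimately show ?thesis by (induction k) auto
    qed
    \<comment> \<open>A stalled chain would retain \<open>a - b\<close>, which drops out at
      \<open>t\<close>.\<close>
    have strict: "Jn (Suc i) \<subset> Jn i" if "i < t" for i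
    proof -
      have "Jn (Suc i) \<noteq> Jn i"
      proof
        assume eq: "Jn (Suc i) = Jn i"
        have "Jn t = Jn i" using const[OF eq, of "t - i"] that by simp
        then have "a - b \<in> Jn t" using diffs[OF ab(1,2) that] by simp
        then show False using ab(3) by (simp add: Jn_def)
      qed
      then show ?thesis using dec by blast
    qed
    have pow: "2 ^ i * card (Jn i) \<le> card (Jn 0)" if "i \<le> t" for i
      using that
    proof (induction i)
      case (Suc i)
      have "2 * card (Jn (Suc i)) \<le> card (Jn i)"
        by (rule card_proper_subgroup[OF Jn(3) Jn(1) Jn(1) strict]) (use Suc in simp)
      then have "2 ^ i * (2 * card (Jn (Suc i))) \<le> 2 ^ i * card (Jn i)" by (rule mult_le_mono2)
      also have "\<dots> \<le> card (Jn 0)" using Suc by simp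
      finally show ?case by (simp add: ac_simps)
    qed simp
    have J0: "Jn 0 = J" using J(2) by (auto simp: Jn_def conjn_simps)
    \<comment> \<open>The conjugate of \<open>J\<close>, consisting of periods of
      \<open>Y + t g\<close>. It has the order of \<open>Jn 0\<close>, whereas all differences of
      \<open>D\<close> lie in \<open>Jn (t - 1)\<close>, which arose from \<open>Jn 0\<close> by
      \<open>t - 1\<close> strict inclusions.\<close>
    define J2 where "J2 = {x \<in> A. \<forall>j\<in>{t}. conjn g j x \<in> J}"
    have J2: "add_subgroup J2" unfolding J2_def by (rule add_subgroup_conjn[OF J(1) A(2)])
    have "card J2 = card J"
    proof -
      have "bij_betw (conjn g t) J2 J"
      proof (rule bij_betwI[where g = "\<lambda>x. - mul g t + x + mul g t"])
        show "conjn g t \<in> J2 \<rightarrow> J" by (simp add: J2_def)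
        have *: "conjn g t (- mul g t + x + mul g t) = x" for x
          by (simp add: conjn_def diff_conv_add_uminus add.assoc del: add_uminus_conv_diff)
        then show "(\<lambda>x. - mul g t + x + mul g t) \<in> J \<rightarrow> J2"
          using J(2) conjA[of t "- mul g t + _ + mul g t"] by (auto simp: J2_def)
        show "- mul g t + conjn g t x + mul g t = x" for x
          by (simp add: conjn_def diff_conv_add_uminus add.assoc del: add_uminus_conv_diff)
        show "conjn g t (- mul g t + x + mul g t) = x" for x by (rule *)
      qed
      then show ?thesis by (rule bij_betw_same_card)
    qed
    moreover have "J2 \<subseteq> rstab (rtrans Y (mul g t))"
      unfolding J2_def rstab_rtrans[abs_def] subset_iff by (simp add: rstab_rtrans conjn_def J_def)
    moreover have "a - b \<notin> rstab (rtrans Y (mul g t))"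
      using ab(3) by (simp add: rstab_rtrans conjn_def J_def)
    \<comment> \<open>Before \<open>t\<close> steps all elements of \<open>D\<close> translate
      alike, so any of them can stand in for \<open>g\<close>.\<close>
    moreover have "rtrans Y (sum_list cs) = rtrans Y (mul g (length cs))" if "set cs \<subseteq> D"
        "length cs \<le> t" for cs
      using that
    proof (induction cs rule: rev_induct)
      case (snoc c cs)
      have "c - g \<in> rstab (rtrans Y (mul g (length cs)))"
        using least[of "length cs"] snoc.prems D by (auto simp: rstab_rtrans P_def conjn_def J_def)
      then have "rtrans (rtrans Y (mul g (length cs))) c = rtrans (rtrans Y (mul g (length cs))) g"
        by (simp add: rtrans_eq_iff)
      moreover have "rtrans Y (sum_list cs) = rtrans Y (mul g (length cs))" using snoc by simp
      ultimately show ?case by (simp add: mul_Suc2 flip: rtrans_rtrans)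
    qed simp
    ultimately have ?Q
      using t1 Jn(1,2)[of "t - 1"] diffs[of _ _ "t - 1"] J2 pow[of "t - 1"] ab J0
      by (intro exI[of _ t] exI[of _ "Jn (t - 1)"] exI[of _ J2]) (auto simp: J2_def)
    then show ?thesis ..
  qed
qed

lemma stuck_cases:
  assumes "finite A" "add_subgroup A" "Y \<subseteq> A" "Y \<noteq> {}" "D \<subseteq> A" "g \<in> D"
    and "\<forall>a\<in>D. \<forall>b\<in>D. a - b \<in> rstab Y"
  obtains (periodic) K where "add_subgroup K" "K \<subseteq> A" "K \<subseteq> rstab Y"
      "\<forall>x\<in>K. g + x - g \<in> K" "\<forall>a\<in>D. a - g \<in> K"
    | (moving) t J1 J2 a b where "t \<ge> 1" "add_subgroup J1" "J1 \<subseteq> A" "\<forall>a\<in>D. \<forall>b\<in>D. a - b \<in> J1"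
      "add_subgroup J2" "J2 \<subseteq> A" "2 ^ (t - 1) * card J1 \<le> card J2"
      "J2 \<subseteq> rstab (rtrans Y (mul g t))" "a \<in> D" "b \<in> D" "a - b \<notin> rstab (rtrans Y (mul g t))"
      "\<forall>cs. set cs \<subseteq> D \<longrightarrow> length cs = t \<longrightarrow> rtrans Y (sum_list cs) = rtrans Y (mul g t)"
  using stuck_alternative[OF assms]
proof (elim disjE exE conjE bexE, goal_cases)
  case (1 K)
  then show ?case by (intro periodic[of K])
next
  case (2 t J1 J2 a b)
  then show ?case by (intro moving[of t J1 J2 a b])
qed

section \<open>One-point changes and difference sets that are not uniform\<close>

lemma growth_insert:
  assumes "finite V"
  shows "growth V k \<le> growth (insert p V) k + 1"
proof -
  have "rtrans V k - V \<subseteq> insert p (rtrans (insert p V) k - insert p V)"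
    by (auto simp: mem_rtrans_iff)
  then have "growth V k \<le> card (insert p (rtrans (insert p V) k - insert p V))"
    unfolding growth_def using assms by (intro card_mono) auto
  also have "\<dots> \<le> growth (insert p V) k + 1"
    unfolding growth_def using card_insert_le_m1 card_insert_if assms by (simp add: card_insert_if)
  finally show ?thesis .
qed

lemma growth_remove:
  assumes "finite V"
  shows "growth V k \<le> growth (V - {p}) k + 1"
proof -
  have "rtrans V k - V \<subseteq> insert (p + k) (rtrans (V - {p}) k - (V - {p}))"
    by (auto simp: mem_rtrans_iff)
  then have "growth V k \<le> card (insert (p + k) (rtrans (V - {p}) k - (V - {p})))"
    unfolding growth_def using assms by (intro card_mono) auto
  also have "\<dots> \<le> growth (V - {p}) k + 1"
    unfolding growth_def using assms by (simp add: card_insert_if)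
  finally show ?thesis .
qed

text \<open>Applied to the periods of a set: as soon as one pair of terms makes the set grow, every
  pair of distinct terms does. Hence the pairs can be fixed in advance.\<close>

definition uniform_differences :: "'g::group_add set \<Rightarrow> bool" where
  "uniform_differences D \<longleftrightarrow> (\<forall>J. add_subgroup J \<longrightarrow> (\<exists>a\<in>D. \<exists>b\<in>D. a \<noteq> b \<and> a - b \<in> J)
    \<longrightarrow> (\<forall>a\<in>D. \<forall>b\<in>D. a - b \<in> J))"

text \<open>Some subgroup \<open>J'\<close> contains a nonzero difference but not all of them. Two
  elements have only one nonzero difference up to sign, which excludes \<open>|D| = 2\<close>; and a
  subgroup \<open>J\<close> with all differences meets \<open>J'\<close> in a proper subgroup of
  order at least 2.\<close>

lemma not_uniform_differences_card:
  assumes "\<not> uniform_differences D" "finite D"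
  shows "3 \<le> card D"
    and "finite J \<Longrightarrow> add_subgroup J \<Longrightarrow> (\<And>a b. a \<in> D \<Longrightarrow> b \<in> D \<Longrightarrow> a - b \<in> J) \<Longrightarrow> 4 \<le> card J"
proof -
  obtain J' a b c d where J': "add_subgroup J'" "a \<in> D" "b \<in> D" "a \<noteq> b" "a - b \<in> J'" "c \<in> D" "d \<in> D"
      "c - d \<notin> J'"
    using assms(1) unfolding uniform_differences_def by blast
  show "3 \<le> card D"
  proof (rule ccontr)
    assume "\<not> 3 \<le> card D"
    then have "card D \<le> card {a, b}" using J'(4) by simp
    then have "{a, b} = D" using J' assms(2) by (intro card_seteq) auto
    then have "(c = a \<or> c = b) \<and> (d = a \<or> d = b)" using J'(6,7) by blast
    moreover have "b - a \<in> J'" using add_subgroupD(3)[OF J'(1,5)] by simp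
    ultimately show False using J'(5,8) add_subgroupD(1)[OF J'(1)] by auto
  qed
  assume J: "finite J" "add_subgroup J" and in_J: "\<And>a b. a \<in> D \<Longrightarrow> b \<in> D \<Longrightarrow> a - b \<in> J"
  have "add_subgroup (J \<inter> J')" using J(2) J'(1) by (auto simp: add_subgroup_def)
  moreover have "J \<inter> J' \<subset> J" using in_J J' by blast
  ultimately have "2 * card (J \<inter> J') \<le> card J" by (rule card_proper_subgroup[OF J])
  moreover have "card {0, a - b} \<le> card (J \<inter> J')"
    using J J' in_J by (intro card_mono) (auto simp: add_subgroupD)
  moreover have "card {0, a - b} = 2" using J'(4) by simp
  ultimately show "4 \<le> card J" by linarith
qed

lemma normalized_inverse:
  fixes g :: "'g::group_add"
  assumes "finite K" "\<And>x. x \<in> K \<Longrightarrow> g + x - g \<in> K" "x \<in> K"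
  shows "- g + x + g \<in> K"
proof -
  have "(\<lambda>x. g + x - g) ` K = K"
  proof (rule endo_inj_surj[OF assms(1)])
    show "(\<lambda>x. g + x - g) ` K \<subseteq> K" using assms(2) by blast
    show "inj_on (\<lambda>x. g + x - g) K"
      by (rule inj_onI, drule arg_cong[of _ _ "\<lambda>z. z + g"]) simp
  qed
  then have "x \<in> (\<lambda>x. g + x - g) ` K" using assms(3) by simp
  then obtain y where "y \<in> K" "x = g + y - g" by (rule imageE)
  then show ?thesis by (simp add: diff_conv_add_uminus add.assoc del: add_uminus_conv_diff)
qed

text \<open>
  A step that ends at a periodic set with one extra point gains a lot and uses a term outside
  the coset of the period: this pays in advance for the unproductive step that has to follow.
\<close>

lemma step_to_isolated_point:
  assumes A: "finite A" "add_subgroup A" "a \<in> A" "b \<in> A" and ab: "a \<noteq> b"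
    and C: "finite C" "C \<noteq> {}" and eq: "rtrans C a \<union> rtrans C b = insert p Y" "p \<notin> Y"
    and K: "add_subgroup K" "K \<subseteq> A" "K \<subseteq> rstab Y" "\<And>x. x \<in> K \<Longrightarrow> g + x - g \<in> K"
  shows "card K + card C \<le> card (insert p Y) + 1" "\<not> (a - g \<in> K \<and> b - g \<in> K)"
proof -
  have finY: "finite Y" using eq C(1) by (metis finite_Un finite_insert finite_rtrans)
  have finK: "finite K" using A(1) K(2) finite_subset by blast
  define Ya where "Ya = rtrans Y (- a)"
  define Yb where "Yb = rtrans Y (- b)"
  have sub: "x = p - a \<or> x \<in> Ya" "x = p - b \<or> x \<in> Yb" if x: "x \<in> C" for x
  proof -
    have "x + a \<in> insert p Y" "x + b \<in> insert p Y" using rtransI[OF x] eq by blast+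
    then show "x = p - a \<or> x \<in> Ya" "x = p - b \<or> x \<in> Yb"
      by (auto simp: Ya_def Yb_def mem_rtrans_iff)
  qed
  \<comment> \<open>If the translates \<open>Ya\<close> and \<open>Yb\<close> agreed, a point of
    \<open>C\<close> outside them would be both \<open>p - a\<close> and \<open>p - b\<close>. So
    \<open>C\<close> would lie inside, and the extra point \<open>p\<close> could not arise.\<close>
  have ne: "- a - - b \<notin> rstab Y"
  proof
    assume "- a - - b \<in> rstab Y"
    then have eqY: "Ya = Yb" unfolding Ya_def Yb_def rtrans_eq_iff .
    have "p - a \<noteq> p - b"
      using ab by (simp only: diff_conv_add_uminus add_left_cancel neg_equal_iff_equal) simp
    then have "C \<subseteq> Ya" using sub eqY by blast
    then have "C \<subseteq> Ya" "C \<subseteq> Yb" using eqY by auto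
    then have "rtrans C a \<subseteq> rtrans Ya a" "rtrans C b \<subseteq> rtrans Yb b"
      by (simp_all add: rtrans_mono)
    then have "rtrans C a \<subseteq> Y" "rtrans C b \<subseteq> Y" by (simp_all add: Ya_def Yb_def rtrans_rtrans)
    then show False using eq by blast
  qed
  have "- a - - b \<in> A" by (intro add_subgroupD(4)[OF A(2)] add_subgroupD(3)[OF A(2)] A)
  then have gr: "card K \<le> growth Y (- a - - b)"
    using card_le_growth[OF A(1,2) K(1,2) _ finY K(3) ne] by blast
  have "card (Ya \<union> Yb) = card Y + growth Y (- a - - b)"
    unfolding Ya_def Yb_def by (rule card_Un_rtrans[OF finY])
  moreover have "card (Ya \<union> Yb) + card (Ya \<inter> Yb) = 2 * card Y"
    using card_Un_Int[of Ya Yb] finY by (simp add: Ya_def Yb_def)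
  \<comment> \<open>Up to the points \<open>p - a\<close> and \<open>p - b\<close>, the set
    \<open>C\<close> lies in both translates of \<open>Y\<close>, and their intersection has at most
    \<open>|Y| - |K|\<close> elements.\<close>
  moreover have "card C \<le> card (Ya \<inter> Yb) + 2"
  proof -
    have "card C \<le> card (insert (p - a) (insert (p - b) (Ya \<inter> Yb)))"
      using sub finY by (intro card_mono) (auto simp: Ya_def Yb_def)
    also have "\<dots> \<le> card (Ya \<inter> Yb) + 2"
      using finY by (simp add: card_insert_if Ya_def Yb_def)
    finally show ?thesis .
  qed
  ultimately show "card K + card C \<le> card (insert p Y) + 1"
    using gr eq(2) finY by simp
  show "\<not> (a - g \<in> K \<and> b - g \<in> K)"
  proof
    assume "a - g \<in> K \<and> b - g \<in> K"
    then have "- (a - g) + (b - g) \<in> K" using K(1) add_subgroupD(2,3) by blast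
    then have "- g + (- (a - g) + (b - g)) + g \<in> K"
      by (intro normalized_inverse[OF finK] K(4))
    moreover have "- g + (- (a - g) + (b - g)) + g = - a - - b"
      by (simp add: diff_conv_add_uminus add.assoc minus_add del: add_uminus_conv_diff)
    ultimately show False using ne K(3) by auto
  qed
qed

section \<open>Olson's theorem\<close>

definition zero_sum :: "'g::monoid_add multiset \<Rightarrow> bool" where
  "zero_sum T \<longleftrightarrow> (\<exists>xs. mset xs = T \<and> sum_list xs = 0)"

definition has_zero_sum :: "nat \<Rightarrow> 'g::monoid_add multiset \<Rightarrow> bool" where
  "has_zero_sum n R \<longleftrightarrow> (\<exists>T. T \<subseteq># R \<and> size T = n \<and> zero_sum T)"

text \<open>Only attainability is recorded: \<open>B\<close> may omit sums of terms of
  \<open>U\<close>, since each step follows one chosen pair.\<close>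

definition reach :: "'g::group_add multiset \<Rightarrow> nat \<Rightarrow> 'g set \<Rightarrow> bool" where
  "reach U s B \<longleftrightarrow> (\<forall>x\<in>B. \<exists>xs. mset xs \<subseteq># U \<and> length xs = s \<and> sum_list xs = x)"

lemma reach_rtrans:
  assumes "reach U s B"
  shows "reach (U + mset cs) (s + length cs) (rtrans B (sum_list cs))"
  unfolding reach_def
proof
  fix x assume "x \<in> rtrans B (sum_list cs)"
  then obtain y where y: "y \<in> B" "x = y + sum_list cs" unfolding rtrans_def by blast
  then obtain xs where "mset xs \<subseteq># U" "length xs = s" "sum_list xs = y"
    using assms unfolding reach_def by blast
  then show "\<exists>xs. mset xs \<subseteq># U + mset cs \<and> length xs = s + length cs \<and> sum_list xs = x"
    using y by (intro exI[of _ "xs @ cs"]) (simp add: subset_mset.add_mono)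
qed

lemma reach_mono: "reach U s B \<Longrightarrow> U \<subseteq># U' \<Longrightarrow> reach U' s B"
  unfolding reach_def by (meson subset_mset.order_trans)

lemma reach_Un: "reach U s B \<Longrightarrow> reach U s C \<Longrightarrow> reach U s (B \<union> C)"
  unfolding reach_def by blast

lemma reach_step:
  assumes "reach U s B"
  shows "reach (U + mset cs + {#a, b#}) (s + length cs + 1)
    (rtrans (rtrans B (sum_list cs)) a \<union> rtrans (rtrans B (sum_list cs)) b)"
proof -
  note r = reach_rtrans[OF assms, of cs]
  have "reach (U + mset cs + {#a#}) (s + length cs + 1) (rtrans (rtrans B (sum_list cs)) a)"
    "reach (U + mset cs + {#b#}) (s + length cs + 1) (rtrans (rtrans B (sum_list cs)) b)"
    using reach_rtrans[OF r, of "[a]"] reach_rtrans[OF r, of "[b]"] by simp_all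
  then show ?thesis by (intro reach_Un) (erule reach_mono, simp)+
qed

section \<open>Choice of terms and of disjoint pairs\<close>

lemma submultiset_of_size:
  assumes "k \<le> size M"
  shows "\<exists>xs. mset xs \<subseteq># M \<and> length xs = k"
proof -
  obtain ys where "mset ys = M" using ex_mset by blast
  moreover have "mset (take k ys) \<subseteq># mset ys"
    by (metis append_take_drop_id mset_append mset_subset_eq_add_left)
  ultimately show ?thesis using assms by (intro exI[of _ "take k ys"]) auto
qed

lemma pair_subset_mset: "a \<in># M \<Longrightarrow> b \<in># M \<Longrightarrow> a \<noteq> b \<Longrightarrow> {#a, b#} \<subseteq># M"
  by (simp add: insert_subset_eq_iff in_diff_count count_greater_zero_iff[symmetric] del:
      count_greater_zero_iff)

text \<open>Greedy choice: a most frequent value \<open>a\<close> is paired with any other. A value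
  outside the pair that then violates the multiplicity bound would fill more than half of the rest,
  while \<open>a\<close> is at most one occurrence behind it.\<close>

lemma disjoint_distinct_pairs:
  assumes "2 * d \<le> size M" "\<And>v. count M v + d \<le> size M"
  shows "\<exists>ps. length ps = d \<and> mset (map fst ps) + mset (map snd ps) \<subseteq># M \<and> (\<forall>p\<in>set ps. fst p \<noteq> snd p)"
  using assms
proof (induction d arbitrary: M)
  case (Suc d)
  have "M \<noteq> {#}" using Suc.prems(1) by auto
  have "\<exists>a. a \<in># M \<and> (\<forall>v. count M v \<le> count M a)"
  proof -
    obtain a where a: "a \<in> set_mset M" "count M a = Max (count M ` set_mset M)"
      using Max_in[of "count M ` set_mset M"] \<open>M \<noteq> {#}\<close> by fastforce
    have "count M v \<le> count M a" for v
      unfolding a(2) by (cases "v \<in># M") (auto simp: not_in_iff)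
    then show ?thesis using a(1) by blast
  qed
  then obtain a where a: "a \<in># M" "\<And>v. count M v \<le> count M a" by blast
  have "\<exists>b. b \<in># M \<and> b \<noteq> a"
  proof (rule ccontr)
    assume "\<not> ?thesis"
    then have "set_mset M \<subseteq> {a}" by blast
    then have "M = replicate_mset (size M) a" by (metis set_mset_subset_singletonD size_replicate_mset)
    then have "count M a = size M" by (metis count_replicate_mset)
    then show False using Suc.prems(2)[of a] by simp
  qed
  then obtain b where b: "b \<in># M" "b \<noteq> a" by blast
  define N where "N = M - {#a, b#}"
  have M: "M = add_mset a (add_mset b N)"
    using subset_mset.diff_add[OF pair_subset_mset[OF a(1) b(1)]] b(2) by (simp add: N_def)
  have "count N v + d \<le> size N" for v
  proof (cases "v = a \<or> v = b")
    case True
    then show ?thesis using Suc.prems(2)[of v] b(2) by (auto simp: M)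
  next
    case False
    have "count N a + count N v \<le> size N"
    proof -
      have "replicate_mset (count N a) a + replicate_mset (count N v) v \<subseteq># N"
        using False by (intro mset_subset_eqI) (auto simp: count_replicate_mset)
      then show ?thesis by (metis size_mset_mono size_replicate_mset size_union)
    qed
    moreover have "count N v \<le> count N a + 1" using a(2)[of v] False b(2)
        by (auto simp: M split: if_splits)
    ultimately show ?thesis using Suc.prems(2)[of v] Suc.prems(1) False by (auto simp: M)
  qed
  then obtain ps where ps: "length ps = d" "mset (map fst ps) + mset (map snd ps) \<subseteq># N"
      "\<forall>p\<in>set ps. fst p \<noteq> snd p"
    using Suc.IH[of N] Suc.prems(1) by (auto simp: M)
  show ?case using ps b(2) by (intro exI[of _ "(a, b) # ps"]) (simp add: M)
qed auto

text \<open>A counterexample with smallest subgroup. The length \<open>n\<close> does not shrink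
  with \<open>H\<close>, so only \<open>n a = 0\<close> on \<open>A\<close> and
  \<open>|H| \<le> n\<close> are required of it. All terms lie in \<open>H + g\<close>, and since
  \<open>g\<close> normalizes \<open>H\<close>, the sums of \<open>s\<close> terms lie in the single
  coset \<open>H + s g\<close>.\<close>

locale olson_setting =
  fixes A :: "'g::group_add set" and n :: nat and H :: "'g set" and g :: 'g and R :: "'g multiset"
  assumes finA: "finite A" and A: "add_subgroup A"
    and H: "add_subgroup H" "H \<subseteq> A" and gA: "g \<in> A" and norm: "\<And>x. x \<in> H \<Longrightarrow> g + x - g \<in> H"
    and mul_n: "\<And>a. a \<in> A \<Longrightarrow> mul a n = 0" and Hn: "card H \<le> n"
    and RH: "\<And>a. a \<in># R \<Longrightarrow> a - g \<in> H" and Rsize: "n + card H \<le> size R + 1"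
    and IH: "\<And>K g' R'. add_subgroup K \<Longrightarrow> K \<subseteq> A \<Longrightarrow> card K < card H \<Longrightarrow> g' \<in> A \<Longrightarrow>
      (\<And>x. x \<in> K \<Longrightarrow> g' + x - g' \<in> K) \<Longrightarrow> (\<And>a. a \<in># R' \<Longrightarrow> a - g' \<in> K) \<Longrightarrow>
      n + card K \<le> size R' + 1 \<Longrightarrow> has_zero_sum n R'"
    and none: "\<not> has_zero_sum n R"
begin

lemma finH: "finite H" using H(2) finA finite_subset by blast

lemma cardH: "1 \<le> card H"
  using finH add_subgroupD(1)[OF H(1)] by (metis card_gt_0_iff One_nat_def Suc_leI empty_iff)

lemma RA: "a \<in># R \<Longrightarrow> a \<in> A"
  using add_subgroupD(2)[OF A, of "a - g" g] RH[of a] H(2) gA by auto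

definition coset where "coset s = {x. x - mul g s \<in> H}"

lemma card_coset: "card (coset s) = card H" and fin_coset: "finite (coset s)"
proof -
  have "coset s = rtrans H (mul g s)" by (auto simp: coset_def mem_rtrans_iff)
  then show "card (coset s) = card H" "finite (coset s)" using finH by simp_all
qed

lemma conjn_H: "x \<in> H \<Longrightarrow> conjn g j x \<in> H"
  by (induction j arbitrary: x) (simp_all add: conjn_simps norm)

lemma coset_add:
  assumes "x \<in> coset s" "y \<in> coset t"
  shows "x + y \<in> coset (s + t)"
proof -
  have "x + y - mul g (s + t) = (x - mul g s) + conjn g s (y - mul g t)"
    by (simp add: conjn_def mul_add diff_conv_add_uminus add.assoc minus_add del: add_uminus_conv_diff)
  then show ?thesis
    using assms conjn_H add_subgroupD(2)[OF H(1)] by (simp add: coset_def)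
qed

lemma sum_list_coset: "set cs \<subseteq> set_mset R \<Longrightarrow> sum_list cs \<in> coset (length cs)"
proof (induction cs)
  case Nil
  then show ?case using add_subgroupD(1)[OF H(1)] by (simp add: coset_def)
next
  case (Cons c cs)
  then have "c \<in> coset 1" using RH by (simp add: coset_def mul_def)
  then show ?case using coset_add[of c 1 "sum_list cs" "length cs"] Cons by simp
qed

lemma rtrans_coset:
  assumes "B \<subseteq> coset s" "set cs \<subseteq> set_mset R"
  shows "rtrans B (sum_list cs) \<subseteq> coset (s + length cs)"
  using assms coset_add[OF _ sum_list_coset[OF assms(2)]] unfolding rtrans_def by blast

lemma coset_A: "coset s \<subseteq> A"
proof
  fix x assume "x \<in> coset s"
  then have "x - mul g s + mul g s \<in> A"
    using H(2) mul_mem[OF A gA] add_subgroupD(2)[OF A] unfolding coset_def by blast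
  then show "x \<in> A" by simp
qed

lemma reach_coset:
  assumes "reach U s B" "U \<subseteq># R"
  shows "B \<subseteq> coset s"
proof
  fix x assume "x \<in> B"
  then obtain xs where xs: "mset xs \<subseteq># U" "length xs = s" "sum_list xs = x"
    using assms(1) unfolding reach_def by blast
  have "mset xs \<subseteq># R" using xs(1) assms(2) by (rule subset_mset.order_trans)
  then have "set xs \<subseteq> set_mset R" using set_mset_mono by fastforce
  then show "x \<in> coset s" using sum_list_coset xs by blast
qed

lemma diff_in_A: "a \<in># R \<Longrightarrow> b \<in># R \<Longrightarrow> a - b \<in> A"
  using RA add_subgroupD(4)[OF A] by blast

text \<open>The set \<open>Y\<close> misses a full coset of its periods \<open>K\<close>, so
  \<open>|K| + |Y| \<le> |H|\<close>. Hence \<open>K\<close> is smaller than \<open>H\<close>, and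
  after discarding at most \<open>|Y|\<close> terms enough remain in the coset \<open>K + g'\<close>
  for the induction hypothesis.\<close>

lemma stable_coset_contradiction:
  assumes K: "add_subgroup K" "K \<subseteq> A" "\<And>x. x \<in> K \<Longrightarrow> g' + x - g' \<in> K" "g' \<in> A"
    and Y: "K \<subseteq> rstab Y" "Y \<subseteq> coset s" "Y \<noteq> {}" "Y \<noteq> coset s"
    and U: "U \<subseteq># R" "\<And>a. a \<in># R - U \<Longrightarrow> a - g' \<in> K" "size U \<le> card Y"
  shows False
proof -
  have finY: "finite Y" using Y(2) fin_coset finite_subset by blast
  have finK: "finite K" using K(2) finA finite_subset by blast
  have stab: "y + k \<in> Y" if "y \<in> Y" "k \<in> K" for y k
    using that Y(1) rstab_iff[OF finY] by blast
  obtain y where y: "y \<in> Y" using Y(3) by blast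
  have conjK: "mul g s + k - mul g s \<in> H" if k: "k \<in> K" for k
  proof -
    have "- (y - mul g s) + (y + k - mul g s) \<in> H"
      using y stab[OF y k] Y(2) add_subgroupD(2,3)[OF H(1)] unfolding coset_def by blast
    moreover have "- (y - mul g s) + (y + k - mul g s) = mul g s + k - mul g s"
      by (simp add: diff_conv_add_uminus add.assoc minus_add del: add_uminus_conv_diff)
    ultimately show ?thesis by simp
  qed
  obtain z where z: "z \<in> coset s" "z \<notin> Y" using Y(2,4) by blast
  have "ltrans z K \<subseteq> coset s - Y"
  proof
    fix x assume "x \<in> ltrans z K"
    then obtain k where k: "k \<in> K" "x = z + k" unfolding ltrans_def by blast
    have "x - mul g s = (z - mul g s) + (mul g s + k - mul g s)"
      unfolding k(2) by (simp add: diff_conv_add_uminus add.assoc del: add_uminus_conv_diff)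
    then have "x \<in> coset s" using z(1) conjK[OF k(1)] add_subgroupD(2)[OF H(1)] by (simp add: coset_def)
    moreover have "x \<notin> Y"
    proof
      assume "x \<in> Y"
      then have "x + - k \<in> Y" using stab add_subgroupD(3)[OF K(1) k(1)] by blast
      then show False using z(2) k(2) by (simp add: add.assoc)
    qed
    ultimately show "x \<in> coset s - Y" by blast
  qed
  then have "card K \<le> card (coset s - Y)"
    using card_mono[of "coset s - Y" "ltrans z K"] fin_coset by simp
  then have cK: "card K + card Y \<le> card H"
    using card_Diff_subset[OF finY Y(2)] card_mono[OF fin_coset Y(2)] card_coset[of s] by simp
  moreover have "card Y > 0" using y finY card_gt_0_iff by blast
  ultimately have "card K < card H" by simp
  moreover have "n + card K \<le> size (R - U) + 1"
    using size_Diff_submset[OF U(1)] size_mset_mono[OF U(1)] Rsize U(3) cK by linarith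
  ultimately have "has_zero_sum n (R - U)"
    using IH[OF K(1,2) _ K(4,3) U(2)] by blast
  then show False using none diff_subset_eq_self subset_mset.order_trans unfolding has_zero_sum_def
      by blast
qed

lemma full_contradiction:
  assumes "reach U s B" "U \<subseteq># R" "B = coset s" "size U + 1 \<le> card H + s" "s \<le> n"
  shows False
proof -
  have "n - s \<le> size (R - U)"
    using size_Diff_submset[OF assms(2)] size_mset_mono[OF assms(2)] Rsize assms(4) by linarith
  then obtain ys where ys: "mset ys \<subseteq># R - U" "length ys = n - s" using submultiset_of_size by blast
  have "set ys \<subseteq> set_mset R" using ys(1) by (metis in_diffD mset_subset_eqD set_mset_mset subsetI)
  then have y: "sum_list ys \<in> coset (n - s)" using sum_list_coset[of ys] ys(2) by simp
  have "mul g s \<in> coset s" using add_subgroupD(1)[OF H(1)] by (simp add: coset_def)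
  from coset_add[OF this y] have "mul g s + sum_list ys \<in> H"
    using assms(5) mul_n[OF gA] by (simp add: coset_def)
  then have "- (mul g s + sum_list ys) \<in> H" by (rule add_subgroupD(3)[OF H(1)])
  then have "- sum_list ys \<in> coset s" by (simp add: coset_def minus_add)
  then obtain xs where xs: "mset xs \<subseteq># U" "length xs = s" "sum_list xs = - sum_list ys"
    using assms(1,3) unfolding reach_def by blast
  have "zero_sum (mset (xs @ ys))" unfolding zero_sum_def using xs(3) by (intro exI[of _ "xs @ ys"]) simp
  moreover have "mset (xs @ ys) \<subseteq># R"
    using subset_mset.add_mono[OF xs(1) ys(1)] assms(2) by simp
  moreover have "size (mset (xs @ ys)) = n" using xs(2) ys(2) assms(5) by simp
  ultimately show False using none unfolding has_zero_sum_def by blast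
qed

lemma count_R: "count R v < n"
proof (rule ccontr)
  assume c: "\<not> count R v < n"
  then have sub: "replicate_mset n v \<subseteq># R" by (simp add: count_le_replicate_mset_subset_eq[symmetric])
  show False
  proof (cases "n = 0")
    case True
    then show ?thesis using Hn cardH by simp
  next
    case False
    then have "v \<in># R" using c by (metis count_eq_zero_iff gr0I)
    then have "zero_sum (replicate_mset n v)"
      unfolding zero_sum_def using mul_n[OF RA] by (intro exI[of _ "replicate n v"]) (simp add: mul_def)
    then show ?thesis using none sub unfolding has_zero_sum_def by (metis size_replicate_mset)
  qed
qed

lemma card_reach_le: "reach U s B \<Longrightarrow> U \<subseteq># R \<Longrightarrow> card B \<le> card H"
  using reach_coset card_mono[OF fin_coset] card_coset by metis

lemma card_step:
  assumes "finite B"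
  shows "card (rtrans (rtrans B y) a \<union> rtrans (rtrans B y) b) = card B + growth (rtrans B y) (a - b)"
  using card_Un_rtrans[of "rtrans B y" a b] assms by simp

lemma step_le:
  assumes "B \<subseteq> coset s" "set cs \<subseteq> set_mset R" "a \<in># R" "b \<in># R"
  shows "card B + growth (rtrans B (sum_list cs)) (a - b) \<le> card H"
proof -
  have "rtrans (rtrans B (sum_list cs)) c \<subseteq> coset (s + length cs + 1)" if "c \<in># R" for c
    using rtrans_coset[OF rtrans_coset[OF assms(1,2)], of "[c]"] that by simp
  then have "rtrans (rtrans B (sum_list cs)) a \<union> rtrans (rtrans B (sum_list cs)) b \<subseteq> coset (s +
      length cs + 1)"
    using assms by simp
  then show ?thesis
    using card_mono[OF fin_coset] card_coset card_step finite_subset[OF assms(1) fin_coset] by metis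
qed

lemma pow_ge: "t \<ge> 1 \<Longrightarrow> t + 1 \<le> (2::nat) ^ t"
  by (induction t rule: dec_induct) auto

text \<open>Exactly \<open>|H| - |B|\<close> disjoint pairs are reserved, so each must pay for one
  new element. A stuck set needs \<open>t\<close> fillers, taken from \<open>t\<close> pairs whose
  second terms are thrown away; the next pair then gains at least \<open>t + 1\<close>
  elements.\<close>

lemma uniform_contradiction:
  assumes state: "reach U s B" "U \<subseteq># R" "B \<noteq> {}" "s + 1 \<le> card B" "size U \<le> card B"
      "size U + 1 \<le> card B + s"
    and ud: "uniform_differences (set_mset (R - U))"
  shows False
proof -
  define D where "D = set_mset (R - U)"
  have DR: "D \<subseteq> set_mset R" unfolding D_def by (meson in_diffD subsetI)
  have DA: "D \<subseteq> A" using DR RA by blast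
  have ud': "a - b \<notin> J" if "add_subgroup J" "c \<in> D" "d \<in> D" "c - d \<notin> J" "a \<in> D" "b \<in> D" "a \<noteq> b"
      for J a b c d
    using ud that unfolding uniform_differences_def D_def by blast
  define d where "d = card H - card B"
  have BH: "card B + d = card H" using card_reach_le[OF state(1,2)] by (simp add: d_def)
  have sR: "size (R - U) + size U = size R" using size_Diff_submset[OF state(2)] size_mset_mono[OF
      state(2)] by linarith
  have "count (R - U) v + d \<le> size (R - U)" for v
    using count_R[of v] sR Rsize BH state(5) by (simp add: count_diff)
  moreover have "2 * d \<le> size (R - U)"
    using sR Rsize BH state(4,5) Hn by linarith
  ultimately obtain ps0 where ps0: "length ps0 = d" "mset (map fst ps0) + mset (map snd ps0) \<subseteq># R - U"
    "\<forall>p\<in>set ps0. fst p \<noteq> snd p"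
    using disjoint_distinct_pairs by blast
  have False if "reach U' s' B'" "card B \<le> card B'" "s' + 1 \<le> card B'"
      "U' + (mset (map fst ps) + mset (map snd ps)) \<subseteq># R" "\<forall>p\<in>set ps. fst p \<noteq> snd p \<and> fst p \<in> D
          \<and> snd p \<in> D"
      "card H \<le> card B' + length ps" "size U' + length ps + 1 \<le> card H + s'" for U' s' B' ps
    using that
  proof (induction "length ps" arbitrary: U' s' B' ps rule: less_induct)
    case less
    note st = less.prems
    have U'R: "U' \<subseteq># R" using st(4) subset_mset.order_trans mset_subset_eq_add_left by blast
    have B'c: "B' \<subseteq> coset s'" by (rule reach_coset[OF st(1) U'R])
    have finB': "finite B'" using B'c fin_coset finite_subset by blast
    have B'ne: "B' \<noteq> {}" using st(3) by auto
    have B'A: "B' \<subseteq> A" using B'c coset_A by blast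
    show False
    proof (cases "B' = coset s'")
      case True
      have "s' \<le> n" using st(3) True card_coset Hn by simp
      then show ?thesis using full_contradiction[OF st(1) U'R True] st(7) by simp
    next
      case False
      then have lt: "card B' < card H"
        using B'c psubset_card_mono[OF fin_coset, of B' s'] card_coset by auto
      then have psne: "ps \<noteq> []" using st(6) by auto
      then obtain p0 where p0: "p0 \<in> set ps" by (cases ps) auto
      then have g0: "fst p0 \<in> D" using st(5) by blast
      define g0 where "g0 = fst p0"
      have "\<exists>t. \<forall>cs. set cs \<subseteq> D \<longrightarrow> length cs = t \<longrightarrow>
          (\<forall>a\<in>D. \<forall>b\<in>D. a \<noteq> b \<longrightarrow> t + 1 \<le> growth (rtrans B' (sum_list cs)) (a - b))"
      proof (cases "\<forall>a\<in>D. \<forall>b\<in>D. a - b \<in> rstab B'")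
        case stuck: True
        have g0D: "g0 \<in> D" using g0 by (simp add: g0_def)
        from finA A B'A B'ne DA g0D stuck show ?thesis
        proof (cases rule: stuck_cases)
          case (periodic K)
          \<comment> \<open>All terms outside the original \<open>U\<close> are trapped in the
            coset, including those spent since. So the count uses \<open>U\<close>, whose size is at
            most \<open>|B|\<close>.\<close>
          have False
          proof (rule stable_coset_contradiction[of K g0 B' s' U])
            show "a - g0 \<in> K" if "a \<in># R - U" for a using periodic(5) that unfolding D_def by blast
            show "g0 \<in> A" using g0 DA unfolding g0_def by blast
          qed (use periodic B'c B'ne False state st in auto)
          then show ?thesis ..
        next
          case (moving t J1 J2 c e)
          show ?thesis
          proof (intro exI[of _ t] allI impI ballI)
            fix cs a b assume cs: "set cs \<subseteq> D" "length cs = t" and ab: "a \<in> D" "b \<in> D" "a \<noteq> b"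
            let ?V = "rtrans B' (mul g0 t)"
            have "a - b \<notin> rstab ?V"
              by (rule ud'[OF rstab_add_subgroup moving(9-11) ab])
            moreover have "a - b \<in> A" using ab DR diff_in_A by blast
            ultimately have gr: "card J2 \<le> growth ?V (a - b)"
              using card_le_growth[OF finA A moving(5,6) _ _ moving(8)] finB' by simp
            \<comment> \<open>A nonzero difference in \<open>J1\<close> supplies one more factor
              2.\<close>
            have "card {0, a - b} \<le> card J1"
              using moving(2,4) ab finite_subset[OF moving(3) finA]
                  by (intro card_mono) (auto simp: add_subgroupD)
            then have "2 \<le> card J1" using ab(3) by simp
            then have "2 ^ (t - 1) * 2 \<le> 2 ^ (t - 1) * card J1" by (rule mult_le_mono2)
            moreover have "2 ^ (t - 1) * 2 = (2::nat) ^ t" using moving(1) by (cases t) auto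
            ultimately have "2 ^ t \<le> card J2" using moving(7) by linarith
            moreover have "rtrans B' (sum_list cs) = ?V" using moving(12) cs by blast
            ultimately show "t + 1 \<le> growth (rtrans B' (sum_list cs)) (a - b)"
              using gr pow_ge[OF moving(1)] by simp
          qed
        qed
      next
        case False
        then obtain c e where ce: "c \<in> D" "e \<in> D" "c - e \<notin> rstab B'" by blast
        have "1 \<le> growth B' (a - b)" if "a \<in> D" "b \<in> D" "a \<noteq> b" for a b
        proof -
          have "growth B' (a - b) \<noteq> 0"
            using ud'[OF rstab_add_subgroup ce that] growth_eq_0_iff[OF finB'] by blast
          then show ?thesis by simp
        qed
        then show ?thesis by (intro exI[of _ 0]) simp
      qed
      then obtain t where t: "\<And>cs a b. set cs \<subseteq> D \<Longrightarrow> length cs = t \<Longrightarrow> a \<in> D \<Longrightarrow> b \<in> D \<Longrightarrow> a \<noteq> b \<Longrightarrow>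
          t + 1 \<le> growth (rtrans B' (sum_list cs)) (a - b)" by blast
      have p0': "fst p0 \<in> D" "snd p0 \<in> D" "fst p0 \<noteq> snd p0" using p0 st(5) by auto
      \<comment> \<open>The promised growth has to fit into the coset, so enough pairs are left to
        supply \<open>t\<close> fillers.\<close>
      have "card B' + (t + 1) \<le> card H"
      proof -
        let ?cs = "replicate t g0"
        have cs: "set ?cs \<subseteq> D" using g0 by (auto simp: g0_def)
        show ?thesis
          using t[OF cs _ p0'] step_le[OF B'c, of ?cs "fst p0" "snd p0"] cs DR p0' by force
      qed
      then have len: "t + 1 \<le> length ps" using st(6) by linarith
      define cs where "cs = map fst (take t ps)"
      define q where "q = ps ! t"
      define rest where "rest = drop (t + 1) ps"
      have ps: "ps = take t ps @ q # rest"
        using len unfolding q_def rest_def by (simp add: id_take_nth_drop)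
      have setps: "set ps = set (take t ps) \<union> {q} \<union> set rest" by (subst ps) auto
      have csD: "set cs \<subseteq> D" using st(5) setps unfolding cs_def by auto
      have lcs: "length cs = t" using len by (simp add: cs_def)
      have q: "fst q \<in> D" "snd q \<in> D" "fst q \<noteq> snd q" using st(5) setps by auto
      define B2 where "B2 = rtrans (rtrans B' (sum_list cs)) (fst q) \<union> rtrans (rtrans B' (sum_list
          cs)) (snd q)"
      define U2 where "U2 = U' + mset cs + {#fst q, snd q#}"
      have cB2: "card B' + t + 1 \<le> card B2"
        using t[OF csD lcs q] card_step[OF finB'] by (simp add: B2_def)
      have mps: "mset (map fst ps) + mset (map snd ps) = mset cs + mset (map snd (take t ps))
          + {#fst q, snd q#} + (mset (map fst rest) + mset (map snd rest))"
        by (subst (1 2) ps) (simp add: cs_def)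
      have lrest: "length rest + t + 1 = length ps" using len by (simp add: rest_def)
      show False
      proof (rule less.hyps[of rest U2 "s' + t + 1" B2])
        show "length rest < length ps" using lrest by simp
        show "reach U2 (s' + t + 1) B2"
          using reach_step[OF st(1), of cs "fst q" "snd q"] lcs by (simp add: U2_def B2_def)
        show "U2 + (mset (map fst rest) + mset (map snd rest)) \<subseteq># R"
        proof -
          have "U2 + (mset (map fst rest) + mset (map snd rest)) \<subseteq># U' + (mset (map fst ps) + mset
              (map snd ps))"
            unfolding mps U2_def by (simp add: union_assoc union_commute union_lcomm)
          then show ?thesis using st(4) by (rule subset_mset.order_trans)
        qed
        show "\<forall>p\<in>set rest. fst p \<noteq> snd p \<and> fst p \<in> D \<and> snd p \<in> D" using st(5) setps by blast
        show "size U2 + length rest + 1 \<le> card H + (s' + t + 1)"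
          using st(7) lrest lcs by (simp add: U2_def)
      qed (use st cB2 lrest in auto)
    qed
  qed
  from this[of U s B ps0] show False
  proof
    show "U + (mset (map fst ps0) + mset (map snd ps0)) \<subseteq># R"
      using ps0(2) state(2) subset_mset.add_mono[of U U]
          by (metis subset_mset.add_diff_inverse subset_mset.order_refl)
    show "\<forall>p\<in>set ps0. fst p \<noteq> snd p \<and> fst p \<in> D \<and> snd p \<in> D"
    proof -
      have "fst p \<in># R - U \<and> snd p \<in># R - U" if "p \<in> set ps0" for p
        using that mset_subset_eqD[OF ps0(2)] by auto
      then show ?thesis using ps0(3) by (auto simp: D_def)
    qed
  qed (use state BH ps0(1) in auto)
qed

text \<open>
  The set \<open>B\<close> is periodic up to one extra point, with a period whose coset contains all the
  remaining terms: all pairs of remaining terms now add a single element, for two terms spent.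
\<close>

definition isolated_point :: "'g set \<Rightarrow> 'g set \<Rightarrow> bool" where
  "isolated_point B D \<longleftrightarrow> \<not> uniform_differences D \<and>
    (\<exists>K g' p Y. add_subgroup K \<and> K \<subseteq> A \<and> (\<forall>x\<in>K. g' + x - g' \<in> K) \<and> (\<forall>d\<in>D. d - g' \<in> K)
      \<and> K \<subseteq> rstab Y \<and> p \<notin> Y \<and> B = insert p Y)"

text \<open>The period \<open>K\<close> contains all differences of \<open>D\<close>, so it has
  order at least 4, and arriving at the isolated point gains at least \<open>|K| - 1\<close>. Since
  \<open>a\<close> or \<open>b\<close> is outside the coset of \<open>K\<close>, the group
  \<open>K\<close> meets \<open>J1\<close> in a proper subgroup, which has at least
  \<open>|D| \<ge> 3\<close> elements.\<close>

lemma isolated_point_growth: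
  assumes V: "finite V" "V \<noteq> {}" and ab: "a \<in> A" "b \<in> A" "a \<noteq> b" and D: "finite D"
    and iso: "isolated_point (rtrans V a \<union> rtrans V b) D"
  shows "3 \<le> growth V (a - b)"
    and "add_subgroup J1 \<Longrightarrow> finite J1 \<Longrightarrow> D \<subseteq> E \<Longrightarrow> \<forall>c\<in>E. \<forall>d\<in>E. c - d \<in> J1 \<Longrightarrow> a \<in> E \<Longrightarrow> b \<in> E
      \<Longrightarrow> 6 \<le> card J1"
proof -
  obtain K g' p Y where nu: "\<not> uniform_differences D" and K: "add_subgroup K" "K \<subseteq> A"
    "\<forall>x\<in>K. g' + x - g' \<in> K" "\<forall>d\<in>D. d - g' \<in> K" "K \<subseteq> rstab Y" "p \<notin> Y"
    and eq: "rtrans V a \<union> rtrans V b = insert p Y"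
    using iso unfolding isolated_point_def by blast
  have diffs: "c - d \<in> K" if "c - g' \<in> K" "d - g' \<in> K" for c d
  proof -
    have "c - d = (c - g') - (d - g')"
      by (simp add: diff_conv_add_uminus add.assoc minus_add del: add_uminus_conv_diff)
    then show ?thesis using that add_subgroupD(4)[OF K(1)] by simp
  qed
  have finK: "finite K" using K(2) finA finite_subset by blast
  note st = step_to_isolated_point[OF finA A ab V eq K(6) K(1,2,5), of g']
  have "4 \<le> card K"
    using not_uniform_differences_card(2)[OF nu D finK K(1)] diffs K(4) by blast
  moreover have "card K + card V \<le> card (insert p Y) + 1" using st(1) K(3) by blast
  moreover have "card (insert p Y) = card V + growth V (a - b)"
    using card_Un_rtrans[OF V(1), of a b] eq by simp
  ultimately show "3 \<le> growth V (a - b)" by linarith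
  assume J1: "add_subgroup J1" "finite J1" and E: "D \<subseteq> E" "\<forall>c\<in>E. \<forall>d\<in>E. c - d \<in> J1" "a \<in> E" "b \<in> E"
  have "card D > 0" using not_uniform_differences_card(1)[OF nu D] by linarith
  then obtain d0 where d0: "d0 \<in> D" by (metis card_gt_0_iff ex_in_conv)
  have out: "\<not> (a - g' \<in> K \<and> b - g' \<in> K)" using st(2) K(3) by blast
  have "\<not> J1 \<subseteq> K"
  proof
    assume "J1 \<subseteq> K"
    then have "c - g' \<in> K" if "c \<in> E" for c
    proof -
      have "c - d0 \<in> K" using \<open>J1 \<subseteq> K\<close> E d0 that by blast
      then have "(c - d0) + (d0 - g') \<in> K" using K(1,4) d0 add_subgroupD(2) by blast
      then show ?thesis by (simp add: diff_conv_add_uminus add.assoc del: add_uminus_conv_diff)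
    qed
    then show False using out E by blast
  qed
  then have "K \<inter> J1 \<subset> J1" by blast
  moreover have "add_subgroup (K \<inter> J1)" using K(1) J1(1) by (auto simp: add_subgroup_def)
  ultimately have "2 * card (K \<inter> J1) \<le> card J1" using card_proper_subgroup[OF J1(2,1)] by blast
  moreover have "card D \<le> card (K \<inter> J1)"
  proof (rule card_inj_on_le[where f = "\<lambda>d. d - d0"])
    show "inj_on (\<lambda>d. d - d0) D" by (rule inj_onI, drule arg_cong[of _ _ "\<lambda>z. z + d0"]) simp
    show "(\<lambda>d. d - d0) ` D \<subseteq> K \<inter> J1" using diffs K(4) d0 E by blast
    show "finite (K \<inter> J1)" using J1 by blast
  qed
  ultimately show "6 \<le> card J1" using not_uniform_differences_card(1)[OF nu D] by linarith
qed

text \<open>A set \<open>D\<close> that is not uniform has a third element \<open>c\<close>. If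
  \<open>x - c\<close> were a period, \<open>a - b\<close> would have growth 2; so
  \<open>a - c\<close>, \<open>b - c\<close> and their difference \<open>a - b\<close> all have
  growth 1, and the structure of such sets applies.\<close>

lemma slow_set_structure:
  assumes B: "B \<subseteq> coset s" "B \<noteq> {}" and D: "D \<subseteq> set_mset R" "\<not> uniform_differences D"
    and slow: "\<forall>a\<in>D. \<forall>b\<in>D. growth B (a - b) \<le> 1"
  obtains (same) "\<forall>a\<in>D. \<forall>b\<in>D. a - b \<in> rstab B"
    | (plus) Y p a b where "\<forall>a\<in>D. \<forall>b\<in>D. a - b \<in> rstab Y" "Y \<subseteq> coset s" "p \<notin> Y" "B = insert p Y"
        "a \<in> D" "b \<in> D" "a \<noteq> b" "growth B (a - b) = 1"
    | (minus) Y p a b where "\<forall>a\<in>D. \<forall>b\<in>D. a - b \<in> rstab Y" "Y \<subseteq> coset s" "p \<in> Y" "B = Y - {p}"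
        "a \<in> D" "b \<in> D" "a \<noteq> b" "growth B (a - b) = 1"
proof (cases "\<forall>a\<in>D. \<forall>b\<in>D. a - b \<in> rstab B")
  case True
  then show ?thesis by (rule same)
next
  case False
  have finB: "finite B" using B(1) fin_coset finite_subset by blast
  have finD: "finite D" using D(1) finite_subset by blast
  have diffA: "x - y \<in> A" if "x \<in> D" "y \<in> D" for x y using that D(1) diff_in_A by blast
  obtain a b where ab: "a \<in> D" "b \<in> D" "a - b \<notin> rstab B" using False by blast
  have g1: "growth B (a - b) = 1"
    using bspec[OF bspec[OF slow ab(1)] ab(2)] growth_eq_0_iff[OF finB, of "a - b"] ab(3) by linarith
  have "a \<noteq> b" using ab(3) add_subgroupD(1)[OF rstab_add_subgroup, of B] by auto
  have "\<not> D \<subseteq> {a, b}"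
  proof
    assume "D \<subseteq> {a, b}"
    then have "card D \<le> card {a, b}" by (intro card_mono) auto
    then show False using not_uniform_differences_card(1)[OF D(2) finD] \<open>a \<noteq> b\<close> by simp
  qed
  then obtain c where c: "c \<in> D" "c \<noteq> a" "c \<noteq> b" by blast
  have one: "growth B (x - c) = 1" if x: "x \<in> D" "x \<noteq> c" for x
  proof -
    have "x - c \<notin> rstab B"
    proof
      assume "x - c \<in> rstab B"
      then have "2 \<le> growth B (a - b)"
        using two_le_growth[OF finA A _ _ finB _ _ ab(3), of "x - c"] diffA x c ab by auto
      then show False using g1 by simp
    qed
    then show ?thesis using bspec[OF bspec[OF slow x(1)] c(1)] growth_eq_0_iff[OF finB, of "x - c"]
        by linarith
  qed
  have diff: "(a - c) - (b - c) = a - b"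
    by (simp add: diff_conv_add_uminus add.assoc minus_add del: add_uminus_conv_diff)
  have "a - c \<noteq> b - c" using \<open>a \<noteq> b\<close> diff by auto
  then obtain Y p where Y: "a - c \<in> rstab Y" "b - c \<in> rstab Y" "finite Y"
      "p \<notin> Y \<and> B = insert p Y \<or> p \<in> Y \<and> B = Y - {p}"
    using thin_set_structure[OF finA A, of "a - c"
        "b - c" B] diffA ab c finB g1 one[of a] one[of b] diff by auto
  \<comment> \<open>The set \<open>Y\<close> has three periods in \<open>A\<close>, so any other
    direction has growth at least 3; but \<open>Y\<close> differs from \<open>B\<close> in one
    point, which changes the growth by at most 1.\<close>
  have stab: "d - c \<in> rstab Y" if d: "d \<in> D" for d
  proof (rule ccontr)
    assume n: "d - c \<notin> rstab Y"
    have "add_subgroup (rstab Y \<inter> A)" using rstab_add_subgroup[of Y] A by (auto simp: add_subgroup_def)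
    then have "card (rstab Y \<inter> A) \<le> growth Y (d - c)"
      using card_le_growth[OF finA A _ _ _ Y(3) _ n] diffA d c by blast
    moreover have "card {0, a - c, b - c} \<le> card (rstab Y \<inter> A)"
      using Y(1,2) diffA ab c finA add_subgroupD(1)[OF A] add_subgroupD(1)[OF rstab_add_subgroup, of Y]
      by (intro card_mono) auto
    moreover have "card {0, a - c, b - c} = 3" using \<open>a - c \<noteq> b - c\<close> c by auto
    moreover have "growth Y (d - c) \<le> growth B (d - c) + 1"
      using Y(4) growth_insert[OF Y(3), of "d - c" p] growth_remove[OF Y(3), of "d - c" p] by auto
    ultimately show False using bspec[OF bspec[OF slow d] c(1)] by linarith
  qed
  have diffs: "\<forall>x\<in>D. \<forall>y\<in>D. x - y \<in> rstab Y"
  proof (intro ballI)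
    fix x y assume "x \<in> D" "y \<in> D"
    then have "(x - c) - (y - c) \<in> rstab Y" using stab add_subgroupD(4)[OF rstab_add_subgroup] by blast
    then show "x - y \<in> rstab Y"
      by (simp add: diff_conv_add_uminus add.assoc minus_add del: add_uminus_conv_diff)
  qed
  \<comment> \<open>A deleted point \<open>p\<close> differs from some point of \<open>B\<close> by
    a difference of terms, which lies in the subgroup that fixes the coset.\<close>
  have Yc: "Y \<subseteq> coset s"
  proof (cases "p \<in> Y")
    case False
    then show ?thesis using Y(4) B(1) by blast
  next
    case True
    define q where "q = p + (a - c)"
    have "q \<in> Y" using True Y(1) rstab_iff[OF Y(3)] by (simp add: q_def)
    moreover have "q \<noteq> p" using c(2) unfolding q_def
        by (metis add_0_right add_left_cancel eq_iff_diff_eq_0)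
    ultimately have "q \<in> coset s" using Y(4) True B(1) by blast
    moreover have "- (a - c) \<in> coset 0"
    proof -
      have "- ((a - g) - (c - g)) \<in> H"
        using RH ab(1) c(1) D(1) add_subgroupD(3,4)[OF H(1)] by blast
      then show ?thesis
        by (simp add: coset_def diff_conv_add_uminus add.assoc minus_add del: add_uminus_conv_diff)
    qed
    ultimately have "q + - (a - c) \<in> coset s" using coset_add[of q s _ 0] by simp
    moreover have "q + - (a - c) = p"
      by (simp add: q_def add.assoc del: minus_diff_eq)
    ultimately show ?thesis using Y(4) B(1) by auto
  qed
  show ?thesis using Y(4) plus[OF diffs Yc _ _ ab(1,2) \<open>a \<noteq> b\<close> g1] minus[OF diffs Yc _ _ ab(1,2) \<open>a
      \<noteq> b\<close> g1] by blast
qed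

lemma growth_le_near:
  assumes "finite W" "V = W \<or> V = insert p W \<or> V = W - {p}"
  shows "growth W k \<le> growth V k + 1"
  using assms growth_insert[OF assms(1)] growth_remove[OF assms(1)] by auto

text \<open>The 4 is the least order of a subgroup with all differences of a set that is not
  uniform. One unit is lost to the extra or missing point, and \<open>t + 2\<close> pays for
  \<open>t\<close> fillers and a pair.\<close>

lemma pow_ge4: "t \<ge> 1 \<Longrightarrow> t + 3 \<le> 2 ^ (t - 1) * (4::nat)"
  using less_exp[of "t - 1"] by linarith

text \<open>With order 6 in place of 4 there is one element more: the credit due when an isolated
  point is reached.\<close>

lemma pow_ge6: "t \<ge> 1 \<Longrightarrow> t + 4 \<le> 2 ^ (t - 1) * (6::nat)"
  using less_exp[of "t - 1"] by linarith

text \<open>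
  The bounds on \<open>size U\<close> hold for \<open>B = {0}\<close> and are kept because each step gains almost as many
  elements as it spends terms. The last hypothesis is the credit needed at an isolated point,
  where one element is gained for two terms.
\<close>

lemma invariant_contradiction:
  assumes "reach U s B" "U \<subseteq># R" "B \<noteq> {}" "s + 1 \<le> card B" "size U \<le> card B" "size U + 1 \<le> card B + s"
    "isolated_point B (set_mset (R - U)) \<Longrightarrow> size U + 1 \<le> card B"
  shows False
  using assms
proof (induction "card H - card B" arbitrary: U s B rule: less_induct)
  case less
  note st = less.prems
  define D where "D = set_mset (R - U)"
  have DR: "D \<subseteq> set_mset R" unfolding D_def by (meson in_diffD subsetI)
  have DA: "D \<subseteq> A" using DR RA by blast
  have finD: "finite D" by (simp add: D_def)
  have Bc: "B \<subseteq> coset s" by (rule reach_coset[OF st(1,2)])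
  have finB: "finite B" using Bc fin_coset finite_subset by blast
  have sR: "size (R - U) + size U = size R" using size_Diff_submset[OF st(2)] size_mset_mono[OF
      st(2)] by linarith
  \<comment> \<open>A step adds \<open>|cs| + 2\<close> terms to \<open>U\<close> and
    \<open>|cs| + 1\<close> to \<open>s\<close>; the hypotheses are what the invariants then ask of
    the growth.\<close>
  have next_step: False if cs: "mset cs + {#a, b#} \<subseteq># R - U" and ab: "a \<noteq> b"
      and gr: "length cs + 1 \<le> growth (rtrans B (sum_list cs)) (a - b)"
        "size U + length cs + 2 \<le> card B + growth (rtrans B (sum_list cs)) (a - b)"
      and iso: "\<And>D'. D' \<subseteq> D \<Longrightarrow> isolated_point (rtrans (rtrans B (sum_list cs)) a \<union> rtrans (rtrans B
          (sum_list cs)) b) D'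
        \<Longrightarrow> size U + length cs + 3 \<le> card B + growth (rtrans B (sum_list cs)) (a - b)" for cs a b
  proof -
    define U2 where "U2 = U + mset cs + {#a, b#}"
    define B2 where "B2 = rtrans (rtrans B (sum_list cs)) a \<union> rtrans (rtrans B (sum_list cs)) b"
    have U2: "U2 \<subseteq># R"
      using subset_mset.add_mono[OF subset_mset.order_refl[of U] cs] st(2)
          by (simp add: U2_def add.assoc)
    have r2: "reach U2 (s + length cs + 1) B2" unfolding U2_def B2_def by (rule reach_step[OF st(1)])
    have c2: "card B2 = card B + growth (rtrans B (sum_list cs)) (a - b)"
      unfolding B2_def by (rule card_step[OF finB])
    have D2: "set_mset (R - U2) \<subseteq> D"
      unfolding D_def U2_def by (rule set_mset_mono) (metis add.assoc diff_diff_add_mset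
          diff_subset_eq_self)
    show False
    proof (rule less.hyps[OF _ r2 U2])
      show "card H - card B2 < card H - card B" using c2 gr(1) card_reach_le[OF r2 U2] by linarith
      show "isolated_point B2 (set_mset (R - U2)) \<Longrightarrow> size U2 + 1 \<le> card B2"
        using iso[OF D2] c2 by (simp add: B2_def U2_def)
      show "B2 \<noteq> {}" using st(3) by (simp add: B2_def)
    qed (use c2 gr st in \<open>simp_all add: U2_def\<close>)
  qed
  show False
  proof (cases "B = coset s")
    case True
    then show False using full_contradiction[OF st(1,2) True] st(4,6) card_coset[of s] Hn by simp
  next
    case nfull: False
    then have lt: "card B < card H"
      using Bc psubset_card_mono[OF fin_coset, of B s] card_coset by auto
    show False
    proof (cases "uniform_differences D")
      case True
      then show False using uniform_contradiction[OF st(1-6)] by (simp add: D_def)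
    next
      case nu: False
      have "D \<noteq> {}" using not_uniform_differences_card(1)[OF nu finD] by auto
      then obtain g0 where g0: "g0 \<in> D" by blast
      show False
      proof (cases "\<exists>a\<in>D. \<exists>b\<in>D. 2 \<le> growth B (a - b)")
        case True
        then obtain a b where ab: "a \<in> D" "b \<in> D" "2 \<le> growth B (a - b)" by blast
        have "a \<noteq> b"
        proof
          assume "a = b"
          then have "growth B (a - b) = 0" by (simp add: growth_def)
          then show False using ab(3) by simp
        qed
        show False
        proof (rule next_step[of "[]" a b])
          show "mset [] + {#a, b#} \<subseteq># R - U"
            using pair_subset_mset[of a "R - U" b] ab \<open>a \<noteq> b\<close> by (simp add: D_def)
          fix D' assume "D' \<subseteq> D" and iso: "isolated_point (rtrans (rtrans B (sum_list [])) a \<union>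
              rtrans (rtrans B (sum_list [])) b) D'"
          then have "3 \<le> growth B (a - b)"
            using isolated_point_growth(1)[OF finB st(3) _ _ \<open>a \<noteq> b\<close>, of D'] ab DA finD
                finite_subset by auto
          then show "size U + length [] + 3 \<le> card B + growth (rtrans B (sum_list [])) (a - b)"
            using st(5) by simp
        qed (use ab \<open>a \<noteq> b\<close> st in auto)
      next
        case False
        have slow: "\<forall>a\<in>D. \<forall>b\<in>D. growth B (a - b) \<le> 1"
        proof (intro ballI, rule ccontr)
          fix a b assume ab: "a \<in> D" "b \<in> D" and "\<not> growth B (a - b) \<le> 1"
          then have "2 \<le> growth B (a - b)" by linarith
          then show False using False ab by blast
        qed
        \<comment> \<open>One element for two terms, paid for by the credit. The new set is not an
          isolated point again, as reaching one takes growth 3.\<close>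
        have isolated: False if "size U + 1 \<le> card B" "a \<in> D" "b \<in> D" "a \<noteq> b" "growth B (a - b) = 1"
            for a b
        proof (rule next_step[of "[]" a b])
          show "mset [] + {#a, b#} \<subseteq># R - U"
            using pair_subset_mset[of a "R - U" b] that by (simp add: D_def)
          fix D' assume "D' \<subseteq> D" and iso: "isolated_point (rtrans (rtrans B (sum_list [])) a \<union>
              rtrans (rtrans B (sum_list [])) b) D'"
          then have "3 \<le> growth B (a - b)"
            using isolated_point_growth(1)[OF finB st(3) _ _ that(4), of D'] that DA finD
                finite_subset by auto
          then show "size U + length [] + 3 \<le> card B + growth (rtrans B (sum_list [])) (a - b)"
            using that by simp
        qed (use that in auto)
        have moving: False if near: "B = Y \<or> B = insert p Y \<or> B = Y - {p}" and Y: "finite Y"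
            and t: "t \<ge> 1" "add_subgroup J1" "J1 \<subseteq> A" "\<forall>a\<in>D. \<forall>b\<in>D. a - b \<in> J1"
              "add_subgroup J2" "J2 \<subseteq> A" "2 ^ (t - 1) * card J1 \<le> card J2"
              "J2 \<subseteq> rstab (rtrans Y (mul g0 t))" "a \<in> D" "b \<in> D" "a - b \<notin> rstab (rtrans Y (mul g0 t))"
              "\<forall>cs. set cs \<subseteq> D \<longrightarrow> length cs = t \<longrightarrow> rtrans Y (sum_list cs) = rtrans Y (mul g0 t)"
          for Y p t J1 J2 a b
        proof -
          have finJ1: "finite J1" using t(3) finA finite_subset by blast
          have ab: "a \<noteq> b" using t(11) add_subgroupD(1)[OF rstab_add_subgroup, of
              "rtrans Y (mul g0 t)"] by auto
          have big: "card J2 \<le> growth (rtrans Y (mul g0 t)) (a - b)"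
            using card_le_growth[OF finA A t(5,6) _ _ t(8,11)] Y t(9,10) DR diff_in_A by auto
          have near': "growth (rtrans Y (mul g0 t)) k \<le> growth (rtrans B (sum_list cs)) k + 1"
            if cs: "set cs \<subseteq> D" "length cs = t" for cs k
          proof (rule growth_le_near[where p = "p + sum_list cs"])
            have eq: "rtrans Y (mul g0 t) = rtrans Y (sum_list cs)" using t(12) cs by simp
            have "rtrans {p} (sum_list cs) = {p + sum_list cs}" by (simp add: rtrans_def)
            then show "rtrans B (sum_list cs) = rtrans Y (mul g0 t)
                \<or> rtrans B (sum_list cs) = insert (p + sum_list cs) (rtrans Y (mul g0 t))
                \<or> rtrans B (sum_list cs) = rtrans Y (mul g0 t) - {p + sum_list cs}"
              using near unfolding eq by (auto simp: rtrans_insert rtrans_Diff)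
          qed (use Y in simp)
          have gr: "2 ^ (t - 1) * card J1 \<le> growth (rtrans B (sum_list cs)) (a - b) + 1"
            if "set cs \<subseteq> D" "length cs = t" for cs
            by (rule le_trans[OF t(7) le_trans[OF big near'[OF that]]])
          have "4 \<le> card J1" using not_uniform_differences_card(2)[OF nu finD finJ1 t(2)] t(4) by blast
          then have "2 ^ (t - 1) * 4 \<le> 2 ^ (t - 1) * card J1" by (rule mult_le_mono2)
          then have gr4: "t + 2 \<le> growth (rtrans B (sum_list cs)) (a - b)"
            if "set cs \<subseteq> D" "length cs = t" for cs
            using gr[OF that] pow_ge4[OF t(1)] by linarith
          have "card B + (t + 2) \<le> card H"
            using gr4[of "replicate t g0"] step_le[OF Bc, of "replicate t g0" a b] g0 t(9,10) DR by force
          then have "t \<le> size (R - U - {#a, b#})"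
            using sR Rsize st(5) Hn size_Diff_submset[OF pair_subset_mset[of a "R - U" b]] t(9,10) ab
            by (simp add: D_def)
          then obtain cs where cs: "mset cs \<subseteq># R - U - {#a, b#}" "length cs = t"
            using submultiset_of_size by blast
          have csD: "set cs \<subseteq> D"
            using cs(1) unfolding D_def by (metis in_diffD mset_subset_eqD set_mset_mset subsetI)
          show False
          proof (rule next_step[of cs a b])
            show "mset cs + {#a, b#} \<subseteq># R - U"
            proof -
              have sub: "{#a, b#} \<subseteq># R - U" using pair_subset_mset t(9,10) ab by (simp add: D_def)
              show ?thesis
                using subset_mset.add_mono[OF cs(1) subset_mset.order_refl[of "{#a, b#}"]]
                unfolding subset_mset.diff_add[OF sub] .
            qed
            show "size U + length cs + 2 \<le> card B + growth (rtrans B (sum_list cs)) (a - b)"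
              using gr4[OF csD cs(2)] st(5) cs(2) by linarith
            show "length cs + 1 \<le> growth (rtrans B (sum_list cs)) (a - b)"
              using gr4[OF csD cs(2)] cs(2) by linarith
            fix D' assume D': "D' \<subseteq> D"
              and iso: "isolated_point (rtrans (rtrans B (sum_list cs)) a \<union> rtrans (rtrans B
                  (sum_list cs)) b) D'"
            have "6 \<le> card J1"
            proof (rule isolated_point_growth(2)[OF _ _ _ _ ab _ iso t(2) finJ1 D' t(4) t(9,10)])
              show "finite D'" using D' finD finite_subset by blast
              show "rtrans B (sum_list cs) \<noteq> {}" using st(3) by simp
            qed (use finB t(9,10) DA in auto)
            then have "2 ^ (t - 1) * 6 \<le> 2 ^ (t - 1) * card J1" by (rule mult_le_mono2)
            then show "size U + length cs + 3 \<le> card B + growth (rtrans B (sum_list cs)) (a - b)"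
              using gr[OF csD cs(2)] pow_ge6[OF t(1)] st(5) cs(2) by linarith
          qed (rule ab)
        qed
        have g0A: "g0 \<in> A" using g0 DA by blast
        have main: False if near: "B = Y \<or> B = insert p Y \<or> B = Y - {p}"
            and Y: "Y \<subseteq> coset s" "Y \<noteq> {}" "\<forall>a\<in>D. \<forall>b\<in>D. a - b \<in> rstab Y"
            and per: "\<And>K. add_subgroup K \<Longrightarrow> K \<subseteq> A \<Longrightarrow> K \<subseteq> rstab Y \<Longrightarrow> \<forall>x\<in>K. g0 + x - g0 \<in> K
              \<Longrightarrow> \<forall>a\<in>D. a - g0 \<in> K \<Longrightarrow> False" for Y p
        proof -
          have finY: "finite Y" using Y(1) fin_coset finite_subset by blast
          have YA: "Y \<subseteq> A" using Y(1) coset_A by blast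
          from finA A YA Y(2) DA g0 Y(3) show False
          proof (cases rule: stuck_cases)
            case (periodic K)
            then show ?thesis by (rule per)
          next
            case m: (moving t J1 J2 a b)
            show ?thesis by (rule moving[OF near finY m])
          qed
        qed
        have contra: False if "B \<subseteq> Y" "Y \<subseteq> coset s" "Y \<noteq> coset s" "add_subgroup K" "K \<subseteq> A" "K \<subseteq> rstab Y"
          "\<forall>x\<in>K. g0 + x - g0 \<in> K" "\<forall>a\<in>D. a - g0 \<in> K" for Y K
        proof (rule stable_coset_contradiction[of K g0 Y s U])
          show "size U \<le> card Y"
            using st(5) card_mono[OF finite_subset[OF that(2) fin_coset] that(1)] by linarith
          show "\<And>a. a \<in># R - U \<Longrightarrow> a - g0 \<in> K" using that(8) by (simp add: D_def)
          show "Y \<noteq> {}" using that(1) st(3) by blast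
        qed (use that g0A st(2) in auto)
        from Bc st(3) DR nu slow show False
        proof (cases rule: slow_set_structure)
          case same
          show False
          proof (rule main[of B undefined])
            fix K assume "add_subgroup K" "K \<subseteq> A" "K \<subseteq> rstab B" "\<forall>x\<in>K. g0 + x - g0 \<in> K"
                "\<forall>a\<in>D. a - g0 \<in> K"
            then show False by (rule contra[OF subset_refl Bc nfull])
          next
            show "B = B \<or> B = insert undefined B \<or> B = B - {undefined}" by simp
          qed (rule Bc st(3) same)+
        next
          case (plus Y p a b)
          show False
          proof (cases "Y = {}")
            case True
            \<comment> \<open>A single point is isolated over the empty set, of which all of
              \<open>A\<close> is a period. This is how the process starts.\<close>
            have "isolated_point B D"
              unfolding isolated_point_def
              using nu A g0A plus(4) True DA add_subgroupD(2,4)[OF A]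
              by (intro conjI exI[of _ A] exI[of _ g0] exI[of _ p] exI[of _
                  "{}"]) (auto simp: rstab_def rtrans_def)
            then show False using isolated[OF _ plus(5-8)] st(7) by (simp add: D_def)
          next
            case False
            show False
            proof (rule main[of Y p])
              fix K assume K: "add_subgroup K" "K \<subseteq> A" "K \<subseteq> rstab Y" "\<forall>x\<in>K. g0 + x - g0 \<in> K"
                  "\<forall>a\<in>D. a - g0 \<in> K"
              have "isolated_point B D"
                unfolding isolated_point_def using nu K plus(3,4) by blast
              then show False using isolated[OF _ plus(5-8)] st(7) by (simp add: D_def)
            next
              show "B = Y \<or> B = insert p Y \<or> B = Y - {p}" using plus(4) by simp
            qed (rule plus(1,2) False)+
          qed
        next
          case (minus Y p a b)
          show False
          proof (cases "Y = coset s")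
            case True
            \<comment> \<open>Only one point of the coset is missing, and a pair with growth 1
              completes it.\<close>
            have cB: "card B + 1 = card H"
              using minus(3,4) True card_coset[of s] fin_coset[of s] cardH by simp
            have sub: "{#a, b#} \<subseteq># R - U" using pair_subset_mset minus(5-7) by (simp add: D_def)
            define B2 where "B2 = rtrans (rtrans B (sum_list [])) a \<union> rtrans (rtrans B (sum_list [])) b"
            have r2: "reach (U + mset [] + {#a, b#}) (s + length ([]::'g list) + 1) B2"
              unfolding B2_def by (rule reach_step[OF st(1)])
            have U2: "U + mset [] + {#a, b#} \<subseteq># R"
              using subset_mset.add_mono[OF subset_mset.order_refl[of U] sub] st(2) by simp
            have "card B2 = card H"
              using card_step[OF finB, of "sum_list []" a b] minus(8) cB by (simp add: B2_def)
            then have "B2 = coset (s + length ([]::'g list) + 1)"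
              using reach_coset[OF r2 U2] card_coset fin_coset by (intro card_subset_eq) auto
            from full_contradiction[OF r2 U2 this] show False using st(4,6) cB Hn by simp
          next
            case False
            show False
            proof (rule main[of Y p])
              have "B \<subseteq> Y" using minus(4) by blast
              fix K assume "add_subgroup K" "K \<subseteq> A" "K \<subseteq> rstab Y" "\<forall>x\<in>K. g0 + x - g0 \<in> K"
                  "\<forall>a\<in>D. a - g0 \<in> K"
              then show False by (rule contra[OF \<open>B \<subseteq> Y\<close> minus(2) False])
            next
              show "B = Y \<or> B = insert p Y \<or> B = Y - {p}" using minus(4) by simp
              show "Y \<noteq> {}" using minus(3) by blast
            qed (rule minus(1,2))+
          qed
        qed
      qed
    qed
  qed
qed

text \<open>The credit required at the single point 0 is present: no term has been spent and
  \<open>|B| = 1\<close>.\<close>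

lemma contradiction: False
proof (rule invariant_contradiction[of "{#}" 0 "{0}"])
  show "reach {#} 0 {0}" by (simp add: reach_def)
qed auto

end

text \<open>Olson's theorem is the case \<open>H = A\<close>, \<open>g = 0\<close>,
  \<open>n = |A|\<close>; the induction needs the subgroup and the coset to vary.\<close>

theorem has_zero_sum_coset:
  fixes A :: "'g::group_add set"
  assumes "finite A" "add_subgroup A" "\<And>a. a \<in> A \<Longrightarrow> mul a n = 0" "card A \<le> n"
    and "add_subgroup H" "H \<subseteq> A" "g \<in> A" "\<And>x. x \<in> H \<Longrightarrow> g + x - g \<in> H"
    and "\<And>a. a \<in># R \<Longrightarrow> a - g \<in> H" "n + card H \<le> size R + 1"
  shows "has_zero_sum n R"
  using assms(5-)
proof (induction "card H" arbitrary: H g R rule: less_induct)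
  case less
  show ?case
  proof (rule ccontr)
    assume "\<not> ?thesis"
    then interpret olson_setting A n H g R
      using assms(1-4) less.prems less.hyps card_mono[OF assms(1) less.prems(2)]
      by unfold_locales auto
    show False by (rule contradiction)
  qed
qed

section \<open>Reiher's theorem\<close>

text \<open>A polynomial in the indicator vector of \<open>T\<close>, kept in factored form; its
  degree is at most the number of factors.\<close>

definition affine_prod :: "(int \<times> ('i \<Rightarrow> int)) list \<Rightarrow> 'i set \<Rightarrow> int" where
  "affine_prod fs T = prod_list (map (\<lambda>f. fst f + sum (snd f) T) fs)"

lemma sum_Pow_insert:
  assumes "finite J" "x \<notin> J"
  shows "sum h (Pow (insert x J)) = sum h (Pow J) + (\<Sum>T\<in>Pow J. h (insert x T))"
proof -
  have "sum h (Pow (insert x J)) = sum h (Pow J) + sum h (insert x ` Pow J)"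
    unfolding Pow_insert using assms by (intro sum.union_disjoint) auto
  moreover have "inj_on (insert x) (Pow J)" using assms(2) by (auto simp: inj_on_def)
  ultimately show ?thesis by (simp add: sum.reindex)
qed

text \<open>This replaces the Chevalley-Warning theorem: the alternating sum is an iterated
  difference in \<open>|J|\<close> directions, and each difference lowers the degree by one.\<close>

lemma alternating_sum_affine_prod:
  assumes "finite J" "length fs < card J"
  shows "(\<Sum>T\<in>Pow J. (-1) ^ card T * affine_prod fs T) = 0"
  using assms
proof (induction J arbitrary: fs rule: finite_induct)
  case (insert x J)
  define sh where "sh = map (\<lambda>f. (fst f + snd f x, snd f) :: int \<times> ('a \<Rightarrow> int))"
  have shift: "affine_prod fs (insert x T) = affine_prod (sh fs) T" if "T \<subseteq> J" for fs T
  proof -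
    have "finite T" "x \<notin> T" using that insert.hyps finite_subset by blast+
    then show ?thesis by (simp add: affine_prod_def sh_def add.assoc comp_def)
  qed
  \<comment> \<open>The difference of two products is telescoped factor by factor.
    \<open>pre\<close> holds the factors already treated, and in each term one factor is replaced by
    the constant \<open>snd f x\<close>.\<close>
  have tel: "(\<Sum>T\<in>Pow J. (-1) ^ card T * (affine_prod pre T * (affine_prod fs T - affine_prod (sh fs)
      T))) = 0"
    if "length pre + length fs \<le> card J" for pre fs
    using that
  proof (induction fs arbitrary: pre)
    case Nil
    then show ?case by (simp add: affine_prod_def sh_def)
  next
    case (Cons f fs)
    have "affine_prod pre T * (affine_prod (f # fs) T - affine_prod (sh (f # fs)) T)
        = affine_prod (pre @ [f]) T * (affine_prod fs T - affine_prod (sh fs) T)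
          - snd f x * affine_prod (pre @ sh fs) T" for T
      by (simp add: affine_prod_def sh_def algebra_simps)
    then have "(\<Sum>T\<in>Pow J. (-1) ^ card T * (affine_prod pre T * (affine_prod (f # fs) T - affine_prod
        (sh (f # fs)) T)))
      = (\<Sum>T\<in>Pow J. (-1) ^ card T * (affine_prod (pre @ [f]) T * (affine_prod fs T - affine_prod (sh
          fs) T)))
        - snd f x * (\<Sum>T\<in>Pow J. (-1) ^ card T * affine_prod (pre @ sh fs) T)"
      by (simp add: right_diff_distrib sum_subtractf sum_distrib_left mult.left_commute)
    moreover have "length (pre @ sh fs) < card J" using Cons.prems by (simp add: sh_def)
    ultimately show ?case using Cons insert.IH by simp
  qed
  have card: "(-1) ^ card (insert x T) = - ((-1) ^ card T :: int)" if "T \<in> Pow J" for T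
  proof -
    have "finite T" "x \<notin> T" using that insert.hyps finite_subset by blast+
    then show ?thesis by simp
  qed
  have "(\<Sum>T\<in>Pow (insert x J). (-1) ^ card T * affine_prod fs T)
      = (\<Sum>T\<in>Pow J. (-1) ^ card T * affine_prod fs T) + (\<Sum>T\<in>Pow J. - ((-1) ^ card T * affine_prod (sh
          fs) T))"
    unfolding sum_Pow_insert[OF insert.hyps(1,2)] using card shift by (intro arg_cong2[of _ _ _ _
        "(+)"] sum.cong) auto
  also have "\<dots> = (\<Sum>T\<in>Pow J. (-1) ^ card T * (affine_prod [] T * (affine_prod fs T - affine_prod (sh
      fs) T)))"
    by (simp add: sum_negf right_diff_distrib sum_subtractf affine_prod_def)
  also have "\<dots> = 0" using insert.prems insert.hyps by (intro tel) simp
  finally show ?case .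
qed simp

section \<open>Index sets with vanishing sums modulo a prime\<close>

context
  fixes p :: nat and a b :: "'i \<Rightarrow> int"
  assumes p: "Factorial_Ring.prime p"
begin

text \<open>Zero sum in \<open>C_p \<times> C_p\<close>. Index sets are used instead of multisets so
  that repeated elements are counted separately.\<close>

definition null_set :: "'i set \<Rightarrow> bool" where
  "null_set T \<longleftrightarrow> int p dvd sum a T \<and> int p dvd sum b T"

definition blocks :: "nat \<Rightarrow> 'i set \<Rightarrow> 'i set set" where
  "blocks k J = {T. T \<subseteq> J \<and> card T = k \<and> null_set T}"

definition N :: "nat \<Rightarrow> 'i set \<Rightarrow> int" where
  "N k J = int (card (blocks k J))"

definition indicator_forms :: "int \<Rightarrow> ('i \<Rightarrow> int) \<Rightarrow> (int \<times> ('i \<Rightarrow> int)) list" where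
  "indicator_forms c w = map (\<lambda>j. (c + int j, w)) [1..<p]"

text \<open>Modulo \<open>p\<close>, the product \<open>(t + 1) \<dots> (t + p - 1)\<close> is a unit if \<open>p\<close> divides \<open>t\<close>, and zero otherwise.\<close>

lemma indicator_forms:
  "[affine_prod (indicator_forms c w) T = (if int p dvd c + sum w T then fact (p - 1) else 0)] (mod
      int p)"
proof -
  define t where "t = c + sum w T"
  have p1: "p > 1" using p prime_gt_1_nat by blast
  have eq: "affine_prod (indicator_forms c w) T = (\<Prod>j = 1..<p. t + int j)"
    unfolding affine_prod_def indicator_forms_def t_def
    by (simp add: comp_def prod.distinct_set_conv_list[symmetric] add_ac)
  show ?thesis
  proof (cases "int p dvd t")
    case True
    have "[(\<Prod>j = 1..<p. t + int j) = (\<Prod>j = 1..<p. int j)] (mod int p)"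
      using True by (intro cong_prod) (simp add: cong_iff_dvd_diff)
    moreover have "(\<Prod>j = 1..<p. int j) = fact (p - 1)"
    proof -
      have "{1..<p} = {1..p - 1}" using p1 by auto
      then show ?thesis by (simp add: fact_prod)
    qed
    ultimately show ?thesis using True by (simp add: eq t_def)
  next
    case False
    define j where "j = nat (- t mod int p)"
    have j: "int j = - t mod int p" using p1 by (simp add: j_def)
    have "j < p" using p1 j by (metis of_nat_less_iff pos_mod_bound of_nat_0_less_iff less_trans
        zero_less_one)
    moreover have "j \<noteq> 0"
    proof
      assume "j = 0"
      then have "int p dvd - t" using j by (simp add: dvd_eq_mod_eq_0)
      then show False using False by simp
    qed
    moreover have "int p dvd t + int j" unfolding j by (simp add: dvd_eq_mod_eq_0 mod_simps)
    ultimately have "int p dvd (\<Prod>j = 1..<p. t + int j)"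
      by (intro dvd_prod_eqI[of _ j, THEN dvd_trans[rotated]]) auto
    then show ?thesis using False by (simp add: eq t_def cong_0_iff)
  qed
qed

lemma finite_blocks: "finite J \<Longrightarrow> finite (blocks k J)"
  unfolding blocks_def by (rule finite_subset[of _ "Pow J"]) auto

lemma N_eq_0_iff: "finite J \<Longrightarrow> N k J = 0 \<longleftrightarrow> blocks k J = {}"
  using finite_blocks by (simp add: N_def)

lemma N_mono:
  assumes "finite J" "I \<subseteq> J" "N k J = 0"
  shows "N k I = 0"
proof -
  have "blocks k I \<subseteq> blocks k J" using assms(2) by (auto simp: blocks_def)
  then show ?thesis using N_eq_0_iff[OF assms(1), of k] assms(3) by (auto simp: N_def)
qed

lemma N_large:
  assumes "finite J" "card J < k"
  shows "N k J = 0"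
proof -
  have "card T \<noteq> k" if "T \<subseteq> J" for T using card_mono[OF assms(1) that] assms(2) by simp
  then have "blocks k J = {}" unfolding blocks_def by blast
  then show ?thesis by (simp add: N_def)
qed

lemma N_0 [simp]: "finite J \<Longrightarrow> N 0 J = 1"
proof -
  assume "finite J"
  then have "blocks 0 J = {{}}" unfolding blocks_def null_set_def by (auto dest: finite_subset)
  then show ?thesis by (simp add: N_def)
qed

lemma fact_not_dvd: "k < p \<Longrightarrow> \<not> int p dvd fact k"
proof -
  assume "k < p"
  then have "\<not> p dvd fact k" using p by (simp add: prime_dvd_fact_iff)
  then show ?thesis by (metis of_nat_fact int_dvd_int_iff)
qed

text \<open>The two indicator products have total degree \<open>2 (p - 1)\<close> and restrict the
  alternating sum to null sets, up to a unit. \<open>M\<close> is cancelled over the integers,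
  before reduction modulo \<open>p\<close>; so it may be divisible by \<open>p\<close>, as
  \<open>fact p\<close> is in the case of a binomial weight.\<close>

lemma signed_count_poly:
  assumes J: "finite J" "2 * (p - 1) + length fs < card J"
    and Q: "\<And>T. T \<subseteq> J \<Longrightarrow> affine_prod fs T = M * Q (card T)" "M \<noteq> 0"
  shows "int p dvd (\<Sum>k\<le>card J. (-1) ^ k * Q k * N k J)"
proof -
  define gs where "gs = indicator_forms 0 a @ indicator_forms 0 b"
  define w where "w = (fact (p - 1) :: int) ^ 2"
  have len: "length (gs @ fs) < card J" using J(2) by (simp add: gs_def indicator_forms_def)
  have gs: "[affine_prod gs T = (if null_set T then w else 0)] (mod int p)" for T
  proof -
    have "affine_prod gs T = affine_prod (indicator_forms 0 a) T * affine_prod (indicator_forms 0 b) T"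
      by (simp add: gs_def affine_prod_def)
    also have "[\<dots> = (if int p dvd 0 + sum a T then fact (p - 1) else 0) * (if int p dvd 0 + sum b T
        then fact (p - 1) else 0)]
        (mod int p)"
      by (intro cong_mult indicator_forms)
    finally show ?thesis by (simp add: null_set_def w_def power2_eq_square split: if_splits)
  qed
  have "affine_prod (gs @ fs) T = M * (affine_prod gs T * Q (card T))" if "T \<in> Pow J" for T
    using Q(1)[of T] that by (simp add: affine_prod_def)
  then have "(\<Sum>T\<in>Pow J. (-1) ^ card T * affine_prod (gs @ fs) T)
      = M * (\<Sum>T\<in>Pow J. (-1) ^ card T * (affine_prod gs T * Q (card T)))"
    unfolding sum_distrib_left by (intro sum.cong) auto
  then have 0: "(\<Sum>T\<in>Pow J. (-1) ^ card T * (affine_prod gs T * Q (card T))) = 0"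
    using alternating_sum_affine_prod[OF J(1) len] Q(2) by simp
  have "[(\<Sum>T\<in>Pow J. (-1) ^ card T * (affine_prod gs T * Q (card T)))
      = (\<Sum>T\<in>Pow J. (-1) ^ card T * ((if null_set T then w else 0) * Q (card T)))] (mod int p)"
    by (intro cong_sum cong_mult cong_refl gs)
  then have "[(\<Sum>T\<in>Pow J. (-1) ^ card T * ((if null_set T then w else 0) * Q (card T))) = 0] (mod int p)"
    unfolding 0 by (rule cong_sym)
  then have "int p dvd (\<Sum>T\<in>Pow J. (-1) ^ card T * ((if null_set T then w else 0) * Q (card T)))"
    by (simp add: cong_0_iff)
  also have "(\<Sum>T\<in>Pow J. (-1) ^ card T * ((if null_set T then w else 0) * Q (card T)))
      = (\<Sum>k\<in>{..card J}. \<Sum>T\<in>{T \<in> Pow J. card T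
          = k}. (-1) ^ card T * ((if null_set T then w else 0) * Q (card T)))"
    using J(1) card_mono[OF J(1)] by (intro sum.group[symmetric]) auto
  also have "\<dots> = (\<Sum>k\<le>card J. w * ((-1) ^ k * Q k * N k J))"
  proof (intro sum.cong refl)
    fix k
    have "(\<Sum>T\<in>{T \<in> Pow J. card T = k}. (-1) ^ card T * ((if null_set T then w else 0) * Q (card T)))
        = (\<Sum>T\<in>{T \<in> Pow J. card T = k}. if null_set T then w * ((-1) ^ k * Q k) else 0)"
      by (intro sum.cong) auto
    also have "\<dots> = (\<Sum>T\<in>blocks k J. w * ((-1) ^ k * Q k))"
      using J(1) by (subst sum.inter_filter[symmetric]) (auto intro!: sum.cong simp: blocks_def)
    finally show "(\<Sum>T\<in>{T \<in> Pow J. card T = k}. (-1) ^ card T * ((if null_set T then w else 0) * Q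
        (card T)))
        = w * ((-1) ^ k * Q k * N k J)" by (simp add: N_def)
  qed
  also have "\<dots> = w * (\<Sum>k\<le>card J. (-1) ^ k * Q k * N k J)" by (simp add: sum_distrib_left)
  finally have "int p dvd w * (\<Sum>k\<le>card J. (-1) ^ k * Q k * N k J)" .
  moreover have "\<not> int p dvd w"
    using fact_not_dvd[of "p - 1"] p prime_gt_1_nat[OF p] by (simp add: w_def prime_dvd_power_iff)
  ultimately show ?thesis using p by (simp add: prime_dvd_mult_iff)
qed

text \<open>A third indicator product, for the condition that \<open>p\<close> divides
  \<open>c + |T|\<close>, selects the sizes at the cost of another \<open>p - 1\<close> in
  degree.\<close>

lemma signed_count_sizes:
  assumes J: "finite J" "3 * (p - 1) < card J"
    and K: "finite K" "\<And>k. k \<le> card J \<Longrightarrow> int p dvd c + int k \<longleftrightarrow> k \<in> K"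
  shows "int p dvd (\<Sum>k\<in>K. (-1) ^ k * N k J)"
proof -
  define Q where "Q k = (\<Prod>j = 1..<p. c + int j + int k)" for k
  have Q: "affine_prod (indicator_forms c (\<lambda>_. 1)) T = Q (card T)" for T
    unfolding affine_prod_def indicator_forms_def Q_def
    by (simp add: comp_def prod.distinct_set_conv_list[symmetric])
  have "int p dvd (\<Sum>k\<le>card J. (-1) ^ k * Q k * N k J)"
    by (rule signed_count_poly[where fs = "indicator_forms c (\<lambda>_. 1)" and M = 1])
      (use J Q in \<open>auto simp: indicator_forms_def\<close>)
  moreover have "[(\<Sum>k\<le>card J. (-1) ^ k * Q k * N k J)
      = (\<Sum>k\<le>card J. (-1) ^ k * (if k \<in> K then fact (p - 1) else 0) * N k J)] (mod int p)"
  proof (intro cong_sum cong_mult cong_refl)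
    fix k assume "k \<in> {..card J}"
    then have k: "k \<le> card J" by simp
    then obtain T where T: "T \<subseteq> J" "card T = k" using obtain_subset_with_card_n by metis
    show "[Q k = (if k \<in> K then fact (p - 1) else 0)] (mod int p)"
      using indicator_forms[of c "\<lambda>_. 1" T] T K(2)[OF k] by (simp add: Q)
  qed
  ultimately have "int p dvd (\<Sum>k\<le>card J. (-1) ^ k * (if k \<in> K then fact (p - 1) else 0) * N k J)"
    using cong_dvd_iff by blast
  also have "(\<Sum>k\<le>card J. (-1) ^ k * (if k \<in> K then fact (p - 1) else 0) * N k J)
      = (\<Sum>k\<in>K \<inter> {..card J}. fact (p - 1) * ((-1) ^ k * N k J))"
    by (rule sum.mono_neutral_cong_right) auto
  also have "\<dots> = (\<Sum>k\<in>K. fact (p - 1) * ((-1) ^ k * N k J))"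
    using K(1) J(1) N_large by (intro sum.mono_neutral_left) auto
  also have "\<dots> = fact (p - 1) * (\<Sum>k\<in>K. (-1) ^ k * N k J)" by (simp add: sum_distrib_left)
  finally show ?thesis
    using fact_not_dvd[of "p - 1"] p prime_gt_1_nat[OF p] by (simp add: prime_dvd_mult_iff)
qed

lemma p_ge2: "p \<ge> 2" using p prime_ge_2_nat by blast

lemma dvd_sizes: "int p dvd int k \<Longrightarrow> k < 3 * p \<Longrightarrow> k = 0 \<or> k = p \<or> k = 2 * p"
proof -
  assume "int p dvd int k" "k < 3 * p"
  then obtain q where q: "k = p * q" by (auto simp: int_dvd_int_iff elim: dvdE)
  then have "q < 3" using \<open>k < 3 * p\<close> by simp
  then show ?thesis using q by (auto simp: less_Suc_eq numeral_3_eq_3)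
qed

lemma count_3p:
  assumes J: "finite J" "3 * p - 2 \<le> card J" "card J < 3 * p"
  shows "int p dvd 1 + (-1) ^ p * N p J + N (2 * p) J"
proof -
  have "int p dvd (\<Sum>k\<in>{0, p, 2 * p}. (-1) ^ k * N k J)"
  proof (rule signed_count_sizes[where c = 0])
    show "3 * (p - 1) < card J" using J p_ge2 by linarith
    fix k assume "k \<le> card J"
    then show "int p dvd 0 + int k \<longleftrightarrow> k \<in> {0, p, 2 * p}" using J(3) dvd_sizes[of k] by auto
  qed (use J in auto)
  then show ?thesis using J(1) p_ge2 by (simp add: add.assoc)
qed

text \<open>If both sizes were absent, only the empty set would remain in the signed count, and its
  contribution 1 is not divisible by \<open>p\<close>.\<close>

lemma short_blocks:
  assumes J: "finite J" "3 * p - 2 \<le> card J"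
  shows "\<exists>T\<subseteq>J. null_set T \<and> (card T = p \<or> card T = 2 * p)"
proof -
  obtain I where I: "I \<subseteq> J" "card I = 3 * p - 2" using obtain_subset_with_card_n[OF J(2)] by metis
  have finI: "finite I" using I(1) J(1) finite_subset by blast
  have "\<not> (N p I = 0 \<and> N (2 * p) I = 0)"
  proof
    assume "N p I = 0 \<and> N (2 * p) I = 0"
    then have "int p dvd 1" using count_3p[OF finI] I(2) p_ge2 by simp
    then show False using p_ge2 by simp
  qed
  then obtain T where "T \<in> blocks p I \<or> T \<in> blocks (2 * p) I" using N_eq_0_iff[OF finI] by blast
  then show ?thesis using I(1) unfolding blocks_def by blast
qed

text \<open>A case of Lucas' theorem: modulo \<open>p\<close> only the two outer terms of
  Vandermonde's identity survive.\<close>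

lemma choose_cong: "r < p \<Longrightarrow> [(q * p + r) choose p = q] (mod p)"
proof (induction q)
  case (Suc q)
  define t where "t i = (p choose i) * ((q * p + r) choose (p - i))" for i
  have "(Suc q * p + r) choose p = sum t {..p}"
    using vandermonde[of p "q * p + r" p] by (simp add: add.assoc t_def)
  also have "{..p} = {0, p} \<union> {0<..<p}" by auto
  also have "sum t \<dots> = sum t {0, p} + sum t {0<..<p}" by (intro sum.union_disjoint) auto
  also have "sum t {0, p} = ((q * p + r) choose p) + 1" using p_ge2 by (simp add: t_def)
  finally have e: "(Suc q * p + r) choose p = ((q * p + r) choose p) + 1 + sum t {0<..<p}" .
  have "p dvd sum t {0<..<p}"
    using p by (intro dvd_sum) (auto simp: t_def intro!: dvd_mult2 dvd_choose_prime)
  then have "[((q * p + r) choose p) + 1 + sum t {0<..<p} = q + 1 + 0] (mod p)"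
    using Suc by (intro cong_add cong_refl) (auto simp: cong_0_iff)
  then show ?case unfolding e by simp
qed (simp add: binomial_eq_0)

section \<open>A set of 4p - 3 indices without a null subset of size p\<close>

context
  fixes J :: "'i set"
  assumes J: "finite J" "card J = 4 * p - 3" and p_odd: "p \<ge> 3" "odd p" and no_block: "N p J = 0"
begin

lemma finite_sub: "I \<subseteq> J \<Longrightarrow> finite I" using J finite_subset by blast

lemma N_2p: "I \<subseteq> J \<Longrightarrow> 3 * p - 2 \<le> card I \<Longrightarrow> card I < 3 * p \<Longrightarrow> [N (2 * p) I = -1] (mod int p)"
  using count_3p[of I] N_mono[OF J(1) _ no_block, of I] finite_sub[of I]
  by (simp add: cong_iff_dvd_diff add.commute)

text \<open>A null set of size \<open>3 p\<close> would contain one of size \<open>2 p\<close>,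
  already among \<open>3 p - 2\<close> of its elements, and the complement would be one of size
  \<open>p\<close>.\<close>

lemma N_3p: "N (3 * p) J = 0"
proof (rule ccontr)
  assume "N (3 * p) J \<noteq> 0"
  then obtain D where D: "D \<subseteq> J" "card D = 3 * p" "null_set D" using N_eq_0_iff[OF J(1)]
      by (auto simp: blocks_def)
  obtain I where I: "I \<subseteq> D" "card I = 3 * p - 2" using obtain_subset_with_card_n[of
      "3 * p - 2" D] D(2) by (metis diff_le_self)
  have IJ: "I \<subseteq> J" using I D by blast
  have "[N (2 * p) I = -1] (mod int p)" using N_2p[OF IJ] I(2) p_ge2 by simp
  then have "N (2 * p) I \<noteq> 0" using p_ge2 by (auto simp: cong_iff_dvd_diff)
  then obtain C where C: "C \<subseteq> I" "card C = 2 * p" "null_set C"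
    using N_eq_0_iff[OF finite_sub[OF IJ]] by (auto simp: blocks_def)
  have fD: "finite D" "C \<subseteq> D" using C I finite_sub D by auto
  have "card (D - C) = p" using C(2) D(2) fD by (simp add: card_Diff_subset finite_subset)
  moreover have "null_set (D - C)" using C(3) D(3) fD unfolding null_set_def by (simp add: sum_diff)
  ultimately have "D - C \<in> blocks p J" using D(1) by (auto simp: blocks_def)
  then show False using no_block N_eq_0_iff[OF J(1)] by blast
qed

text \<open>Double counting of the ways to split a null set of size \<open>3 p - 1\<close> into null
  sets of sizes \<open>p - 1\<close> and \<open>2 p\<close>. Whether the smaller part or the union
  is fixed, the number of choices for the part of size \<open>2 p\<close> is -1 modulo
  \<open>p\<close>.\<close>

lemma N_p1: "[N (p - 1) J = N (3 * p - 1) J] (mod int p)"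
proof -
  define S where "S = (SIGMA A:blocks (p - 1) J. blocks (2 * p) (J - A))"
  define S' where "S' = (SIGMA D:blocks (3 * p - 1) J. blocks (2 * p) D)"
  have "bij_betw (\<lambda>(A, C). (A \<union> C, C)) S S'"
  proof (rule bij_betwI[where g = "\<lambda>(D, C). (D - C, C)"])
    show "(\<lambda>(A, C). (A \<union> C, C)) \<in> S \<rightarrow> S'"
    proof (rule Pi_I)
      fix x assume "x \<in> S"
      then obtain A C where x: "x = (A, C)" and AC: "A \<in> blocks (p - 1) J" "C \<in> blocks (2 * p) (J - A)"
        unfolding S_def by blast
      then have "finite A" "finite C" "A \<inter> C = {}" "A \<subseteq> J" "C \<subseteq> J"
        using finite_sub[of A] finite_sub[of C] by (auto simp: blocks_def)
      then have "A \<union> C \<in> blocks (3 * p - 1) J" "C \<in> blocks (2 * p) (A \<union> C)"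
        using AC p_ge2 by (auto simp: blocks_def null_set_def card_Un_disjoint sum.union_disjoint)
      then show "(case x of (A, C) \<Rightarrow> (A \<union> C, C)) \<in> S'" by (simp add: x S'_def)
    qed
    show "(\<lambda>(D, C). (D - C, C)) \<in> S' \<rightarrow> S"
    proof (rule Pi_I)
      fix x assume "x \<in> S'"
      then obtain D C where x: "x = (D, C)" and DC: "D \<in> blocks (3 * p - 1) J" "C \<in> blocks (2 * p) D"
        unfolding S'_def by blast
      then have "finite D" "finite C" "C \<subseteq> D" "D \<subseteq> J"
        using finite_sub[of D] finite_sub[of C] by (auto simp: blocks_def)
      then have "D - C \<in> blocks (p - 1) J" "C \<in> blocks (2 * p) (J - (D - C))"
        using DC p_ge2 by (auto simp: blocks_def null_set_def card_Diff_subset sum_diff)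
      then show "(case x of (D, C) \<Rightarrow> (D - C, C)) \<in> S" by (simp add: x S_def)
    qed
    show "(\<lambda>(D, C). (D - C, C)) ((\<lambda>(A, C). (A \<union> C, C)) x) = x" if "x \<in> S" for x
      using that by (auto simp: S_def blocks_def)
    show "(\<lambda>(A, C). (A \<union> C, C)) ((\<lambda>(D, C). (D - C, C)) y) = y" if "y \<in> S'" for y
      using that by (auto simp: S'_def blocks_def)
  qed
  then have "card S = card S'" by (rule bij_betw_same_card)
  moreover have "int (card S) = (\<Sum>A\<in>blocks (p - 1) J. N (2 * p) (J - A))"
    unfolding S_def N_def using finite_blocks J(1) by (subst card_SigmaI) auto
  moreover have "int (card S') = (\<Sum>D\<in>blocks (3 * p - 1) J. N (2 * p) D)"
    unfolding S'_def N_def using finite_blocks J(1) finite_sub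
        by (subst card_SigmaI) (auto simp: blocks_def)
  ultimately have eq: "(\<Sum>A\<in>blocks (p - 1) J. N (2 * p) (J - A)) = (\<Sum>D\<in>blocks (3 * p - 1) J. N (2 * p) D)"
    by simp
  have "[(\<Sum>A\<in>blocks (p - 1) J. N (2 * p) (J - A)) = (\<Sum>A\<in>blocks (p - 1) J. -1)] (mod int p)"
  proof (rule cong_sum)
    fix A assume "A \<in> blocks (p - 1) J"
    then have "card (J - A) = 3 * p - 2"
      using finite_sub[of A] J p_ge2 by (auto simp: blocks_def card_Diff_subset)
    then show "[N (2 * p) (J - A) = -1] (mod int p)" using p_ge2 by (intro N_2p) auto
  qed
  then have 1: "[(\<Sum>A\<in>blocks (p - 1) J. N (2 * p) (J - A)) = - N (p - 1) J] (mod int p)"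
      by (simp add: N_def)
  have "[(\<Sum>D\<in>blocks (3 * p - 1) J. N (2 * p) D) = (\<Sum>D\<in>blocks (3 * p - 1) J. -1)] (mod int p)"
  proof (rule cong_sum)
    fix D assume "D \<in> blocks (3 * p - 1) J"
    then show "[N (2 * p) D = -1] (mod int p)" using p_ge2 by (intro N_2p) (auto simp: blocks_def)
  qed
  then have 2: "[(\<Sum>D\<in>blocks (3 * p - 1) J. N (2 * p) D) = - N (3 * p - 1) J] (mod int p)"
      by (simp add: N_def)
  from cong_trans[OF cong_sym[OF 1] 2[folded eq]] show ?thesis
    using cong_minus_minus_iff by blast
qed

lemma dvd_count_2p: "int p dvd 1 + N (2 * p) J"
proof -
  have "int p dvd (\<Sum>k\<in>{0, p, 2 * p, 3 * p}. (-1) ^ k * N k J)"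
  proof (rule signed_count_sizes[where c = 0])
    fix k assume "k \<le> card J"
    then have "k < 4 * p" using J p_ge2 by simp
    then show "int p dvd 0 + int k \<longleftrightarrow> k \<in> {0, p, 2 * p, 3 * p}"
    proof -
      have "k \<in> {0, p, 2 * p, 3 * p}" if d: "int p dvd int k"
      proof -
        from d obtain q where q: "k = p * q" by (auto simp: int_dvd_int_iff elim: dvdE)
        then have "q < 4" using \<open>k < 4 * p\<close> by simp
        then have "q = 0 \<or> q = 1 \<or> q = 2 \<or> q = 3" by linarith
        then show ?thesis using q by auto
      qed
      then show ?thesis by auto
    qed
  qed (use J p_odd in auto)
  then show ?thesis using J(1) p_ge2 no_block N_3p by simp
qed

lemma dvd_count_near_multiples: "int p dvd N (p - 1) J - N (2 * p - 1) J + N (3 * p - 1) J"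
proof -
  define k1 where "k1 = p - 1"
  define k2 where "k2 = 2 * p - 1"
  define k3 where "k3 = 3 * p - 1"
  note k_defs = k1_def k2_def k3_def
  have ne: "k1 \<noteq> k2" "k1 \<noteq> k3" "k2 \<noteq> k3" unfolding k_defs using p_ge2 by linarith+
  have par: "even k1" "odd k2" "even k3" using p_odd by (auto simp: k_defs)
  have "int p dvd (\<Sum>k\<in>{k1, k2, k3}. (-1) ^ k * N k J)"
  proof (rule signed_count_sizes[where c = 1])
    fix k assume "k \<le> card J"
    then have k: "k < 4 * p - 1" using J p_odd by simp
    have "k \<in> {k1, k2, k3}" if d: "int p dvd 1 + int k"
    proof -
      have "p dvd Suc k" using d by (metis int_dvd_int_iff of_nat_Suc add.commute)
      then obtain q where q: "Suc k = p * q" by (elim dvdE)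
      then have "p * q < p * 4" using k by linarith
      then have "q < 4" by simp
      then have "q = 0 \<or> q = 1 \<or> q = 2 \<or> q = 3" by linarith
      then show ?thesis using q unfolding k_defs by auto
    qed
    moreover have "int p dvd 1 + int k" if "k \<in> {k1, k2, k3}"
      using that p_ge2 unfolding k_defs by (auto simp: of_nat_diff)
    ultimately show "int p dvd 1 + int k \<longleftrightarrow> k \<in> {k1, k2, k3}" by blast
  qed (use J p_odd in auto)
  then have "int p dvd N k1 J - N k2 J + N k3 J" using ne par by (simp add: add_diff_eq algebra_simps)
  then show ?thesis by (simp only: k_defs)
qed

text \<open>The factor \<open>q\<close>, of degree \<open>p - 2\<close>, vanishes modulo
  \<open>p\<close> except at sizes 0 and -1 modulo \<open>p\<close>. The binomial coefficient is the
  number of subsets of size \<open>3 p - 3\<close> in \<open>J\<close> that contain a given set of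
  size \<open>k\<close>, so the sum runs over all these subsets at once. The total degree
  \<open>4 p - 4\<close> is just below \<open>|J|\<close>.\<close>

lemma dvd_count_weighted: "int p dvd 3 - 2 * N (p - 1) J + N (2 * p - 1) J + N (2 * p) J"
proof -
  define q where "q k = (\<Prod>j = 1..<p - 1. int k - int j)" for k
  define Q where "Q k = q k * int ((4 * p - 3 - k) choose p)" for k
  define fs where "fs = map (\<lambda>j. (- int j, \<lambda>_::'i. 1::int)) [1..<p - 1]
    @ map (\<lambda>j. (int (4 * p - 3) - int j, \<lambda>_::'i. -1)) [0..<p]"
  define u where "u = (\<Prod>j = 1..<p - 1. - int j)"
  have lfs: "length fs = 2 * p - 2" using p_odd by (simp add: fs_def)
  have "affine_prod fs T = fact p * Q (card T)" if T: "T \<subseteq> J" for T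
  proof -
    have cT: "card T \<le> 4 * p - 3" using card_mono[OF J(1) T] J(2) by simp
    have "int (fact p * ((4 * p - 3 - card T) choose p)) = (\<Prod>i
        = 0..<p. int (4 * p - 3 - card T) - int i)"
    proof -
      have "(of_nat ((4 * p - 3 - card T) choose p) :: rat) * fact p = (\<Prod>i
          = 0..<p. of_nat (4 * p - 3 - card T) - of_nat i)"
        using gbinomial_mult_fact'[of "of_nat (4 * p - 3 - card T) :: rat" p]
            by (simp add: binomial_gbinomial)
      then have "(of_int (int (fact p * ((4 * p - 3 - card T) choose p))) :: rat)
          = of_int (\<Prod>i = 0..<p. int (4 * p - 3 - card T) - int i)"
        by (simp add: mult.commute)
      then show ?thesis by (simp only: of_int_eq_iff)
    qed
    moreover have "int (4 * p - 3 - card T) = int (4 * p - 3) - int (card T)" using cT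
        by (simp add: of_nat_diff)
    ultimately show ?thesis
      unfolding affine_prod_def fs_def Q_def q_def
      by (simp add: comp_def prod.distinct_set_conv_list[symmetric] algebra_simps)
  qed
  then have dvd: "int p dvd (\<Sum>k\<le>card J. (-1) ^ k * Q k * N k J)"
    by (intro signed_count_poly[where fs = fs and M = "fact p"]) (use J lfs p_odd in auto)
  define k1 where "k1 = p - 1"
  define k2 where "k2 = 2 * p - 1"
  define k3 where "k3 = 2 * p"
  note k_defs = k1_def k2_def k3_def
  have ne: "0 \<noteq> k1" "0 \<noteq> k2" "0 \<noteq> k3" "k1 \<noteq> k2" "k1 \<noteq> k3" "k2 \<noteq> k3" unfolding k_defs using p_odd
      by linarith+
  have par: "even k1" "odd k2" "even k3" using p_odd by (auto simp: k_defs)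
  have qu: "[q k = (if p dvd k then u else if p dvd Suc k then - u else 0)] (mod int p)" for k
  proof (cases "p dvd k \<or> p dvd Suc k")
    case False
    define j where "j = k mod p"
    have "j < p" "[int k = int j] (mod int p)"
      using p_ge2 by (simp_all add: j_def cong_def zmod_int)
    moreover have "j \<noteq> 0" using False by (auto simp: j_def dvd_eq_mod_eq_0)
    moreover have "j \<noteq> p - 1"
    proof
      assume "j = p - 1"
      then have "Suc k mod p = 0" using p_ge2 by (simp add: j_def mod_Suc)
      then show False using False by auto
    qed
    ultimately have "j \<in> {1..<p - 1}" "int p dvd int k - int j" by (auto simp: cong_iff_dvd_diff)
    then have "int p dvd q k" unfolding q_def by (intro dvd_trans[OF _ dvd_prodI[of _ j]]) auto
    then show ?thesis using False by (simp add: cong_0_iff)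
  next
    case True
    show ?thesis
    proof (cases "p dvd k")
      case True
      have "[q k = u] (mod int p)" unfolding q_def u_def
        using True by (intro cong_prod) (simp add: cong_iff_dvd_diff)
      then show ?thesis using True by simp
    next
      case False
      then have d: "p dvd Suc k" using True by simp
      \<comment> \<open>Compared with \<open>u\<close>, the factors are shifted by one: -1 is
        exchanged for \<open>-(p - 1)\<close>, so \<open>u\<close> becomes \<open>u (p - 1)\<close>,
        which is \<open>- u\<close> modulo \<open>p\<close>.\<close>
      have e1: "[q k = (\<Prod>j = 1..<p - 1. - int (Suc j))] (mod int p)" unfolding q_def
      proof (rule cong_prod)
        fix j
        have "int k - int j - (- int (Suc j)) = int (Suc k)" by simp
        then show "[int k - int j = - int (Suc j)] (mod int p)"
          unfolding cong_iff_dvd_diff using d by (simp only: int_dvd_int_iff)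
      qed
      have "(\<Prod>j = 1..<p - 1. - int (Suc j)) = (\<Prod>j = 2..<p. - int j)"
        using p_odd prod.shift_bounds_Suc_ivl[of "\<lambda>j. - int j" 1 "p - 1"] by (simp add: numeral_2_eq_2)
      also have "\<dots> = u * int (p - 1)"
      proof -
        have "(\<Prod>j = 1..<p. - int j) = - int 1 * (\<Prod>j = 2..<p. - int j)"
          using p_odd by (subst prod.atLeast_Suc_lessThan) (auto simp: numeral_2_eq_2)
        moreover have "(\<Prod>j = 1..<p. - int j) = u * - int (p - 1)"
          using p_odd prod.atLeastLessThan_Suc[of 1 "p - 1" "\<lambda>j. - int j"] by (simp add: u_def)
        ultimately show ?thesis by simp
      qed
      finally have e: "[q k = u * int (p - 1)] (mod int p)" using e1 by simp
      have "u * int (p - 1) - (- u) = u * int p" using p_ge2 by (simp add: of_nat_diff algebra_simps)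
      then have "[u * int (p - 1) = - u] (mod int p)" by (simp add: cong_iff_dvd_diff)
      from cong_trans[OF e this] show ?thesis using False d by simp
    qed
  qed
  have ch: "[Q k = q k * int c] (mod int p)" if "4 * p - 3 - k = c * p + r" "r < p" for k c r
    unfolding Q_def that(1) using choose_cong[OF that(2), of c]
    by (intro cong_mult cong_refl) (simp add: cong_int_iff)
  have Qu: "[Q k = (if p dvd k then u * int c else if p dvd Suc k then - u * int c else 0)] (mod int p)"
    if "4 * p - 3 - k = c * p + r" "r < p" for k c r
    using cong_trans[OF ch[OF that] cong_mult[OF qu[of k] cong_refl]] by (simp split: if_splits)
  \<comment> \<open>The quotients of \<open>4 p - 3 - k\<close> by \<open>p\<close> are 3, 2, 1, 1
    at the sizes 0, \<open>p - 1\<close>, \<open>2 p - 1\<close>, \<open>2 p\<close>; the signs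
    combine those of \<open>q\<close> and of \<open>(-1) ^ k\<close>. At \<open>3 p - 1\<close> the
    quotient is 0, and at \<open>p\<close> and \<open>3 p\<close> there are no null sets.\<close>
  define R :: "nat \<Rightarrow> int" where
    "R k = (if k = 0 then 3 else if k = k1 then - 2 else if k = k2 then 1 else if k
        = k3 then 1 else 0)" for k
  have cong: "[(-1) ^ k * Q k * N k J = u * (R k * N k J)] (mod int p)" if k: "k \<le> card J" for k
  proof -
    consider "k = 0" | "k = k1" | "k = k2" | "k = k3" | "R k = 0" "N k J = 0"
      | "R k = 0" "[Q k = 0] (mod int p)"
    proof -
      consider "p dvd k" | "\<not> p dvd k" "p dvd Suc k" | "\<not> p dvd k" "\<not> p dvd Suc k" by blast
      then have "k = 0 \<or> k = k1 \<or> k = k2 \<or> k = k3 \<or> R k = 0 \<and> N k J = 0 \<or> R k = 0 \<and> [Q k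
          = 0] (mod int p)"
      proof cases
        case 1
        then obtain q' where q': "k = p * q'" by (elim dvdE)
        have "p * q' < p * 4" using k J(2) q' p_odd by linarith
        then have "q' < 4" by simp
        then have "q' = 0 \<or> q' = 1 \<or> q' = 2 \<or> q' = 3" by linarith
        then have "k = 0 \<or> k = k3 \<or> (k = p \<or> k = 3 * p)" using q' by (auto simp: k3_def)
        moreover have "R k = 0 \<and> N k J = 0" if "k = p \<or> k = 3 * p"
        proof -
          have "k \<noteq> 0" "k \<noteq> k1" "k \<noteq> k2" "k \<noteq> k3" using that p_odd unfolding k_defs by linarith+
          then show ?thesis using that no_block N_3p by (auto simp: R_def)
        qed
        ultimately show ?thesis by blast
      next
        case 2
        then obtain q' where q': "Suc k = p * q'" by (elim dvdE)
        have "p * q' < p * 4" using k J(2) q' p_odd by linarith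
        then have "q' < 4" by simp
        then have "q' = 0 \<or> q' = 1 \<or> q' = 2 \<or> q' = 3" by linarith
        then have "k = k1 \<or> k = k2 \<or> k = 3 * p - 1" using q' by (auto simp: k_defs)
        moreover have "R k = 0 \<and> [Q k = 0] (mod int p)" if k: "k = 3 * p - 1"
        proof -
          have "k \<noteq> 0" "k \<noteq> k1" "k \<noteq> k2" "k \<noteq> k3" using k p_odd unfolding k_defs by linarith+
          moreover have "[Q k = q k * int 0] (mod int p)" using k p_odd by (intro ch[of k 0
              "p - 2"]) auto
          ultimately show ?thesis by (simp add: R_def)
        qed
        ultimately show ?thesis by blast
      next
        case 3
        have "k \<noteq> 0" using 3(1) by (metis dvd_0_right)
        moreover have "k \<noteq> k1" "k \<noteq> k2" "k \<noteq> k3" using 3 p_odd unfolding k_defs by auto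
        moreover have "[Q k = 0] (mod int p)"
          using Qu[of k "(4 * p - 3 - k) div p" "(4 * p - 3 - k) mod p"] 3 p_ge2 by simp
        ultimately show ?thesis by (simp add: R_def)
      qed
      then show ?thesis using that by blast
    qed
    then show ?thesis
    proof cases
      case 1
      have "[Q k = u * 3] (mod int p)" using Qu[of k 3 "p - 3"] 1 p_odd by simp
      then show ?thesis using 1 J(1) by (simp add: R_def)
    next
      case 2
      have "k \<noteq> 0" "\<not> p dvd k" "p dvd Suc k" using 2 p_odd by (auto simp: k1_def dest: dvd_imp_le)
      then have "[Q k = - u * 2] (mod int p)" using Qu[of k 2 "p - 2"] 2 p_odd by (simp add: k1_def)
      then have "[(-1) ^ k * Q k * N k J = (-1) ^ k * (- u * 2) * N k J] (mod int p)"
        by (intro cong_mult cong_refl)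
      then show ?thesis using 2 par ne by (simp add: R_def mult.assoc)
    next
      case 3
      have dS: "p dvd Suc k" using 3 p_odd by (simp add: k2_def)
      moreover have "\<not> p dvd k"
      proof
        assume "p dvd k"
        then have "p dvd Suc k - k" using dS by (intro dvd_diff_nat)
        then show False using p_odd by simp
      qed
      ultimately have "[Q k = - u * 1] (mod int p)" using Qu[of k 1 "p - 2"] 3 p_odd
          by (simp add: k2_def)
      then have "[(-1) ^ k * Q k * N k J = (-1) ^ k * (- u * 1) * N k J] (mod int p)"
        by (intro cong_mult cong_refl)
      then show ?thesis using 3 par ne by (simp add: R_def)
    next
      case 4
      have "[Q k = u * 1] (mod int p)" using Qu[of k 1 "p - 3"] 4 p_odd by (simp add: k3_def)
      then have "[(-1) ^ k * Q k * N k J = (-1) ^ k * (u * 1) * N k J] (mod int p)"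
        by (intro cong_mult cong_refl)
      then show ?thesis using 4 par ne by (simp add: R_def)
    next
      case 5
      then show ?thesis by simp
    next
      case 6
      have "[(-1) ^ k * Q k * N k J = (-1) ^ k * 0 * N k J] (mod int p)"
        by (intro cong_mult cong_refl 6(2))
      then show ?thesis using 6(1) by simp
    qed
  qed
  have "[(\<Sum>k\<le>card J. (-1) ^ k * Q k * N k J) = (\<Sum>k\<le>card J. u * (R k * N k J))] (mod int p)"
    by (intro cong_sum cong) simp
  then have "int p dvd (\<Sum>k\<le>card J. u * (R k * N k J))" using dvd cong_dvd_iff by blast
  also have "(\<Sum>k\<le>card J. u * (R k * N k J)) = u * (\<Sum>k\<in>{0, k1, k2, k3}. R k * N k J)"
    unfolding sum_distrib_left[symmetric]
    using J(2) p_odd by (intro arg_cong[of _ _ "(*) u"] sum.mono_neutral_right) (auto simp: R_def k_defs)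
  finally have "int p dvd u * (\<Sum>k\<in>{0, k1, k2, k3}. R k * N k J)" .
  moreover have "\<not> int p dvd u"
  proof
    assume "int p dvd u"
    then obtain j where "j \<in> {1..<p - 1}" "int p dvd - int j"
      using p by (auto simp: u_def prime_dvd_prod_iff)
    then show False by (auto dest: dvd_imp_le)
  qed
  ultimately have "int p dvd (\<Sum>k\<in>{0, k1, k2, k3}. R k * N k J)"
    using p by (simp add: prime_dvd_mult_iff)
  also have "(\<Sum>k\<in>{0, k1, k2, k3}. R k * N k J) = 3 - 2 * N k1 J + N k2 J + N k3 J"
    using ne J(1) by (simp add: R_def)
  finally show ?thesis by (simp only: k_defs)
qed

text \<open>The congruences are combined so that all unknown counts cancel; what is left says that
  \<open>p\<close> divides 2.\<close>

lemma no_block_contradiction: False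
proof -
  have "[N (p - 1) J - N (2 * p - 1) J + N (3 * p - 1) J
      = N (p - 1) J - N (2 * p - 1) J + N (p - 1) J] (mod int p)"
    by (intro cong_add cong_refl cong_sym[OF N_p1])
  then have "int p dvd N (p - 1) J - N (2 * p - 1) J + N (p - 1) J"
    using dvd_count_near_multiples cong_dvd_iff by blast
  then have "int p dvd (3 - 2 * N (p - 1) J + N (2 * p - 1) J + N (2 * p) J)
      + (N (p - 1) J - N (2 * p - 1) J + N (p - 1) J) - (1 + N (2 * p) J)"
    by (rule dvd_diff[OF dvd_add[OF dvd_count_weighted] dvd_count_2p])
  then have "int p dvd 2" by simp
  then show False using p_odd zdvd_imp_le[of "int p" 2] by simp
qed

end

theorem block_of_size_p:
  assumes J: "finite J" "4 * p - 3 \<le> card J"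
  shows "\<exists>T\<subseteq>J. null_set T \<and> card T = p"
proof (rule ccontr)
  assume none: "\<not> ?thesis"
  obtain I where I: "I \<subseteq> J" "card I = 4 * p - 3" using obtain_subset_with_card_n[OF J(2)] by metis
  have finI: "finite I" using I(1) J(1) finite_subset by blast
  have "blocks p I = {}" using none I(1) unfolding blocks_def by blast
  then have N0: "N p I = 0" by (simp add: N_def)
  show False
  proof (cases "p = 2")
    case False
    then have "p \<ge> 3" "odd p" using p_ge2 p prime_odd_nat[OF p] by auto
    then show False using no_block_contradiction[OF finI I(2) _ _ N0] by blast
  next
    case True
    \<comment> \<open>For \<open>p = 2\<close> there are five vectors and four parity
      classes.\<close>
    define h where "h i = (a i mod 2, b i mod 2)" for i
    have "h ` I \<subseteq> {0, 1} \<times> {0, 1}" by (auto simp: h_def)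
    then have "card (h ` I) \<le> card ({0, 1::int} \<times> {0, 1::int})" by (intro card_mono) auto
    then have "card (h ` I) < card I" using I(2) True by (simp add: card_insert_if)
    then obtain i j where ij: "i \<in> I" "j \<in> I" "i \<noteq> j" "h i = h j"
      using pigeonhole[of h I] by (auto simp: inj_on_def)
    have "a i mod 2 = a j mod 2" "b i mod 2 = b j mod 2" using ij(4) by (simp_all add: h_def)
    then have "even (a i + a j)" "even (b i + b j)" by presburger+
    then have "{i, j} \<in> blocks p I"
      unfolding blocks_def null_set_def using ij True by simp
    then show False using \<open>blocks p I = {}\<close> by blast
  qed
qed

end

section \<open>Sequences over groups with a metacyclic quotient\<close>

lemma add_eq_0_commute: "(x::'g::group_add) + y = 0 \<Longrightarrow> y + x = 0"
  by (metis add.inverse_inverse add_eq_0_iff left_minus)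

lemma zero_sum_union: "zero_sum S \<Longrightarrow> zero_sum T \<Longrightarrow> zero_sum (S + T)"
  unfolding zero_sum_def by (metis add_0_left mset_append sum_list_append)

definition ez_bound :: "'g::group_add set \<Rightarrow> nat \<Rightarrow> bool" where
  "ez_bound A l \<longleftrightarrow> (\<forall>S. set_mset S \<subseteq> A \<longrightarrow> l \<le> size S \<longrightarrow> has_zero_sum (card A) S)"

lemma has_zero_sum_join:
  assumes "T \<subseteq># S" "size T = k" "zero_sum T" "has_zero_sum l (S - T)"
  shows "has_zero_sum (k + l) S"
proof -
  obtain T' where T': "T' \<subseteq># S - T" "size T' = l" "zero_sum T'" using assms(4)
      unfolding has_zero_sum_def by blast
  have "T + T' \<subseteq># T + (S - T)" using T'(1) by simp
  then have "T + T' \<subseteq># S" using assms(1) by simp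
  then show ?thesis using assms(2,3) T'(2,3) zero_sum_union unfolding has_zero_sum_def
    by (intro exI[of _ "T + T'"]) auto
qed

text \<open>Zero-sum sequences of length \<open>|A|\<close> are split off one after another; the
  surplus \<open>c\<close> is needed only once.\<close>

lemma ez_bound_multiple:
  assumes "ez_bound A (card A + c)" "set_mset S \<subseteq> A" "j * card A + c \<le> size S"
  shows "has_zero_sum (j * card A) S"
  using assms(2,3)
proof (induction j arbitrary: S)
  case 0
  then show ?case by (auto simp: has_zero_sum_def zero_sum_def intro!: exI[of _ "{#}"])
next
  case (Suc j)
  then have "has_zero_sum (card A) S" using assms(1) unfolding ez_bound_def by auto
  then obtain T where T: "T \<subseteq># S" "size T = card A" "zero_sum T" unfolding has_zero_sum_def by blast
  have "has_zero_sum (j * card A) (S - T)"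
  proof (rule Suc.IH)
    show "set_mset (S - T) \<subseteq> A" using Suc.prems(1) by (meson in_diffD subset_iff)
    show "j * card A + c \<le> size (S - T)" using Suc.prems(2) T by (simp add: size_Diff_submset)
  qed
  from has_zero_sum_join[OF T this] show ?case by simp
qed

text \<open>
  One sequence term short of the bound, every element can be added to complete a zero-sum
  sequence. So the sums that use all but two terms already fill the whole group.
\<close>

lemma ez_bound_double_weight:
  assumes A: "finite A" "add_subgroup A" and ez: "ez_bound A (card A + c)"
    and R: "set_mset R \<subseteq> A" "j * card A + c \<le> size R + 1" and h: "h \<in> A" and j: "j \<ge> 2"
  shows "has_zero_sum (j * card A) R
    \<or> (\<exists>us. mset us \<subseteq># R \<and> length us + 2 = j * card A \<and> h + sum_list us = 0)"
proof -
  obtain i where i: "j = Suc i" "i \<ge> 1" using j by (cases j) auto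
  have k: "card A \<ge> 1" using A add_subgroupD(1)[OF A(2)]
      by (metis One_nat_def Suc_leI card_gt_0_iff empty_iff)
  have ik: "1 \<le> i * card A" using i(2) k by simp
  have "has_zero_sum (card A) R"
  proof -
    have "card A + i * card A + c \<le> size R + 1" using R(2) by (simp add: i(1))
    then have "card A + c \<le> size R" using ik by linarith
    then show ?thesis using ez R(1) unfolding ez_bound_def by blast
  qed
  then obtain W where W: "W \<subseteq># R" "size W = card A" "zero_sum W" unfolding has_zero_sum_def by blast
  obtain ws where ws: "mset ws = W" "sum_list ws = 0" using W(3) unfolding zero_sum_def by blast
  obtain w v where wv: "ws = w # v" using ws(1) W(2) k by (cases ws) auto
  have wA: "w \<in> A" using W(1) R(1) ws(1) wv by (metis in_mono list.set_intros(1) set_mset_mono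
      set_mset_mset)
  show ?thesis
  proof (cases "has_zero_sum (i * card A) (R - W)")
    case True
    from has_zero_sum_join[OF W this] show ?thesis by (simp add: i(1))
  next
    case False
    \<comment> \<open>The companions of \<open>x\<close> in a zero-sum sequence have sum
      \<open>- h + w\<close>, and the rest \<open>v\<close> of \<open>W\<close> has sum
      \<open>- w\<close>; together they give \<open>- h\<close>. Dropping \<open>x\<close> and
      \<open>w\<close> accounts for the two missing terms.\<close>
    define x where "x = - w + h"
    have "has_zero_sum (i * card A) (add_mset x (R - W))"
    proof (rule ez_bound_multiple[OF ez])
      have "x \<in> A" unfolding x_def using wA h add_subgroupD(2,3)[OF A(2)] by blast
      then show "set_mset (add_mset x (R - W)) \<subseteq> A" using R(1) by (auto dest: in_diffD)
      show "i * card A + c \<le> size (add_mset x (R - W))"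
        using R(2) W(1,2) by (simp add: size_Diff_submset i(1))
    qed
    then obtain T where T: "T \<subseteq># add_mset x (R - W)" "size T = i * card A" "zero_sum T"
      unfolding has_zero_sum_def by blast
    have "\<not> T \<subseteq># R - W" using False T(2,3) unfolding has_zero_sum_def by blast
    then have xT: "x \<in># T" using T(1) by (metis add_mset_add_single diff_single_trivial
        subset_eq_diff_conv)
    obtain zs where zs: "mset zs = T" "sum_list zs = 0" using T(3) unfolding zero_sum_def by blast
    obtain l1 l2 where l: "zs = l1 @ x # l2" using xT zs(1) by (metis in_multiset_in_set split_list)
    \<comment> \<open>A zero sum may be rotated cyclically, so \<open>x\<close> can be brought to
      the front.\<close>
    have "x + (sum_list l2 + sum_list l1) = 0"
      using add_eq_0_commute[of "sum_list l1" "x + sum_list l2"] zs(2) l by (simp add: add.assoc)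
    then have s: "sum_list l2 + sum_list l1 = - x" by (metis minus_unique)
    have ml: "mset (l2 @ l1) \<subseteq># R - W"
      using T(1) unfolding zs(1)[symmetric] l by (simp add: add.commute)
    have "w + sum_list v = 0" using ws(2) wv by simp
    then have sv: "sum_list v = - w" by (metis minus_unique)
    define us where "us = l2 @ l1 @ v"
    have "sum_list us + h = 0"
    proof -
      have "sum_list us + h = (sum_list l2 + sum_list l1) + sum_list v + h"
          by (simp add: us_def add.assoc)
      also have "\<dots> = - x + - w + h" unfolding s sv by simp
      also have "\<dots> = 0" by (simp add: x_def minus_add add.assoc)
      finally show ?thesis .
    qed
    then have "h + sum_list us = 0" by (rule add_eq_0_commute)
    moreover have "mset us \<subseteq># R"
    proof -
      have "mset v \<subseteq># W" using ws(1) wv by auto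
      from subset_mset.add_mono[OF ml this] have "mset us \<subseteq># (R - W) + W" by (simp add: us_def add.assoc)
      then show ?thesis using W(1) by simp
    qed
    moreover have "length us + 2 = j * card A"
    proof -
      have "length zs = i * card A" using zs(1) T(2) by (metis size_mset)
      moreover have "length ws = card A" using ws(1) W(2) by (metis size_mset)
      ultimately show ?thesis using l wv by (simp add: us_def i(1))
    qed
    ultimately show ?thesis by blast
  qed
qed

section \<open>From sequences of block sums back to the blocks\<close>

lemma submultiset_map:
  assumes "mset xs \<subseteq># mset (map f Bs)"
  shows "\<exists>Cs. mset Cs \<subseteq># mset Bs \<and> map f Cs = xs"
  using assms
proof (induction xs arbitrary: Bs)
  case (Cons x xs)
  have "x \<in># mset (map f Bs)" using Cons.prems
      by (metis in_multiset_in_set list.set_intros(1) mset_subset_eqD)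
  then obtain b where b: "b \<in> set Bs" "x = f b" by auto
  then obtain B1 B2 where Bs: "Bs = B1 @ b # B2" by (metis split_list)
  have "mset xs \<subseteq># mset (map f (B1 @ B2))" using Cons.prems by (simp add: Bs b(2))
  then obtain Cs where "mset Cs \<subseteq># mset (B1 @ B2)" "map f Cs = xs" using Cons.IH by blast
  then show ?case by (intro exI[of _ "b # Cs"]) (simp add: Bs b(2))
qed simp

lemma sum_list_concat: "sum_list (concat Cs) = sum_list (map sum_list Cs)"
  by (induction Cs) simp_all

lemma mset_concat_mono: "mset Cs \<subseteq># mset Bs \<Longrightarrow> mset (concat Cs) \<subseteq># mset (concat Bs)"
proof -
  assume "mset Cs \<subseteq># mset Bs"
  then obtain M where "mset Bs = mset Cs + M" by (metis subset_mset.le_iff_add)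
  then have "image_mset mset (mset Bs) = image_mset mset (mset Cs) + image_mset mset M" by simp
  moreover have "mset (concat Ds) = sum_mset (image_mset mset (mset Ds))" for Ds :: "'a list list"
    by (induction Ds) simp_all
  ultimately show ?thesis by simp
qed

lemma length_concat_const: "(\<And>b. b \<in> set Cs \<Longrightarrow> length b = p) \<Longrightarrow> length (concat Cs) = p * length Cs"
  by (induction Cs) auto

lemma has_zero_sum_blocks:
  assumes "mset (concat Bs) \<subseteq># S" "\<And>b. b \<in> set Bs \<Longrightarrow> length b = p"
    and "has_zero_sum l (mset (map sum_list Bs))"
  shows "has_zero_sum (p * l) S"
proof -
  obtain xs where xs: "mset xs \<subseteq># mset (map sum_list Bs)" "length xs = l" "sum_list xs = 0"
    using assms(3) unfolding has_zero_sum_def zero_sum_def by (metis size_mset)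
  obtain Cs where Cs: "mset Cs \<subseteq># mset Bs" "map sum_list Cs = xs" using submultiset_map[OF xs(1)]
      by blast
  have len: "length (concat Cs) = p * l"
  proof -
    have "length b = p" if "b \<in> set Cs" for b using assms(2) Cs(1) that
        by (metis mset_subset_eqD in_multiset_in_set)
    then show ?thesis using length_concat_const[of Cs p] Cs(2) xs(2) by (metis length_map)
  qed
  have "mset (concat Cs) \<subseteq># S" using mset_concat_mono[OF Cs(1)] assms(1)
      by (rule subset_mset.order_trans)
  moreover have "sum_list (concat Cs) = 0" using Cs(2) xs(3) by (simp add: sum_list_concat)
  ultimately show ?thesis unfolding has_zero_sum_def zero_sum_def using len by (metis size_mset)
qed

text \<open>The block of \<open>2 p\<close> terms stands for two blocks of \<open>p\<close>, so the
  total length is again a multiple \<open>p l\<close>.\<close>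

lemma has_zero_sum_blocks_double:
  assumes "mset (bl @ concat Bs) \<subseteq># S" "\<And>b. b \<in> set Bs \<Longrightarrow> length b = p" "length bl = 2 * p"
    and us: "mset us \<subseteq># mset (map sum_list Bs)" "length us + 2 = l" "sum_list bl + sum_list us = 0"
  shows "has_zero_sum (p * l) S"
proof -
  obtain Cs where Cs: "mset Cs \<subseteq># mset Bs" "map sum_list Cs = us" using submultiset_map[OF us(1)]
      by blast
  have len: "length (concat Cs) = p * length us"
  proof -
    have "length b = p" if "b \<in> set Cs" for b using assms(2) Cs(1) that
        by (metis mset_subset_eqD in_multiset_in_set)
    then show ?thesis using length_concat_const[of Cs p] Cs(2) by (metis length_map)
  qed
  have "mset (bl @ concat Cs) \<subseteq># mset (bl @ concat Bs)" using mset_concat_mono[OF Cs(1)] by simp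
  then have "mset (bl @ concat Cs) \<subseteq># S" using assms(1) by (rule subset_mset.order_trans)
  moreover have "sum_list (bl @ concat Cs) = 0" using Cs(2) us(3) by (simp add: sum_list_concat)
  moreover have "length (bl @ concat Cs) = p * l" using len assms(3) us(2) by (auto simp: algebra_simps)
  ultimately show ?thesis unfolding has_zero_sum_def zero_sum_def by (metis size_mset)
qed

lemma submultiset_of_indices:
  assumes "I \<subseteq> {..<length xs}"
  defines "T \<equiv> image_mset (nth xs) (mset_set I)"
  shows "T \<subseteq># mset xs" "size T = card I" "sum_mset (image_mset f T) = (\<Sum>i\<in>I. f (xs ! i))"
proof -
  have "mset xs = image_mset (nth xs) (mset_set {..<length xs})"
    by (metis map_nth mset_map mset_upt atLeast0LessThan)
  moreover have "mset_set I \<subseteq># mset_set {..<length xs}" using assms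
      by (intro subset_imp_msubset_mset_set) auto
  ultimately show "T \<subseteq># mset xs" unfolding T_def by (simp add: image_mset_subseteq_mono)
  show "size T = card I" by (simp add: T_def)
  show "sum_mset (image_mset f T) = (\<Sum>i\<in>I. f (xs ! i))"
    by (simp add: T_def sum_unfold_sum_mset multiset.map_comp comp_def)
qed

definition null_block :: "nat \<Rightarrow> ('g \<Rightarrow> int) \<Rightarrow> ('g \<Rightarrow> int) \<Rightarrow> 'g list \<Rightarrow> bool" where
  "null_block p a b xs \<longleftrightarrow> int p dvd sum_list (map a xs) \<and> int p dvd sum_list (map b xs)"

lemma null_block_from_indices:
  assumes p: "Factorial_Ring.prime p"
    and "I \<subseteq> {..<length ys}" "null_set p (\<lambda>i. a (ys ! i)) (\<lambda>i. b (ys ! i)) I"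
  shows "\<exists>xs. mset xs \<subseteq># mset ys \<and> length xs = card I \<and> null_block p a b xs"
proof -
  define T where "T = image_mset (nth ys) (mset_set I)"
  obtain xs where xs: "mset xs = T" using ex_mset by blast
  note T = submultiset_of_indices[OF assms(2), folded T_def]
  have "sum_list (map f xs) = (\<Sum>i\<in>I. f (ys ! i))" for f :: "'a \<Rightarrow> int"
    using T(3)[of f] xs by (metis mset_map sum_mset_sum_list)
  then show ?thesis
    using xs T(1,2) assms(3) unfolding null_block_def null_set_def[OF p]
    by (intro exI[of _ xs]) (auto simp flip: size_mset)
qed

lemma null_block_of_size_p:
  assumes "Factorial_Ring.prime p" "4 * p - 3 \<le> size S"
  shows "\<exists>xs. mset xs \<subseteq># S \<and> length xs = p \<and> null_block p a b xs"
proof -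
  obtain ys where ys: "mset ys = S" using ex_mset by blast
  then have "4 * p - 3 \<le> card {..<length ys}" using assms(2) by auto
  then obtain I where "I \<subseteq> {..<length ys}" "null_set p (\<lambda>i. a (ys ! i)) (\<lambda>i. b (ys ! i)) I" "card I = p"
    using block_of_size_p[OF assms(1) finite_lessThan] by blast
  then show ?thesis using null_block_from_indices[OF assms(1), of I ys a b] ys by blast
qed

lemma null_block_of_size_p_or_2p:
  assumes "Factorial_Ring.prime p" "3 * p - 2 \<le> size S"
  shows "\<exists>xs. mset xs \<subseteq># S \<and> (length xs = p \<or> length xs = 2 * p) \<and> null_block p a b xs"
proof -
  obtain ys where ys: "mset ys = S" using ex_mset by blast
  then have "3 * p - 2 \<le> card {..<length ys}" using assms(2) by auto
  then obtain I where "I \<subseteq> {..<length ys}" "null_set p (\<lambda>i. a (ys ! i)) (\<lambda>i. b (ys ! i)) I" "card I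
      = p \<or> card I = 2 * p"
    using short_blocks[OF assms(1) finite_lessThan] by blast
  then show ?thesis using null_block_from_indices[OF assms(1), of I ys a b] ys by metis
qed

text \<open>The last extraction still wants \<open>4 p - 3\<close> terms, and \<open>p\<close> of
  them go into the block: hence the surplus \<open>3 p - 3\<close>.\<close>

lemma disjoint_null_blocks:
  assumes p: "Factorial_Ring.prime p" and "p * r + 3 * p - 3 \<le> size S"
  shows "\<exists>Bs. length Bs = r \<and> mset (concat Bs) \<subseteq># S \<and> (\<forall>xs\<in>set Bs. length xs = p \<and> null_block p a b xs)"
  using assms(2)
proof (induction r arbitrary: S)
  case (Suc r)
  then have "4 * p - 3 \<le> size S" by simp
  then obtain xs where xs: "mset xs \<subseteq># S" "length xs = p" "null_block p a b xs"
    using null_block_of_size_p[OF p] by blast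
  have "p * r + 3 * p - 3 \<le> size (S - mset xs)"
    using Suc.prems xs(1,2) by (simp add: size_Diff_submset)
  then obtain Bs where Bs: "length Bs = r" "mset (concat Bs) \<subseteq># S - mset xs"
    "\<forall>xs\<in>set Bs. length xs = p \<and> null_block p a b xs" using Suc.IH by blast
  have "mset xs + mset (concat Bs) \<subseteq># mset xs + (S - mset xs)" using Bs(2) by simp
  then have "mset (concat (xs # Bs)) \<subseteq># S" using xs(1) by simp
  then show ?case using Bs xs by (intro exI[of _ "xs # Bs"]) auto
qed auto

lemma card_subgroup_mul:
  fixes A :: "'g::group_add set"
  assumes "finite A" "add_subgroup A" "a \<in> A"
  shows "mul a (card A) = 0"
proof -
  define G :: "'g monoid" where "G = \<lparr>carrier = A, monoid.mult = (+), one = 0\<rparr>"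
  have "group G"
  proof (rule groupI)
    fix x assume "x \<in> carrier G"
    then show "\<exists>y\<in>carrier G. y \<otimes>\<^bsub>G\<^esub> x = \<one>\<^bsub>G\<^esub>"
      using add_subgroupD(3)[OF assms(2)] by (intro bexI[of _ "- x"]) (auto simp: G_def)
  qed (use add_subgroupD[OF assms(2)] in \<open>auto simp: G_def add.assoc\<close>)
  then interpret G: group G .
  have "a [^]\<^bsub>G\<^esub> n = mul a n" for n :: nat
    by (induction n) (simp_all add: G_def mul_Suc2)
  moreover have "a [^]\<^bsub>G\<^esub> order G = \<one>\<^bsub>G\<^esub>" using assms by (intro G.pow_order_eq_1) (simp add: G_def)
  ultimately show ?thesis by (simp add: G_def order_def)
qed

lemma ez_bound_general:
  assumes "finite A" "add_subgroup A"
  shows "ez_bound A (card A + (card A - 1))"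
  unfolding ez_bound_def
proof (intro allI impI)
  fix S :: "'a multiset" assume S: "set_mset S \<subseteq> A" "card A + (card A - 1) \<le> size S"
  show "has_zero_sum (card A) S"
    by (rule has_zero_sum_coset[OF assms card_subgroup_mul[OF assms] order_refl assms(2), of 0])
      (use S add_subgroupD(1)[OF assms(2)] in auto)
qed

text \<open>
  The pair \<open>(a x, b x)\<close> is the image of \<open>x\<close> in \<open>C\<^sub>m \<ltimes> C\<^sub>m\<close>, and \<open>u x\<close> is the multiplier by which
  \<open>x\<close> acts on the normal factor.
\<close>

locale metacyclic_coordinates =
  fixes A :: "'g::group_add set" and m :: nat and a b u :: "'g \<Rightarrow> int"
  assumes A: "finite A" "add_subgroup A" and m: "m > 0"
    and a_add: "\<And>x y. x \<in> A \<Longrightarrow> y \<in> A \<Longrightarrow> [a (x + y) = a x + a y] (mod int m)"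
    and b_add: "\<And>x y. x \<in> A \<Longrightarrow> y \<in> A \<Longrightarrow> [b (x + y) = b x + u x * b y] (mod int m)"
    and u_add: "\<And>x y. x \<in> A \<Longrightarrow> y \<in> A \<Longrightarrow> [u (x + y) = u x * u y] (mod int m)"
    and u_eq_1: "\<And>x. x \<in> A \<Longrightarrow> [a x = 0] (mod int m) \<Longrightarrow> [u x = 1] (mod int m)"
    and surj: "\<And>i j. \<exists>x\<in>A. [a x = i] (mod int m) \<and> [b x = j] (mod int m)"
begin

context
  fixes p m' :: nat
  assumes p: "Factorial_Ring.prime p" and m_eq: "m = p * m'" and least: "\<And>q. Factorial_Ring.prime q
      \<Longrightarrow> q dvd m \<Longrightarrow> p \<le> q"
begin

lemma p_dvd: "[x = y] (mod int m) \<Longrightarrow> [x = y] (mod int p)"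
  by (rule cong_dvd_modulus) (auto simp: m_eq)

lemma mul_coordinates:
  assumes "x \<in> A"
  shows "[a (mul x (Suc j)) = int (Suc j) * a x] (mod int m) \<and> [u (mul x (Suc j))
      = u x ^ Suc j] (mod int m)"
proof (induction j)
  case 0
  then show ?case by (simp add: mul_Suc)
next
  case (Suc j)
  have mA: "mul x (Suc j) \<in> A" by (rule mul_mem[OF A(2) assms])
  have "[a x + a (mul x (Suc j)) = a x + int (Suc j) * a x] (mod int m)"
    "[u x * u (mul x (Suc j)) = u x * u x ^ Suc j] (mod int m)"
    using Suc by (auto intro!: cong_add cong_mult)
  from cong_trans[OF a_add[OF assms mA] this(1)] cong_trans[OF u_add[OF assms mA] this(2)]
  show ?case by (simp add: mul_Suc[of x "Suc j"] algebra_simps)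
qed

text \<open>
  The action is trivial modulo the least prime \<open>p\<close> of \<open>m\<close>: its order there divides \<open>m\<close>
  and \<open>p - 1\<close>, which are coprime.
\<close>

lemma u_cong_1:
  assumes x: "x \<in> A"
  shows "[u x = 1] (mod int p)"
proof -
  obtain l where l: "m = Suc l" using m by (cases m) auto
  have mA: "mul x m \<in> A" by (rule mul_mem[OF A(2) x])
  have "[a (mul x m) = int m * a x] (mod int m)" using mul_coordinates[OF x, of l] unfolding l by blast
  moreover have "[int m * a x = 0] (mod int m)" by (simp add: cong_0_iff)
  ultimately have "[u (mul x m) = 1] (mod int m)" using u_eq_1[OF mA] cong_trans by blast
  moreover have "[u (mul x m) = u x ^ m] (mod int m)" using mul_coordinates[OF x, of l] unfolding l
      by blast
  ultimately have "[u x ^ m = 1] (mod int m)" using cong_sym cong_trans by blast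
  then have um: "[u x ^ m = 1] (mod int p)" by (rule p_dvd)
  define v where "v = nat (u x mod int p)"
  have p1: "p > 1" using p prime_gt_1_nat by blast
  have v: "[int v = u x] (mod int p)" using p1 by (simp add: v_def)
  have "[int v ^ m = 1] (mod int p)" using cong_trans[OF cong_pow[OF v] um] .
  then have vm: "[v ^ m = 1] (mod p)" by (metis cong_int_iff of_nat_power of_nat_1)
  have "\<not> p dvd v"
  proof
    assume "p dvd v"
    then have "p dvd v ^ m" using m by (simp add: dvd_power_iff dvd_trans[OF _ dvd_power])
    then have "p dvd 1" using vm cong_dvd_iff by blast
    then show False using p1 by simp
  qed
  then have vp: "[v ^ (p - 1) = 1] (mod p)" using fermat_theorem[OF p] by blast
  have "coprime m (p - 1)"
  proof (rule ccontr)
    assume "\<not> coprime m (p - 1)"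
    then obtain q where q: "Factorial_Ring.prime q" "q dvd gcd m (p - 1)"
      using prime_factor_nat coprime_iff_gcd_eq_1 by metis
    then have "q dvd m" "q dvd p - 1" by auto
    then have "q \<le> p - 1" using p1 by (intro dvd_imp_le) auto
    then show False using least[OF q(1) \<open>q dvd m\<close>] p1 by linarith
  qed
  then have "gcd m (p - 1) = 1" by simp
  then obtain s t where st: "m * s = (p - 1) * t + 1" using bezout_nat[of m "p - 1"] m by auto
  have v1: "[v ^ (m * s) = 1] (mod p)" using cong_pow[OF vm, of s] by (simp add: power_mult)
  have v2: "[v ^ ((p - 1) * t + 1) = 1 * v] (mod p)"
  proof -
    have eq: "v ^ ((p - 1) * t + 1) = (v ^ (p - 1)) ^ t * v"
        by (simp only: power_add power_mult power_one_right)
    show ?thesis unfolding eq using cong_mult[OF cong_pow[OF vp, of t] cong_refl[of v]]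
        by (simp only: power_one)
  qed
  have "[v = 1] (mod p)" using cong_trans[OF cong_sym[OF v2] v1[unfolded st]] by simp
  then have "[int v = 1] (mod int p)" by (metis cong_int_iff of_nat_1)
  then show ?thesis using v cong_sym cong_trans by blast
qed

lemma a_add_p: "x \<in> A \<Longrightarrow> y \<in> A \<Longrightarrow> [a (x + y) = a x + a y] (mod int p)"
  using a_add p_dvd by blast

text \<open>The multiplier is 1 modulo \<open>p\<close>, so the second coordinate becomes additive
  too; this is the map to \<open>C_p \<times> C_p\<close>.\<close>

lemma b_add_p:
  assumes "x \<in> A" "y \<in> A"
  shows "[b (x + y) = b x + b y] (mod int p)"
proof -
  have "[b x + u x * b y = b x + 1 * b y] (mod int p)"
    using assms u_cong_1 by (intro cong_add cong_mult) auto
  then show ?thesis using cong_trans[OF p_dvd[OF b_add[OF assms]]] by simp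
qed

definition kernel where "kernel = {x \<in> A. int p dvd a x \<and> int p dvd b x}"

lemma zero_dvd: "int p dvd a 0" "int p dvd b 0"
  using a_add_p[of 0 0] b_add_p[of 0 0] add_subgroupD(1)[OF A(2)] by (auto simp: cong_iff_dvd_diff)

lemma sum_list_coordinates:
  assumes "set xs \<subseteq> A"
  shows "[a (sum_list xs) = sum_list (map a xs)] (mod int p) \<and> [b (sum_list xs)
      = sum_list (map b xs)] (mod int p)"
  using assms
proof (induction xs)
  case Nil
  then show ?case using zero_dvd by (simp add: cong_0_iff)
next
  case (Cons x xs)
  then have s: "sum_list xs \<in> A" "x \<in> A" using sum_list_mem[OF A(2)] by auto
  have "[a x + a (sum_list xs) = a x + sum_list (map a xs)] (mod int p)"
    "[b x + b (sum_list xs) = b x + sum_list (map b xs)] (mod int p)"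
    using Cons by (auto intro!: cong_add)
  then show ?case using cong_trans[OF a_add_p[OF s(2,1)]] cong_trans[OF b_add_p[OF s(2,1)]] by simp
qed

lemma null_block_sum:
  assumes "set xs \<subseteq> A" "null_block p a b xs"
  shows "sum_list xs \<in> kernel"
  using sum_list_coordinates[OF assms(1)] sum_list_mem[OF A(2) assms(1)] assms(2)
  unfolding kernel_def null_block_def by (auto simp: cong_dvd_iff)

lemma kernel: "add_subgroup kernel" "finite kernel" "kernel \<subseteq> A"
proof -
  show sub: "kernel \<subseteq> A" by (auto simp: kernel_def)
  show fin: "finite kernel" using sub A(1) finite_subset by blast
  show "add_subgroup kernel"
  proof (rule finite_add_subgroupI[OF fin])
    show "0 \<in> kernel" using zero_dvd add_subgroupD(1)[OF A(2)] by (simp add: kernel_def)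
    fix x y assume xy: "x \<in> kernel" "y \<in> kernel"
    then have xy': "x \<in> A" "y \<in> A" by (auto simp: kernel_def)
    then show "x + y \<in> kernel"
      using xy cong_dvd_iff[OF a_add_p[OF xy']] cong_dvd_iff[OF b_add_p[OF xy']] add_subgroupD(2)[OF
          A(2) xy']
      by (simp add: kernel_def)
  qed
qed

text \<open>The fibres of the reduction modulo \<open>p\<close> are cosets of the kernel, and by
  \<open>surj\<close> none of the \<open>p^2\<close> fibres is empty.\<close>

lemma card_kernel: "card A = p * p * card kernel"
proof -
  define f where "f x = (a x mod int p, b x mod int p)" for x
  define I where "I = {0..<int p} \<times> {0..<int p}"
  have p0: "int p > 0" using p prime_gt_0_nat by simp
  have fI: "f ` A \<subseteq> I" using p0 by (auto simp: f_def I_def)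
  have fib: "card {x \<in> A. f x = ij} = card kernel" if ij: "ij \<in> I" for ij
  proof -
    obtain y where y: "y \<in> A" "f y = ij"
    proof -
      obtain y where y: "y \<in> A" "[a y = fst ij] (mod int m)" "[b y = snd ij] (mod int m)" using surj
          by blast
      have "f y = ij" using p_dvd[OF y(2)] p_dvd[OF y(3)] ij by (auto simp: f_def I_def cong_def)
      then show ?thesis using y(1) that by blast
    qed
    have "{x \<in> A. f x = ij} = ltrans y kernel"
    proof (rule Set.set_eqI)
      fix x
      have iff: "f x = f y \<longleftrightarrow> z \<in> kernel" if z: "z \<in> A" "x = y + z" for z
      proof -
        have "f x = f y \<longleftrightarrow> [a (y + z) = a y] (mod int p) \<and> [b (y + z) = b y] (mod int p)"
          by (simp add: f_def z(2) cong_def)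
        also have "\<dots> \<longleftrightarrow> [a y + a z = a y + 0] (mod int p) \<and> [b y + b z = b y + 0] (mod int p)"
          using a_add_p[OF y(1) z(1)] b_add_p[OF y(1) z(1)] by (simp add: cong_def)
        also have "\<dots> \<longleftrightarrow> z \<in> kernel" using z(1)
            by (simp only: cong_add_lcancel) (simp add: cong_0_iff kernel_def)
        finally show ?thesis .
      qed
      show "x \<in> {x \<in> A. f x = ij} \<longleftrightarrow> x \<in> ltrans y kernel"
      proof
        assume "x \<in> {x \<in> A. f x = ij}"
        then have "- y + x \<in> A" "f x = f y"
          using y(2) add_subgroupD(2)[OF A(2) add_subgroupD(3)[OF A(2) y(1)]] by auto
        then show "x \<in> ltrans y kernel" using iff[of "- y + x"] by (simp add: mem_ltrans_iff)
      next
        assume "x \<in> ltrans y kernel"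
        then obtain z where z: "z \<in> kernel" "x = y + z" unfolding ltrans_def by blast
        then have "z \<in> A" using kernel(3) by blast
        then show "x \<in> {x \<in> A. f x = ij}" using iff[of z] z y add_subgroupD(2)[OF A(2) y(1)] by simp
      qed
    qed
    then show ?thesis by simp
  qed
  have "card A = (\<Sum>x\<in>A. 1)" by simp
  also have "\<dots> = (\<Sum>ij\<in>I. \<Sum>x\<in>{x \<in> A. f x = ij}. 1)"
    using A(1) fI by (intro sum.group[symmetric]) (auto simp: I_def)
  also have "\<dots> = card I * card kernel" using fib by simp
  also have "card I = p * p" by (simp add: I_def)
  finally show ?thesis .
qed

lemma cong_div:
  assumes "[x = y] (mod int m)" "x = int p * x'" "y = int p * y'"
  shows "[x' = y'] (mod int m')"
proof -
  have "int p * int m' dvd int p * (x' - y')" using assms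
      by (simp add: cong_iff_dvd_diff m_eq right_diff_distrib)
  moreover have "int p \<noteq> 0" using p prime_gt_0_nat by auto
  ultimately show ?thesis by (simp add: cong_iff_dvd_diff)
qed

text \<open>On the kernel both coordinates are multiples of \<open>p\<close>, and division by
  \<open>p\<close> turns congruences modulo \<open>m\<close> into congruences modulo
  \<open>m'\<close>. The rule for \<open>b\<close> is linear in \<open>b\<close>, so it survives
  with the same multiplier \<open>u\<close>.\<close>

lemma kernel_coordinates:
  "metacyclic_coordinates kernel m' (\<lambda>x. a x div int p) (\<lambda>x. b x div int p) u"
proof
  have p0: "int p \<noteq> 0" using p prime_gt_0_nat by auto
  have m'm: "[x = y] (mod int m) \<Longrightarrow> [x = y] (mod int m')" for x y
    by (rule cong_dvd_modulus) (auto simp: m_eq)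
  have eq: "a x = int p * (a x div int p)" "b x = int p * (b x div int p)" if "x \<in> kernel" for x
    using that by (auto simp: kernel_def)
  show "m' > 0" using m m_eq by (cases m') auto
  fix x y assume x: "x \<in> kernel" and y: "y \<in> kernel"
  have xy: "x + y \<in> kernel" using add_subgroupD(2)[OF kernel(1) x y] .
  have xA: "x \<in> A" and yA: "y \<in> A" using x y kernel(3) by auto
  show "[a (x + y) div int p = a x div int p + a y div int p] (mod int m')"
    by (rule cong_div[OF a_add[OF xA yA] eq(1)[OF xy]]) (use eq(1)[OF x] eq(1)[OF y] in \<open>simp add:
        distrib_left\<close>)
  show "[b (x + y) div int p = b x div int p + u x * (b y div int p)] (mod int m')"
  proof (rule cong_div[OF b_add[OF xA yA] eq(2)[OF xy]])
    have "b x + u x * b y = int p * (b x div int p) + u x * (int p * (b y div int p))"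
      using eq(2)[OF x] eq(2)[OF y] by presburger
    then show "b x + u x * b y = int p * (b x div int p + u x * (b y div int p))"
      by (simp add: algebra_simps)
  qed
  show "[u (x + y) = u x * u y] (mod int m')" by (rule m'm[OF u_add[OF xA yA]])
next
  have m'm: "[x = y] (mod int m) \<Longrightarrow> [x = y] (mod int m')" for x y
    by (rule cong_dvd_modulus) (auto simp: m_eq)
  fix x assume x: "x \<in> kernel" and 0: "[a x div int p = 0] (mod int m')"
  have "a x = int p * (a x div int p)" using x by (auto simp: kernel_def)
  moreover have "int p * int m' dvd int p * (a x div int p)" using 0 by (simp add: cong_0_iff)
  ultimately have "[a x = 0] (mod int m)" by (simp add: cong_0_iff m_eq)
  then show "[u x = 1] (mod int m')" using u_eq_1 x kernel(3) m'm by blast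
next
  fix i j
  obtain x where x: "x \<in> A" "[a x = int p * i] (mod int m)" "[b x = int p * j] (mod int m)"
      using surj by blast
  have "int p dvd a x" "int p dvd b x"
    using cong_dvd_iff[OF p_dvd[OF x(2)]] cong_dvd_iff[OF p_dvd[OF x(3)]] by auto
  then have "x \<in> kernel" "a x = int p * (a x div int p)" "b x = int p * (b x div int p)"
    using x(1) by (auto simp: kernel_def)
  then show "\<exists>x\<in>kernel. [a x div int p = i] (mod int m') \<and> [b x div int p = j] (mod int m')"
    using cong_div[OF x(2)] cong_div[OF x(3)] by blast
qed (rule kernel)+

text \<open>The number \<open>r\<close> of blocks is one below what the kernel bound asks for length
  \<open>p |kernel|\<close>. A last block of \<open>p\<close> terms supplies the missing sum; for
  one of \<open>2 p\<close> terms, \<open>ez_bound_double_weight\<close> works with \<open>r\<close>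
  sums only.\<close>

lemma ez_bound_lift:
  assumes kc: "card kernel = m' * m' * k" "ez_bound kernel (card kernel + (m' * k + m' - 2))"
  shows "ez_bound A (card A + (m * k + m - 2))"
  unfolding ez_bound_def
proof (intro allI impI)
  fix S assume S: "set_mset S \<subseteq> A" "card A + (m * k + m - 2) \<le> size S"
  define c where "c = m' * k + m' - 2"
  define r where "r = p * card kernel + c - 1"
  have p2: "p \<ge> 2" using p prime_ge_2_nat by blast
  have kpos: "card kernel \<ge> 1"
    using kernel(2) add_subgroupD(1)[OF kernel(1)] by (metis One_nat_def Suc_leI card_gt_0_iff empty_iff)
  have m'k: "m' \<ge> 1" "k \<ge> 1" using kpos kc(1) by (auto intro: Suc_leI gr0I)
  then have "m' * k \<ge> 1" by simp
  \<comment> \<open>\<open>c + 2\<close> is the quantity that is multiplied by \<open>p\<close>;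
    stated additively it avoids truncated subtraction.\<close>
  then have c2: "c + 2 = m' * k + m'" using m'k(1) unfolding c_def by linarith
  have r1: "r + 1 = p * card kernel + c" using kpos p2 by (simp add: r_def)
  have "p * (c + 2) = p * (m' * k + m')" by (simp only: c2)
  also have "\<dots> = m * k + m" by (simp add: m_eq algebra_simps)
  finally have "p * (c + 2) = m * k + m" .
  then have pc: "p * c + 2 * p = m * k + m" by (simp add: algebra_simps)
  \<comment> \<open>The left side equals \<open>|A| + (m k + m - 2)\<close>, so no term is
    wasted.\<close>
  have size: "p * r + 3 * p - 2 \<le> size S"
  proof -
    have "p * (r + 1) = p * (p * card kernel + c)" by (simp only: r1)
    then have "p * r + p = card A + p * c" by (simp add: card_kernel algebra_simps)
    then show ?thesis using S(2) pc p2 by linarith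
  qed
  then have "p * r + 3 * p - 3 \<le> size S" by simp
  then obtain Bs where Bs: "length Bs = r" "mset (concat Bs) \<subseteq># S"
    "\<And>xs. xs \<in> set Bs \<Longrightarrow> length xs = p \<and> null_block p a b xs"
    using disjoint_null_blocks[OF p, of r S a b] by blast
  have lenB: "length (concat Bs) = p * r" using length_concat_const[of Bs p] Bs(1,3) by simp
  have "3 * p - 2 \<le> size (S - mset (concat Bs))"
    using size Bs(2) lenB by (simp add: size_Diff_submset)
  then obtain bl where bl: "mset bl \<subseteq># S - mset (concat Bs)" "length bl = p \<or> length bl = 2 * p"
      "null_block p a b bl"
    using null_block_of_size_p_or_2p[OF p, of "S - mset (concat Bs)" a b] by blast
  have all: "mset (bl @ concat Bs) \<subseteq># S"
  proof -
    have "mset bl + mset (concat Bs) \<subseteq># (S - mset (concat Bs)) + mset (concat Bs)" using bl(1) by simp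
    then show ?thesis using Bs(2) by simp
  qed
  have blA: "set bl \<subseteq> A" using all S(1) by (metis Un_subset_iff set_append set_mset_mono
      set_mset_mset subset_trans)
  have BsA: "set xs \<subseteq> A" if "xs \<in> set Bs" for xs
  proof -
    have "set xs \<subseteq> set (concat Bs)" using that by auto
    also have "\<dots> \<subseteq> A" using Bs(2) S(1) by (metis set_mset_mono set_mset_mset subset_trans)
    finally show ?thesis .
  qed
  have h: "sum_list bl \<in> kernel" by (rule null_block_sum[OF blA bl(3)])
  have R: "set_mset (mset (map sum_list Bs)) \<subseteq> kernel" using null_block_sum BsA Bs(3) by auto
  have cA: "card A = p * (p * card kernel)" by (simp add: card_kernel)
  have single: "has_zero_sum (card A) S" if "has_zero_sum (p * card kernel) (mset (map sum_list
      Cs))" "mset (concat Cs) \<subseteq># S"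
    "\<And>xs. xs \<in> set Cs \<Longrightarrow> length xs = p" for Cs
    unfolding cA by (rule has_zero_sum_blocks[OF that(2,3,1)])
  show "has_zero_sum (card A) S"
  proof (cases "length bl = p")
    case True
    have "has_zero_sum (p * card kernel) (mset (map sum_list (bl # Bs)))"
      by (rule ez_bound_multiple[OF kc(2)]) (use R h Bs(1) r1 in \<open>auto simp: c_def\<close>)
    then show ?thesis using single[of "bl # Bs"] all True Bs(3) by auto
  next
    case False
    then have bl2: "length bl = 2 * p" using bl(2) by simp
    have "has_zero_sum (p * card kernel) (mset (map sum_list Bs))
      \<or> (\<exists>us. mset us \<subseteq># mset (map sum_list Bs) \<and> length us + 2 = p * card kernel
          \<and> sum_list bl + sum_list us = 0)"
      by (rule ez_bound_double_weight[OF kernel(2,1) kc(2) R _ h p2]) (use Bs(1) r1 in \<open>simp add: c_def\<close>)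
    then show ?thesis
    proof
      assume "has_zero_sum (p * card kernel) (mset (map sum_list Bs))"
      then show ?thesis using single[of Bs] Bs(2,3) by blast
    next
      assume "\<exists>us. mset us \<subseteq># mset (map sum_list Bs) \<and> length us + 2 = p * card kernel
          \<and> sum_list bl + sum_list us = 0"
      then obtain us where us: "mset us \<subseteq># mset (map sum_list Bs)" "length us + 2 = p * card kernel"
          "sum_list bl + sum_list us = 0"
        by blast
      show ?thesis unfolding cA
        by (rule has_zero_sum_blocks_double[OF all _ bl2 us]) (use Bs(3) in blast)
    qed
  qed
qed

end

end

text \<open>\<open>k\<close> is the order of the subgroup where both coordinates vanish modulo
  \<open>m\<close>; it is the same for \<open>kernel p\<close> and \<open>m'\<close>. The least
  prime is taken because the action need not be trivial modulo the others. For \<open>m = 1\<close>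
  the bound is Olson's.\<close>

theorem ez_bound_metacyclic:
  assumes "metacyclic_coordinates A m a b u"
  shows "\<exists>k. card A = m * m * k \<and> ez_bound A (card A + (m * k + m - 2))"
  using assms
proof (induction m arbitrary: A a b rule: less_induct)
  case (less m)
  interpret metacyclic_coordinates A m a b u by (rule less.prems)
  show ?case
  proof (cases "m = 1")
    case True
    then show ?thesis using ez_bound_general[OF A] by (intro exI[of _ "card A"]) simp
  next
    case False
    define p where "p = (LEAST q. Factorial_Ring.prime q \<and> q dvd m)"
    obtain q where "Factorial_Ring.prime q \<and> q dvd m" using prime_factor_nat[OF False] by blast
    then have p: "Factorial_Ring.prime p" "p dvd m" unfolding p_def
      using LeastI[of "\<lambda>q. Factorial_Ring.prime q \<and> q dvd m"] by blast+
    have least: "p \<le> q" if "Factorial_Ring.prime q" "q dvd m" for q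
      unfolding p_def using that by (intro Least_le) auto
    obtain m' where m': "m = p * m'" using p(2) by (elim dvdE)
    have "m' > 0" using m m' by (cases m') auto
    then have "m' < m" using prime_gt_1_nat[OF p(1)] unfolding m' by simp
    note K = kernel_coordinates[OF p(1) m' least]
    obtain k where k: "card (kernel p) = m' * m' * k"
        "ez_bound (kernel p) (card (kernel p) + (m' * k + m' - 2))"
      using less.IH[OF \<open>m' < m\<close> K] by blast
    have "card A = m * m * k"
      using card_kernel[OF p(1) m' least] k(1) by (simp add: m')
    then show ?thesis using ez_bound_lift[OF p(1) m' least k] by blast
  qed
qed

section \<open>Product-one sequences\<close>

text \<open>
  The class \<open>group_add\<close> has no carriers; Cayley's embedding into the bijections of the type makes
  an arbitrary finite group a subgroup of an instance of the class.
\<close>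

typedef 'a bijection = "{f :: 'a \<Rightarrow> 'a. bij f}"
  by (rule exI[of _ id]) simp

instantiation bijection :: (type) group_add
begin

definition "0 = Abs_bijection id"
definition "f + g = Abs_bijection (Rep_bijection f \<circ> Rep_bijection g)"
definition "- f = Abs_bijection (inv_into UNIV (Rep_bijection f))"
definition "f - g = f + - (g :: 'a bijection)"

lemma bij_Rep_bijection: "bij (Rep_bijection f)"
  using Rep_bijection[of f] by simp

instance
proof
  fix f g h :: "'a bijection"
  note rep = bij_Rep_bijection
  note inverse = Abs_bijection_inverse[unfolded mem_Collect_eq]
  show "f + g + h = f + (g + h)"
    by (simp add: plus_bijection_def inverse rep bij_comp comp_assoc)
  show "0 + f = f" "f + 0 = f"
    by (simp_all add: plus_bijection_def zero_bijection_def inverse Rep_bijection_inverse)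
  show "- f + f = 0"
    using rep[of f]
    by (simp add: plus_bijection_def zero_bijection_def uminus_bijection_def inverse bij_imp_bij_inv
        bij_is_inj)
  show "f + - g = f - g" by (simp add: minus_bijection_def)
qed

end

text \<open>Being the identity outside the carrier makes it a bijection of the whole type.\<close>

definition cayley :: "('a, 'b) monoid_scheme \<Rightarrow> 'a \<Rightarrow> 'a bijection" where
  "cayley G g = Abs_bijection (\<lambda>x. if x \<in> carrier G then g \<otimes>\<^bsub>G\<^esub> x else x)"

context group
begin

lemma Rep_cayley:
  assumes "g \<in> carrier G"
  shows "Rep_bijection (cayley G g) = (\<lambda>x. if x \<in> carrier G then g \<otimes> x else x)"
proof -
  have "bij (\<lambda>x. if x \<in> carrier G then g \<otimes> x else x)"
    by (rule o_bij[where g = "\<lambda>x. if x \<in> carrier G then inv g \<otimes> x else x"])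
      (use assms in \<open>auto simp: fun_eq_iff simp flip: m_assoc\<close>)
  then show ?thesis unfolding cayley_def by (simp add: Abs_bijection_inverse)
qed

lemma cayley_mult:
  assumes "g \<in> carrier G" "h \<in> carrier G"
  shows "cayley G (g \<otimes> h) = cayley G g + cayley G h"
proof -
  have "Rep_bijection (cayley G (g \<otimes> h)) = Rep_bijection (cayley G g) \<circ> Rep_bijection (cayley G h)"
    using assms by (auto simp: Rep_cayley fun_eq_iff m_assoc)
  then show ?thesis unfolding plus_bijection_def by (metis Rep_bijection_inverse)
qed

lemma inj_cayley: "inj_on (cayley G) (carrier G)"
proof (rule inj_onI)
  fix g h assume "g \<in> carrier G" "h \<in> carrier G" "cayley G g = cayley G h"
  then have "Rep_bijection (cayley G g) \<one> = Rep_bijection (cayley G h) \<one>" by simp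
  then show "g = h" using \<open>g \<in> carrier G\<close> \<open>h \<in> carrier G\<close> by (simp add: Rep_cayley)
qed

lemma cayley_one: "cayley G \<one> = 0"
proof -
  have "cayley G \<one> + cayley G \<one> = cayley G \<one> + 0" using cayley_mult[of \<one> \<one>] by simp
  then show ?thesis by (simp only: add_left_cancel)
qed

abbreviation (input) "permutations \<equiv> cayley G ` carrier G"

lemma card_permutations: "card permutations = order G"
  by (simp add: card_image inj_cayley order_def)

lemma permutations_subgroup: "finite (carrier G) \<Longrightarrow> add_subgroup permutations"
proof (rule finite_add_subgroupI)
  show "0 \<in> permutations" using cayley_one by (metis image_eqI one_closed)
  fix x y assume "x \<in> permutations" "y \<in> permutations"
  then obtain g h where "g \<in> carrier G" "h \<in> carrier G" "x = cayley G g" "y = cayley G h" by auto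
  then show "x + y \<in> permutations" using cayley_mult[of g h] by (metis image_eqI m_closed)
qed simp

lemma foldr_closed: "set xs \<subseteq> carrier G \<Longrightarrow> foldr (\<otimes>) xs \<one> \<in> carrier G"
  by (induction xs) auto

lemma sum_list_cayley:
  assumes "set xs \<subseteq> carrier G"
  shows "sum_list (map (cayley G) xs) = cayley G (foldr (\<otimes>) xs \<one>)"
  using assms by (induction xs) (auto simp: cayley_one cayley_mult foldr_closed)

lemma product_one_subsequence:
  assumes ez: "ez_bound permutations l" and S: "sequence_over G S" "l \<le> size S"
  shows "\<exists>T. T \<subseteq># S \<and> size T = order G \<and> product_one G T"
proof -
  obtain ys where ys: "mset ys = S" using ex_mset by blast
  have ysG: "set ys \<subseteq> carrier G" using S(1) ys by (auto simp: sequence_over_def)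
  have "has_zero_sum (order G) (mset (map (cayley G) ys))"
  proof -
    have "set_mset (mset (map (cayley G) ys)) \<subseteq> permutations" using ysG by auto
    moreover have "l \<le> size (mset (map (cayley G) ys))" using S(2) ys by auto
    ultimately show ?thesis using ez unfolding ez_bound_def card_permutations by blast
  qed
  then obtain xs where xs: "mset xs \<subseteq># mset (map (cayley G) ys)" "length xs = order G" "sum_list xs = 0"
    unfolding has_zero_sum_def zero_sum_def by (metis size_mset)
  obtain cs where cs: "mset cs \<subseteq># mset ys" "map (cayley G) cs = xs" using submultiset_map[OF xs(1)]
      by blast
  have csG: "set cs \<subseteq> carrier G" using cs(1) ysG by (metis set_mset_mono set_mset_mset subset_trans)
  have "cayley G (foldr (\<otimes>) cs \<one>) = cayley G \<one>"
    using xs(3) cs(2) sum_list_cayley[OF csG] by (simp add: cayley_one)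
  then have "foldr (\<otimes>) cs \<one> = \<one>"
    using inj_cayley foldr_closed[OF csG] by (auto dest: inj_onD)
  then have "product_one G (mset cs)" unfolding product_one_def by blast
  moreover have "size (mset cs) = order G" using cs(2) xs(2) by auto
  ultimately show ?thesis using cs(1) ys by blast
qed

section \<open>The constants E and d of a finite group\<close>

lemma E_constant_le:
  assumes "ez_bound permutations l"
  shows "E_constant G \<le> l"
  unfolding E_constant_def using product_one_subsequence[OF assms] by (intro Least_le) blast

text \<open>Olson's bound shows that some length has the defining property, so the least one is
  attained.\<close>

lemma E_constant_property:
  assumes "finite (carrier G)" "sequence_over G S" "E_constant G \<le> size S"
  shows "\<exists>T. T \<subseteq># S \<and> size T = order G \<and> product_one G T"
proof -
  have "ez_bound permutations (card permutations + (card permutations - 1))"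
    using assms(1) permutations_subgroup by (intro ez_bound_general) auto
  then have "\<forall>S. sequence_over G S \<and> card permutations + (card permutations - 1) \<le> size S \<longrightarrow>
      (\<exists>T. T \<subseteq># S \<and> size T = order G \<and> product_one G T)"
    using product_one_subsequence by blast
  then have "\<forall>S. sequence_over G S \<and> E_constant G \<le> size S \<longrightarrow>
      (\<exists>T. T \<subseteq># S \<and> size T = order G \<and> product_one G T)"
    unfolding E_constant_def by (rule LeastI)
  then show ?thesis using assms(2,3) by blast
qed

lemma order_pos: "finite (carrier G) \<Longrightarrow> 0 < order G"
  by (simp add: order_gt_0_iff_finite)

text \<open>This makes the set of lengths of free sequences finite, so that its maximum is
  meaningful.\<close>

lemma free_size_less:
  assumes "finite (carrier G)" "sequence_over G S" "product_one_free G S"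
  shows "size S < E_constant G"
proof (rule ccontr)
  assume "\<not> ?thesis"
  then obtain T where T: "T \<subseteq># S" "size T = order G" "product_one G T"
    using E_constant_property[OF assms(1,2)] by auto
  then have "T \<noteq> {#}" using order_pos[OF assms(1)] by auto
  then show False using assms(3) T unfolding product_one_free_def by blast
qed

lemma finite_free_sizes:
  "finite (carrier G) \<Longrightarrow> finite {size S |S. sequence_over G S \<and> product_one_free G S}"
  by (rule finite_subset[of _ "{..<E_constant G}"]) (auto dest: free_size_less)

lemma size_le_small_davenport:
  assumes "finite (carrier G)" "sequence_over G S" "product_one_free G S"
  shows "size S \<le> small_davenport G"
  unfolding small_davenport_def using assms finite_free_sizes by (intro Max_ge) auto

lemma small_davenport_attained:
  assumes "finite (carrier G)"
  shows "\<exists>S. sequence_over G S \<and> product_one_free G S \<and> size S = small_davenport G"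
proof -
  have "0 \<in> {size S |S. sequence_over G S \<and> product_one_free G S}"
    by (auto simp: sequence_over_def product_one_free_def intro!: exI[of _ "{#}"])
  then have "small_davenport G \<in> {size S |S. sequence_over G S \<and> product_one_free G S}"
    unfolding small_davenport_def using finite_free_sizes[OF assms] by (intro Max_in) auto
  then show ?thesis by auto
qed

lemma foldr_filter_one:
  "set xs \<subseteq> carrier G \<Longrightarrow> foldr (\<otimes>) (filter (\<lambda>x. x \<noteq> \<one>) xs) \<one> = foldr (\<otimes>) xs \<one>"
  by (induction xs) (auto simp: foldr_closed)

text \<open>Deleting identities changes no product. Only \<open>|G| - 1\<close> of them are present,
  so a product-one subsequence of length \<open>|G|\<close> leaves a nonempty one inside the free
  sequence.\<close>

lemma order_add_small_davenport_le:
  assumes fin: "finite (carrier G)"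
  shows "order G + small_davenport G \<le> E_constant G"
proof (rule ccontr)
  assume less: "\<not> ?thesis"
  obtain S where S: "sequence_over G S" "product_one_free G S" "size S = small_davenport G"
    using small_davenport_attained[OF fin] by blast
  define S' where "S' = S + replicate_mset (order G - 1) \<one>"
  have S'G: "sequence_over G S'" using S(1) by (auto simp: S'_def sequence_over_def)
  have "E_constant G \<le> size S'" using less S(3) order_pos[OF fin] by (simp add: S'_def)
  then obtain T where T: "T \<subseteq># S'" "size T = order G" "product_one G T"
    using E_constant_property[OF fin S'G] by blast
  obtain as where as: "mset as = T" "foldr (\<otimes>) as \<one> = \<one>" using T(3) unfolding product_one_def by blast
  have asG: "set as \<subseteq> carrier G"
    using as(1) T(1) S'G unfolding sequence_over_def by (metis set_mset_mono set_mset_mset subset_trans)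
  have free_one: "\<one> \<notin># S"
  proof
    assume "\<one> \<in># S"
    moreover have "product_one G {#\<one>#}" unfolding product_one_def by (rule exI[of _ "[\<one>]"]) simp
    ultimately show False using S(2) unfolding product_one_free_def
        by (metis mset_subset_eq_single empty_not_add_mset)
  qed
  define T1 where "T1 = filter_mset (\<lambda>x. x \<noteq> \<one>) T"
  have "T1 \<subseteq># filter_mset (\<lambda>x. x \<noteq> \<one>) S'" unfolding T1_def by (rule multiset_filter_mono[OF T(1)])
  also have "filter_mset (\<lambda>x. x \<noteq> \<one>) S' = filter_mset (\<lambda>x. x \<noteq> \<one>) S"
  proof -
    have "filter_mset (\<lambda>x. x \<noteq> \<one>) (replicate_mset k \<one>) = {#}" for k by (induction k) auto
    then show ?thesis by (simp add: S'_def)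
  qed
  also have "\<dots> \<subseteq># S" by simp
  finally have sub: "T1 \<subseteq># S" .
  have "product_one G T1"
    unfolding product_one_def T1_def
    using as foldr_filter_one[OF asG] by (intro exI[of _ "filter (\<lambda>x. x \<noteq> \<one>) as"]) auto
  moreover have "T1 \<noteq> {#}"
  proof
    assume "T1 = {#}"
    then have "set_mset T1 = {}" by simp
    then have "set_mset T \<subseteq> {\<one>}" unfolding T1_def set_mset_filter by auto
    then have "T = replicate_mset (order G) \<one>" using T(2)
        by (metis set_mset_subset_singletonD size_replicate_mset)
    then have "count T \<one> = order G" by simp
    moreover have "count T \<one> \<le> count S' \<one>" using T(1) by (rule mset_subset_eq_count)
    moreover have "count S' \<one> = order G - 1" using free_one by (simp add: S'_def not_in_iff)
    ultimately show False using order_pos[OF fin] by simp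
  qed
  ultimately show False using S(2) sub unfolding product_one_free_def by blast
qed

end

section \<open>The group C_m \<ltimes> C_b in coordinates\<close>

context
  fixes m b :: nat and \<phi> :: "int \<Rightarrow> int \<Rightarrow> int"
  assumes m: "m > 0" and b: "b > 0" and \<phi>: "\<phi> \<in> cyclic_actions m b"
begin

abbreviation (input) "P \<equiv> cyclic_semidirect_product m \<phi> b"

lemma carrier_P: "carrier P = {0..<int m} \<times> {0..<int b}"
  using m b by (simp add: cyclic_semidirect_product_def semidirect_product_def carrier_integer_mod_group)

lemma mult_P: "(h, x) \<otimes>\<^bsub>P\<^esub> (h', x') = ((h + h') mod int m, (x + \<phi> h x') mod int b)"
  by (simp add: cyclic_semidirect_product_def semidirect_product_def)

lemma one_P: "\<one>\<^bsub>P\<^esub> = (0, 0)"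
  by (simp add: cyclic_semidirect_product_def semidirect_product_def)

lemma group_P: "group P"
  unfolding cyclic_semidirect_product_def
  by (rule group_semidirect_product) (use \<phi> in \<open>simp_all add: cyclic_actions_def\<close>)

lemma \<phi>_auto:
  assumes "h \<in> {0..<int m}"
  shows "\<phi> h \<in> auto (integer_mod_group b)"
proof -
  have "\<phi> h \<in> carrier (AutoGroup (integer_mod_group b))"
    using \<phi> assms m by (auto simp: cyclic_actions_def hom_def carrier_integer_mod_group)
  then show ?thesis by (simp add: AutoGroup_def)
qed

lemma \<phi>_closed: "h \<in> {0..<int m} \<Longrightarrow> x \<in> {0..<int b} \<Longrightarrow> \<phi> h x \<in> {0..<int b}"
  using \<phi>_auto[of h] b by (auto simp: auto_def hom_def carrier_integer_mod_group)

lemma \<phi>_add: "h \<in> {0..<int m} \<Longrightarrow> x \<in> {0..<int b} \<Longrightarrow> y \<in> {0..<int b}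
    \<Longrightarrow> \<phi> h ((x + y) mod int b) = (\<phi> h x + \<phi> h y) mod int b"
  using \<phi>_auto[of h] b by (auto simp: auto_def hom_def carrier_integer_mod_group)

lemma \<phi>_comp:
  assumes "h \<in> {0..<int m}" "h' \<in> {0..<int m}" "x \<in> {0..<int b}"
  shows "\<phi> ((h + h') mod int m) x = \<phi> h (\<phi> h' x)"
proof -
  have "\<phi> ((h + h') mod int m) = \<phi> h \<otimes>\<^bsub>AutoGroup (integer_mod_group b)\<^esub> \<phi> h'"
    using \<phi> assms(1,2) m by (auto simp: cyclic_actions_def hom_def carrier_integer_mod_group)
  then show ?thesis
    using \<phi>_auto[OF assms(1)] \<phi>_auto[OF assms(2)] assms(3) b
    by (simp add: AutoGroup_def BijGroup_def auto_def compose_eq carrier_integer_mod_group)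
qed

lemma \<phi>_zero: "x \<in> {0..<int b} \<Longrightarrow> \<phi> 0 x = x"
proof -
  assume x: "x \<in> {0..<int b}"
  interpret H: group_hom "integer_mod_group m" "AutoGroup (integer_mod_group b)" \<phi>
    using \<phi> by (intro group_hom.intro group_hom_axioms.intro) (simp_all add: cyclic_actions_def
        group.AutoGroup)
  show ?thesis using H.hom_one x b by (simp add: AutoGroup_def BijGroup_def carrier_integer_mod_group)
qed

text \<open>An endomorphism of a cyclic group is multiplication by the image of a generator. The
  generator is written \<open>1 mod int b\<close> because 1 is not in the carrier when
  \<open>b = 1\<close>.\<close>

lemma \<phi>_linear:
  assumes h: "h \<in> {0..<int m}" and j: "j < b"
  shows "[\<phi> h (int j) = \<phi> h (1 mod int b) * int j] (mod int b)"
  using j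
proof (induction j)
  case 0
  have "\<phi> h ((0 + 0) mod int b) = (\<phi> h 0 + \<phi> h 0) mod int b" using b by (intro \<phi>_add[OF h]) auto
  then have "\<phi> h 0 = (\<phi> h 0 + \<phi> h 0) mod int b" by simp
  then have "[\<phi> h 0 = \<phi> h 0 + \<phi> h 0] (mod int b)" unfolding cong_def by (metis mod_mod_trivial)
  then have "[\<phi> h 0 + 0 = \<phi> h 0 + \<phi> h 0] (mod int b)" by simp
  then have "[0 = \<phi> h 0] (mod int b)" using cong_add_lcancel by blast
  then show ?case by (simp add: cong_sym_eq)
next
  case (Suc j)
  have b1: "1 mod int b = 1" using Suc.prems by simp
  have "\<phi> h ((int j + 1) mod int b) = (\<phi> h (int j) + \<phi> h 1) mod int b"
    using Suc.prems by (intro \<phi>_add[OF h]) auto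
  moreover have "(int j + 1) mod int b = int (Suc j)" using Suc.prems by (simp add: add.commute)
  ultimately have "[\<phi> h (int (Suc j)) = \<phi> h (int j) + \<phi> h 1] (mod int b)" by (simp add: cong_def)
  moreover have "[\<phi> h (int j) + \<phi> h 1 = \<phi> h 1 * int j + \<phi> h 1] (mod int b)"
    using Suc b1 by (intro cong_add) auto
  ultimately have "[\<phi> h (int (Suc j)) = \<phi> h 1 * int j + \<phi> h 1] (mod int b)" by (rule cong_trans)
  then show ?case unfolding b1 by (simp add: algebra_simps)
qed

lemma \<phi>_linear_int:
  assumes h: "h \<in> {0..<int m}" and x: "x \<in> {0..<int b}"
  shows "[\<phi> h x = \<phi> h (1 mod int b) * x] (mod int b)"
  using \<phi>_linear[OF h, of "nat x"] x by (simp add: nat_less_iff)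

text \<open>The action is by multiplications, so it is compatible with reducing the second
  coordinate modulo \<open>m\<close>. Hence every \<open>b\<close> divisible by \<open>m\<close> is
  admissible, which covers \<open>C_m\<close> and \<open>C_mn\<close> as normal factor
  together.\<close>

lemma metacyclic_from_hom:
  fixes G (structure)
  assumes G: "group G" "finite (carrier G)" and F: "F \<in> hom G P" "F ` carrier G = carrier P" and mb:
      "m dvd b"
  shows "\<exists>a c u. metacyclic_coordinates (cayley G ` carrier G) m a c u"
proof -
  interpret group G by (rule G(1))
  define r where "r = the_inv_into (carrier G) (cayley G)"
  have r: "r (cayley G x) = x" if "x \<in> carrier G" for x
    unfolding r_def using the_inv_into_f_f[OF inj_cayley that] .
  define a where "a z = fst (F (r z))" for z
  define c where "c z = snd (F (r z))" for z
  define u where "u z = \<phi> (a z) (1 mod int b)" for z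
  have FP: "fst (F x) \<in> {0..<int m}" "snd (F x) \<in> {0..<int b}" if "x \<in> carrier G" for x
  proof -
    have "F x \<in> {0..<int m} \<times> {0..<int b}" using that F(2) unfolding carrier_P by blast
    then show "fst (F x) \<in> {0..<int m}" "snd (F x) \<in> {0..<int b}" by (simp_all only: mem_Times_iff)
  qed
  have Fm: "F (x \<otimes> y) = ((fst (F x) + fst (F y)) mod int m, (snd (F x) + \<phi> (fst (F x)) (snd (F y)))
      mod int b)"
    if "x \<in> carrier G" "y \<in> carrier G" for x y
    using F(1) that mult_P[of "fst (F x)" "snd (F x)" "fst (F y)" "snd (F y)"] by (auto simp: hom_def)
  have one_b: "1 mod int b \<in> {0..<int b}" using b by simp
  have "int m dvd int b" using mb by simp
  then have mod_b: "[x = y] (mod int m)" if "[x = y] (mod int b)" for x y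
    by (rule cong_dvd_modulus[OF that])
  have "metacyclic_coordinates (cayley G ` carrier G) m a c u"
  proof
    show "finite permutations" using G(2) by simp
    show "add_subgroup permutations" by (rule permutations_subgroup[OF G(2)])
    show "0 < m" by (rule m)
    fix z w assume "z \<in> permutations" "w \<in> permutations"
    then obtain x y where xy: "x \<in> carrier G" "y \<in> carrier G" "z = cayley G x" "w = cayley G y" by auto
    have zw: "z + w = cayley G (x \<otimes> y)" using xy cayley_mult by simp
    have rr: "r z = x" "r w = y" "r (z + w) = x \<otimes> y" using xy zw r by auto
    note fx = FP[OF xy(1)] and fy = FP[OF xy(2)]
    show "[a (z + w) = a z + a w] (mod int m)"
      unfolding a_def rr Fm[OF xy(1,2)] by (simp add: cong_def)
    have "[c (z + w) = snd (F x) + \<phi> (fst (F x)) (snd (F y))] (mod int b)"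
      unfolding c_def rr Fm[OF xy(1,2)] by (simp add: cong_def)
    moreover have "[snd (F x) + \<phi> (fst (F x)) (snd (F y))
        = snd (F x) + \<phi> (fst (F x)) (1 mod int b) * snd (F y)] (mod int b)"
      by (intro cong_add cong_refl \<phi>_linear_int fx fy)
    ultimately have "[c (z + w) = snd (F x) + \<phi> (fst (F x)) (1 mod int b) * snd (F y)] (mod int b)"
      by (rule cong_trans)
    then have "[c (z + w) = c z + u z * c w] (mod int b)" by (simp add: c_def u_def a_def rr)
    then show "[c (z + w) = c z + u z * c w] (mod int m)" by (rule mod_b)
    have "u (z + w) = \<phi> (fst (F x)) (\<phi> (fst (F y)) (1 mod int b))"
      unfolding u_def a_def rr Fm[OF xy(1,2)] using \<phi>_comp[OF fx(1) fy(1) one_b] by simp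
    moreover have "[\<phi> (fst (F x)) (\<phi> (fst (F y)) (1 mod int b))
        = \<phi> (fst (F x)) (1 mod int b) * \<phi> (fst (F y)) (1 mod int b)] (mod int b)"
      by (intro \<phi>_linear_int fx \<phi>_closed fy one_b)
    ultimately have "[u (z + w) = u z * u w] (mod int b)" by (simp add: u_def a_def rr)
    then show "[u (z + w) = u z * u w] (mod int m)" by (rule mod_b)
  next
    fix z assume "z \<in> permutations" and az: "[a z = 0] (mod int m)"
    then obtain x where x: "x \<in> carrier G" "z = cayley G x" by auto
    have "a z \<in> {0..<int m}" using FP(1)[OF x(1)] x r by (simp add: a_def)
    then have "a z = 0" using az by (simp add: cong_def)
    then have "u z = 1 mod int b" unfolding u_def using \<phi>_zero[OF one_b] by simp
    then have "[u z = 1] (mod int b)" by (simp add: cong_def)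
    then show "[u z = 1] (mod int m)" by (rule mod_b)
  next
    fix i j
    have "(i mod int m, j mod int b) \<in> F ` carrier G" unfolding F(2) carrier_P using m b by simp
    then obtain x where x: "x \<in> carrier G" "F x = (i mod int m, j mod int b)" by (metis imageE)
    have "[a (cayley G x) = i] (mod int m)" "[c (cayley G x) = j] (mod int b)"
      by (simp_all add: a_def c_def r x cong_def)
    then show "\<exists>z\<in>permutations. [a z = i] (mod int m) \<and> [c z = j] (mod int m)"
      using x(1) mod_b by blast
  qed
  then show ?thesis by blast
qed

lemma E_constant_upper:
  fixes G (structure)
  assumes G: "group G" "finite (carrier G)" and F: "F \<in> hom G P" "F ` carrier G = carrier P" and mb:
      "m dvd b"
  shows "\<exists>k. order G = m * m * k \<and> E_constant G \<le> order G + (m * k + m - 2)"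
proof -
  interpret group G by (rule G(1))
  obtain a c u where "metacyclic_coordinates permutations m a c u"
    using metacyclic_from_hom[OF assms] by blast
  from ez_bound_metacyclic[OF this] obtain k
    where k: "card permutations = m * m * k" "ez_bound permutations (card permutations + (m * k + m
        - 2))" by blast
  then show ?thesis using E_constant_le[OF k(2)] unfolding card_permutations by blast
qed

text \<open>The first coordinate counts the copies of \<open>y\<close> modulo \<open>m\<close>, so a
  product-one subsequence contains none. What remains is a power of \<open>x\<close> with exponent
  below its order \<open>b\<close>.\<close>

lemma small_davenport_lower:
  fixes G (structure)
  assumes G: "group G" "finite (carrier G)" and F: "F \<in> iso G P"
  shows "(b - 1) + (m - 1) \<le> small_davenport G"
proof -
  interpret group G by (rule G(1))
  have Fh: "F \<in> hom G P" and Fb: "F ` carrier G = carrier P" "inj_on F (carrier G)"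
    using F by (auto simp: iso_def bij_betw_def)
  obtain x where x: "x \<in> carrier G" "F x = (0, 1 mod int b)"
  proof -
    have "(0, 1 mod int b) \<in> F ` carrier G" unfolding Fb(1) carrier_P using m b by simp
    then show ?thesis using that by (metis imageE)
  qed
  obtain y where y: "y \<in> carrier G" "F y = (1 mod int m, 0)"
  proof -
    have "(1 mod int m, 0) \<in> F ` carrier G" unfolding Fb(1) carrier_P using m b by simp
    then show ?thesis using that by (metis imageE)
  qed
  have F1: "F \<one> = (0, 0)" using hom_one[OF Fh G(1) group_P] one_P by simp
  have Fm: "F (z \<otimes> w) = ((fst (F z) + fst (F w)) mod int m, (snd (F z) + \<phi> (fst (F z)) (snd (F w)))
      mod int b)"
    if "z \<in> carrier G" "w \<in> carrier G" for z w
    using Fh that mult_P[of "fst (F z)" "snd (F z)" "fst (F w)" "snd (F w)"] by (auto simp: hom_def)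
  define S where "S = replicate_mset (b - 1) x + replicate_mset (m - 1) y"
  have "sequence_over G S" using x y by (auto simp: S_def sequence_over_def)
  moreover have "product_one_free G S"
    unfolding product_one_free_def
  proof
    assume "\<exists>T. T \<subseteq># S \<and> T \<noteq> {#} \<and> product_one G T"
    then obtain T where T: "T \<subseteq># S" "T \<noteq> {#}" "product_one G T" by blast
    \<comment> \<open>Splitting by intersection requires no distinction of \<open>x\<close> from
      \<open>y\<close>; they coincide if \<open>m = b = 1\<close>.\<close>
    define Tx where "Tx = T \<inter># replicate_mset (b - 1) x"
    have "T - Tx \<subseteq># replicate_mset (m - 1) y"
      using T(1) unfolding Tx_def S_def
      by (metis add.commute subset_eq_diff_conv diff_intersect_left_idem)
    then obtain j where j: "j \<le> m - 1" "T - Tx = replicate_mset j y" by (metis msubseteq_replicate_msetE)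
    have "Tx \<subseteq># replicate_mset (b - 1) x" by (simp add: Tx_def)
    then obtain i where i: "i \<le> b - 1" "Tx = replicate_mset i x" by (metis msubseteq_replicate_msetE)
    have Tij: "T = replicate_mset i x + replicate_mset j y"
      using subset_mset.add_diff_inverse[of Tx T] unfolding i(2)[symmetric] j(2)[symmetric]
          by (simp add: Tx_def)
    obtain as where as: "mset as = T" "foldr (\<otimes>) as \<one> = \<one>" using T(3) unfolding product_one_def by blast
    have "set as = set_mset T" using as(1) by (metis set_mset_mset)
    then have asG: "set as \<subseteq> carrier G" using Tij x(1) y(1) by auto
    have "[fst (F (foldr (\<otimes>) as \<one>)) = sum_list (map (\<lambda>z. fst (F z)) as)] (mod int m)" using asG
    proof (induction as)
      case (Cons z zs)
      have "[fst (F z) + fst (F (foldr (\<otimes>) zs \<one>))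
          = fst (F z) + sum_list (map (\<lambda>z. fst (F z)) zs)] (mod int m)"
        using Cons by (intro cong_add) auto
      then show ?case using Cons.prems by (simp add: Fm foldr_closed cong_def)
    qed (simp add: F1)
    then have "[0 = sum_mset (image_mset (\<lambda>z. fst (F z)) T)] (mod int m)"
      using as F1 by (metis fst_conv mset_map sum_mset_sum_list)
    moreover have "sum_mset (image_mset (\<lambda>z. fst (F z)) T) = int j * (1 mod int m)"
      by (simp add: Tij x(2) y(2))
    moreover have "[int j * (1 mod int m) = int j * 1] (mod int m)"
        by (intro cong_mult) (auto simp: cong_def)
    ultimately have "[0 = int j] (mod int m)" using cong_trans by fastforce
    then have "int j mod int m = 0" by (simp add: cong_def)
    moreover have "j < m" using j(1) m by simp
    ultimately have j0: "j = 0" by simp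
    then have Tx: "T = replicate_mset i x" using Tij by simp
    have "length as = i" using as(1) Tx by (metis size_mset size_replicate_mset)
    moreover have "\<forall>z\<in>set as. z = x" using \<open>set as = set_mset T\<close> Tx by (simp split: if_splits)
    ultimately have "as = replicate i x" using replicate_length_same[of as x] by simp
    moreover have "F (foldr (\<otimes>) (replicate l x) \<one>) = (0, int l mod int b)" for l
    proof (induction l)
      case (Suc l)
      have "foldr (\<otimes>) (replicate l x) \<one> \<in> carrier G" using x(1) by (intro foldr_closed) auto
      moreover have "int l mod int b \<in> {0..<int b}" using b by simp
      ultimately show ?case using Suc x \<phi>_zero[of "int l mod int b"] m by (simp add: Fm mod_simps)
    qed (simp add: F1)
    ultimately have "int i mod int b = 0" using as(2) F1 by (metis snd_conv)
    moreover have "i < b" using i(1) b by simp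
    ultimately have "i = 0" by simp
    then show False using T(2) Tx by simp
  qed
  ultimately have "size S \<le> small_davenport G" by (rule size_le_small_davenport[OF G(2)])
  then show ?thesis by (simp add: S_def)
qed

end

theorem theorem1p2:
  fixes G :: "('a, 'b) monoid_scheme" and m :: nat
  assumes "group G" and "finite (carrier G)" and "m > 0"
  shows "((\<exists>N \<phi>. N \<lhd> G \<and> \<phi> \<in> cyclic_actions m m \<and> (G Mod N) \<cong> cyclic_semidirect_product m \<phi> m)
           \<longrightarrow> order G + small_davenport G \<le> E_constant G
             \<and> real (E_constant G) \<le> real (order G) + real (order G) / real m + real m - 2)
       \<and> (\<forall>n::nat. n > 0 \<and> (\<exists>\<phi>. \<phi> \<in> cyclic_actions m (m * n) \<and> G \<cong> cyclic_semidirect_product m \<phi> (m * n))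
           \<longrightarrow> E_constant G = order G + small_davenport G
             \<and> int (E_constant G) = int m ^ 2 * int n + int m * int n + int m - 2
             \<and> int (small_davenport G) = int m * int n + int m - 2)"
proof (intro conjI impI allI; elim exE conjE)
  interpret group G by (rule assms(1))
  note lower = order_add_small_davenport_le[OF assms(2)]
  show "order G + small_davenport G \<le> E_constant G" by (rule lower)
  {
    fix N \<phi> assume N: "N \<lhd> G" and \<phi>: "\<phi> \<in> cyclic_actions m m" and iso:
        "(G Mod N) \<cong> cyclic_semidirect_product m \<phi> m"
    interpret N: normal N G by (rule N)
    obtain f where f: "f \<in> iso (G Mod N) (cyclic_semidirect_product m \<phi> m)" using iso
        unfolding is_iso_def by blast
    define F where "F = f \<circ> (\<lambda>g. N #>\<^bsub>G\<^esub> g)"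
    have "F \<in> hom G (cyclic_semidirect_product m \<phi> m)"
      unfolding F_def using f by (intro Group.hom_compose[OF N.r_coset_hom_Mod]) (auto simp: iso_def)
    moreover have "F ` carrier G = carrier (cyclic_semidirect_product m \<phi> m)"
    proof -
      have "(\<lambda>g. N #>\<^bsub>G\<^esub> g) ` carrier G = carrier (G Mod N)" by (auto simp: FactGroup_def RCOSETS_def)
      then show ?thesis using f unfolding F_def image_comp[symmetric] by (simp add: iso_def bij_betw_def)
    qed
    ultimately obtain k where k: "order G = m * m * k" "E_constant G \<le> order G + (m * k + m - 2)"
      using E_constant_upper[OF assms(3,3) \<phi> assms(1,2) _ _ dvd_refl] by blast
    \<comment> \<open>Positivity makes the truncated \<open>m * k + m - 2\<close> a true
      difference.\<close>
    have "k > 0" using k(1) order_pos[OF assms(2)] by (cases k) auto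
    then have "m * k \<ge> 1" using assms(3) by simp
    then have "m * k + m \<ge> 2" using assms(3) by linarith
    then have "real (E_constant G) \<le> real (order G) + (real (m * k) + real m - 2)" using k(2) by linarith
    moreover have "real (order G) / real m = real (m * k)" using k(1) assms(3) by simp
    ultimately show "real (E_constant G) \<le> real (order G) + real (order G) / real m + real m - 2" by simp
  }
  fix n \<phi> assume n: "n > 0" and \<phi>: "\<phi> \<in> cyclic_actions m (m * n)" and iso:
      "G \<cong> cyclic_semidirect_product m \<phi> (m * n)"
  obtain F where F: "F \<in> iso G (cyclic_semidirect_product m \<phi> (m * n))" using iso
      unfolding is_iso_def by blast
  have mn: "m * n > 0" using n assms(3) by simp
  have cP: "order G = m * (m * n)"
    using iso_same_card[OF iso] carrier_P[OF assms(3) mn \<phi>] by (simp add: order_def nat_mult_distrib)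
  have "F \<in> hom G (cyclic_semidirect_product m \<phi> (m * n))"
    and "F ` carrier G = carrier (cyclic_semidirect_product m \<phi> (m * n))"
    using F by (auto simp: iso_def bij_betw_def)
  then obtain k where k: "order G = m * m * k" "E_constant G \<le> order G + (m * k + m - 2)"
    using E_constant_upper[OF assms(3) mn \<phi> assms(1,2)] by (metis dvd_triv_left)
  have kn: "k = n" using k(1) cP assms(3) by simp
  have d: "(m * n - 1) + (m - 1) \<le> small_davenport G"
    by (rule small_davenport_lower[OF assms(3) mn \<phi> assms(1,2) F])
  have "m * n \<ge> 1" using mn by simp
  \<comment> \<open>The explicit free sequence reaches the upper bound for
    \<open>E_constant G\<close>, so all inequalities in between are equalities.\<close>
  then have E: "E_constant G = order G + small_davenport G" and d': "small_davenport G + 2 = m * n + m"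
    using d k(2) lower assms(3) unfolding kn by linarith+
  show "E_constant G = order G + small_davenport G" by (rule E)
  have "int (small_davenport G) + 2 = int m * int n + int m" using d'
      by (metis of_nat_add of_nat_mult of_nat_numeral)
  then show dd: "int (small_davenport G) = int m * int n + int m - 2" by simp
  have "int (E_constant G) = int (m * (m * n)) + int (small_davenport G)" by (simp only: E cP of_nat_add)
  then show "int (E_constant G) = int m ^ 2 * int n + int m * int n + int m - 2"
    unfolding dd by (simp add: power2_eq_square algebra_simps)
qed

end
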